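(* Let $d\ge1$ and let $M,K_{\mathrm{IR}},\zeta>0$ be given. Suppose $(Q,g)\in\mathcal{Q}_{M,K_{\mathrm{IR}},\zeta}$. Let $\eta_j=\sum_{y\in\mathbb{Z}^d}y_jQ(y)$ and $\Lambda_{jl}=\sum_{y\in\mathbb{Z}^d}y_jy_lQ(y)$, and let $x\in\mathbb{Z}^d$ be a nonzero vector in the same direction as $\eta$, i.e., $\eta=|\eta|\hat x$ ($\eta=0$ is permitted here). If $d\le2$, we further assume $|x||\eta|\ge s_0$ for some $s_0>0$. Then, as $|x|\to\infty$, $$G_{Q,g}(x):=\int_0^\infty dt\int_{\mathbb{T}^d}\frac{dk}{(2\pi)^d}\,e^{ik\cdot x}\,\hat g(k)\,e^{-t[\hat Q(0)-\hat Q(k)]}=\mathbb{C}(x;\eta,\Lambda)\Bigl[\hat g(0)+O\Bigl(\frac1{|x|^{\varepsilon}}\Bigr)\Bigr]$$ with some $\varepsilon>0$ and with the constant depending only on $d,\zeta,M,K_{\mathrm{IR}},s_0$.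
   Context: Notation. $|x|=\|x\|_2$ is the Euclidean norm on $\mathbb{R}^d$; $\hat x=x/|x|$; $a\wedge b=\min\{a,b\}$; $\mathbb{T}^d$ is the $d$-dimensional torus of period $2\pi$. For $f:\mathbb{Z}^d\to\mathbb{R}$, $\hat f(k)=\sum_{x\in\mathbb{Z}^d}f(x)e^{-ik\cdot x}$, and $\|f(y)\|_p$ is the $\ell^p(\mathbb{Z}^d)$ norm. Class $\mathcal{Q}_{M,K_{\mathrm{IR}},\zeta}$: the set of pairs $(Q,g)$ of functions $\mathbb{Z}^d\to\mathbb{R}$ such that (a) $\|Q(y)\|_1\le M$ and $\||y|^{2+\zeta}Q(y)\|_1\le M$; (b) $\mathrm{Re}[\hat Q(0)-\hat Q(k)]\ge K_{\mathrm{IR}}|k|^2$ for $k\in\mathbb{T}^d$ (represented in $[-\pi,\pi]^d$); (c) $\|g(y)\|_1\le M$, $\||y|^{\zeta}g(y)\|_1\le M$, $\||y|^2g(y)\|_{p_d\wedge2}\le M$, where $p_d=2$ for $d=1$ and $p_d=\frac{d}{d-2+(\zeta\wedge2)}$ for $d\ge2$; (d) if $d\ge4$, additionally $\||y|^{d-1}Q(y)\|_{\frac d3\wedge2}\le M$ and $\||y|^{d-1}g(y)\|_2\le M$. (These conditions imply that $\Lambda$ is positive-definite.) Brownian Green function: for $\eta\in\mathbb{R}^d$ and symmetric positive-definite $\Lambda$, $\mathbb{C}(x;\eta,\Lambda)=\int_0^\infty\rho_t(x;\eta,\Lambda)\,dt$ with $\rho_t(x;\eta,\Lambda)=\frac{1}{\sqrt{\det\Lambda}}\frac{1}{(2\pi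 t)^{d/2}}\exp\{-\frac1{2t}(x-t\eta)\cdot\Lambda^{-1}(x-t\eta)\}$. Convention: the asymptotic formula means that the error term is bounded in absolute value by $C|x|^{-\varepsilon}$ for all pairs $(Q,g)\in\mathcal{Q}_{M,K_{\mathrm{IR}},\zeta}$ and all nonzero $x\in\mathbb{Z}^d$ with $|x|\ge R$ such that the vector $\eta$ with components $\eta_j=\sum_{y\in\mathbb{Z}^d}y_jQ(y)$ satisfies $\eta=|\eta|\hat x$ and, if $d\le2$, also $|x||\eta|\ge s_0$, where $\varepsilon,C,R$ depend only on the listed parameters $d,\zeta,M,K_{\mathrm{IR}},s_0$ ($s_0$ being relevant only for $d\le2$). *)

theory Defs
  imports "HOL-Analysis.Analysis"
begin

definition rvec :: "int ^ 'd::finite \<Rightarrow> real ^ 'd" where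
  "rvec y = (\<chi> i. real_of_int (y $ i))"

text \<open>The counting-measure $\ell^p$ norm, for $0 < p < \infty$, with value $\infty$ if the
  defining series diverges.\<close>

definition lp_norm :: "real \<Rightarrow> (int ^ 'd::finite \<Rightarrow> real) \<Rightarrow> ennreal" where
  "lp_norm p f =
     (if (\<lambda>y. \<bar>f y\<bar> powr p) summable_on UNIV
      then ennreal ((\<Sum>\<^sub>\<infinity>y. \<bar>f y\<bar> powr p) powr (1 / p)) else \<infinity>)"

definition fourier :: "(int ^ 'd::finite \<Rightarrow> real) \<Rightarrow> real ^ 'd \<Rightarrow> complex" where
  "fourier f k = (\<Sum>\<^sub>\<infinity>y. complex_of_real (f y) * exp (- (\<i> * complex_of_real (k \<bullet> rvec y))))"

text \<open>The fundamental domain $[-\pi,\pi]^d$ representing the torus of period $2\pi$.\<close>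

definition torus :: "(real ^ 'd::finite) set" where
  "torus = cbox (\<chi> i. - pi) (\<chi> i. pi)"

definition p_exp :: "nat \<Rightarrow> real \<Rightarrow> real" where
  "p_exp d \<zeta> = (if d = 1 then 2 else real d / (real d - 2 + min \<zeta> 2))"

definition class_Q ::
  "real \<Rightarrow> real \<Rightarrow> real \<Rightarrow> ((int ^ 'd::finite \<Rightarrow> real) \<times> (int ^ 'd \<Rightarrow> real)) set" where
  "class_Q M K_IR \<zeta> = {(Q, g).
     lp_norm 1 Q \<le> ennreal M \<and>
     lp_norm 1 (\<lambda>y. norm (rvec y) powr (2 + \<zeta>) * Q y) \<le> ennreal M \<and>
     (\<forall>k\<in>torus. Re (fourier Q 0 - fourier Q k) \<ge> K_IR * (norm k)\<^sup>2) \<and>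
     lp_norm 1 g \<le> ennreal M \<and>
     lp_norm 1 (\<lambda>y. norm (rvec y) powr \<zeta> * g y) \<le> ennreal M \<and>
     lp_norm (min (p_exp CARD('d) \<zeta>) 2) (\<lambda>y. (norm (rvec y))\<^sup>2 * g y) \<le> ennreal M \<and>
     (CARD('d) \<ge> 4 \<longrightarrow>
        lp_norm (min (real CARD('d) / 3) 2)
          (\<lambda>y. norm (rvec y) ^ (CARD('d) - 1) * Q y) \<le> ennreal M \<and>
        lp_norm 2 (\<lambda>y. norm (rvec y) ^ (CARD('d) - 1) * g y) \<le> ennreal M)}"

definition drift :: "(int ^ 'd::finite \<Rightarrow> real) \<Rightarrow> real ^ 'd" where
  "drift Q = (\<chi> j. \<Sum>\<^sub>\<infinity>y. real_of_int (y $ j) * Q y)"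

definition second_moment :: "(int ^ 'd::finite \<Rightarrow> real) \<Rightarrow> real ^ 'd ^ 'd" where
  "second_moment Q = (\<chi> j l. \<Sum>\<^sub>\<infinity>y. real_of_int (y $ j) * real_of_int (y $ l) * Q y)"

definition rho :: "real \<Rightarrow> real ^ 'd::finite \<Rightarrow> real ^ 'd \<Rightarrow> real ^ 'd ^ 'd \<Rightarrow> real" where
  "rho t x \<eta> \<Lambda> =
     1 / sqrt (det \<Lambda>) * (1 / (2 * pi * t) powr (real CARD('d) / 2)) *
     exp (- (1 / (2 * t)) * ((x - t *\<^sub>R \<eta>) \<bullet> (matrix_inv \<Lambda> *v (x - t *\<^sub>R \<eta>))))"

definition brownian_green :: "real ^ 'd::finite \<Rightarrow> real ^ 'd \<Rightarrow> real ^ 'd ^ 'd \<Rightarrow> real" where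
  "brownian_green x \<eta> \<Lambda> = (LINT t:{0<..}|lborel. rho t x \<eta> \<Lambda>)"

definition green_inner ::
  "(int ^ 'd::finite \<Rightarrow> real) \<Rightarrow> (int ^ 'd \<Rightarrow> real) \<Rightarrow> int ^ 'd \<Rightarrow> real \<Rightarrow> complex" where
  "green_inner Q g x t =
     (LINT k:torus|lborel.
        exp (\<i> * complex_of_real (k \<bullet> rvec x)) * fourier g k *
        exp (- (complex_of_real t * (fourier Q 0 - fourier Q k)))
        / complex_of_real ((2 * pi) ^ CARD('d)))"

definition green ::
  "(int ^ 'd::finite \<Rightarrow> real) \<Rightarrow> (int ^ 'd \<Rightarrow> real) \<Rightarrow> int ^ 'd \<Rightarrow> complex" where
  "green Q g x = (LINT t:{0<..}|lborel. green_inner Q g x t)"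

end

theory Submission
  imports Defs "HOL-Probability.Probability"
begin

text \<open>
  Let \<open>p t x\<close> be the inner (torus) integral of the Green function and \<open>\<rho> t x\<close> the Gaussian density. The
  difference \<open>p t x - ghat(0) \<rho> t x\<close> is integrated in absolute value over \<open>t\<close> and compared with the lower
  bound \<open>|x|^(2-d) (1 + |x| |\<eta>|)^((d-3)/2)\<close> of the Brownian Green function.

  Expanding the Fourier transforms at \<open>k = 0\<close> gives the error \<open>O(t^(-d/2-\<epsilon>))\<close> uniformly in \<open>x\<close>. This suffices
  when \<open>x - t \<eta>\<close> is at most about \<open>sqrt t\<close>. When \<open>D = |x - t \<eta>|\<close> exceeds \<open>t^(1/2+\<delta>)\<close>, both terms are small
  separately. For \<open>p t x\<close>, cut \<open>Q\<close> and \<open>g\<close> off at the radius \<open>r = D^(1-\<delta>)\<close>: shifting the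
  contour of the truncated trigonometric integrand by an imaginary vector of length \<open>1/r\<close> gains the factor
  \<open>exp (-D/r)\<close>, and the removed tails are controlled by the weighted \<open>l^p\<close> hypotheses, where an elementary
  splitting argument takes the place of the Hausdorff-Young inequality. The resulting
  bound \<open>t^(1-d/2) D^(-2+2\<delta>)\<close>, and for \<open>d \<ge> 4\<close> also \<open>t^(-1/2) D^(-(d-1)(1-\<delta>))\<close>, is integrated over \<open>t\<close>;
  the two regimes are \<open>|x| |\<eta>|\<close> above and below a small power of \<open>|x|\<close>.
\<close>

text \<open>The error is measured against the Brownian Green function alone, because ghat(0) may
  vanish. At early times the bound \<open>t^(1-d/2) D^(-2)\<close> integrates to no better than
  order \<open>|x|^(-2)\<close>, which is too much against \<open>|x|^(2-d)\<close> as soon as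
  \<open>d >= 4\<close>. The weights \<open>|y|^(d-1)\<close> of the class are there to supply
  \<open>t^(-1/2) D^(-(d-1))\<close>, whose integral up to time \<open>|x|^2 / \<sigma>\<close> has
  order \<open>|x|^(2-d) \<sigma>^(-1/2)\<close> up to small losses, a gain for every large
  \<open>\<sigma>\<close>. At late times \<open>t^(-d/2)\<close> is integrable only for
  \<open>d >= 3\<close>; for \<open>d <= 2\<close> the assumption \<open>|x| |\<eta>| >= s0\<close>
  makes \<open>D\<close> grow linearly in \<open>t\<close>, which restores convergence. The early
  and late estimates hold only outside a range of times that is a small power of \<open>|x|\<close>
  wider than the natural one. On that range the gain \<open>t^(-z1/2)\<close> of the local limit
  theorem has to pay for the widening. The price is at most a multiple of \<open>(d + 1)^2 q\<close>
  in the exponent, so \<open>q = z1 / (200 (d + 1)^2)\<close> is affordable, and this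
  \<open>q\<close> is the final \<open>\<epsilon>\<close>.\<close>

section \<open>Lattice points as real vectors\<close>

lemma rvec_nth [simp]: "rvec y $ i = real_of_int (y $ i)"
  by (simp add: rvec_def)

lemma rvec_0 [simp]: "rvec 0 = 0"
  by (simp add: vec_eq_iff)

lemma rvec_diff: "rvec (y - z) = rvec y - rvec z"
  by (simp add: vec_eq_iff)

lemma rvec_add: "rvec (y + z) = rvec y + rvec z"
  by (simp add: vec_eq_iff)

lemma rvec_eq_0_iff [simp]: "rvec y = 0 \<longleftrightarrow> y = 0"
  by (simp add: vec_eq_iff)

lemma norm_rvec_ge_1:
  assumes "y \<noteq> 0"
  shows "norm (rvec y) \<ge> 1"
proof -
  obtain i where "y $ i \<noteq> 0" using assms by (auto simp: vec_eq_iff)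
  then have "1 \<le> \<bar>rvec y $ i\<bar>" by simp
  also have "\<dots> \<le> norm (rvec y)" by (rule component_le_norm_cart)
  finally show ?thesis .
qed

text \<open>Finiteness of balls makes the truncation of a Fourier series at a radius a trigonometric
  polynomial, the class to which tilting applies.\<close>

lemma finite_norm_rvec_le: "finite {y :: int ^ 'd::finite. norm (rvec y) \<le> r}"
proof -
  define N where "N = \<lceil>r\<rceil>"
  have "finite (PiE (UNIV :: 'd set) (\<lambda>_. {-N..N}))" by (rule finite_PiE) auto
  then have "finite ((\<lambda>f. \<chi> i. f i) ` (PiE (UNIV :: 'd set) (\<lambda>_. {-N..N})))" by simp
  moreover have "{y :: int ^ 'd. norm (rvec y) \<le> r} \<subseteq> (\<lambda>f. \<chi> i. f i) ` (PiE (UNIV :: 'd set) (\<lambda>_. {-N..N}))"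
  proof
    fix y :: "int ^ 'd" assume "y \<in> {y. norm (rvec y) \<le> r}"
    then have *: "\<bar>rvec y $ i\<bar> \<le> r" for i
      using component_le_norm_cart[of "rvec y" i] by simp
    have "y $ i \<in> {-N..N}" for i
      using *[of i] unfolding N_def by (simp add: abs_le_iff) linarith
    then show "y \<in> (\<lambda>f. \<chi> i. f i) ` (PiE (UNIV :: 'd set) (\<lambda>_. {-N..N}))"
      by (intro image_eqI[of _ _ "\<lambda>i. y $ i"]) auto
  qed
  ultimately show ?thesis by (rule rev_finite_subset)
qed

section \<open>Product integrals over coordinates, torus characters and the standard
  Gaussian\<close>

text \<open>Lebesgue measure is the image of the product of one-dimensional Lebesgue measures under
  the coordinate map, so Fubini applies factor by factor. Both the characters of the torus and the
  standard Gaussian are of this product form.\<close>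

lemma lborel_integral_prod:
  fixes \<phi> :: "'a::euclidean_space \<Rightarrow> real \<Rightarrow> complex"
  assumes "\<And>b. b \<in> Basis \<Longrightarrow> integrable lborel (\<phi> b)"
  shows "integrable lborel (\<lambda>x::'a. \<Prod>b\<in>Basis. \<phi> b (x \<bullet> b))"
    and "(LINT x|lborel. (\<Prod>b\<in>Basis. \<phi> b ((x::'a) \<bullet> b))) = (\<Prod>b\<in>Basis. LINT u|lborel. \<phi> b u)"
proof -
  interpret product_sigma_finite "\<lambda>_::'a. lborel :: real measure" ..
  define T where "T = (\<lambda>f. \<Sum>b\<in>Basis. f b *\<^sub>R b :: 'a)"
  have T [measurable]: "T \<in> (\<Pi>\<^sub>M b\<in>(Basis::'a set). lborel) \<rightarrow>\<^sub>M borel"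
    unfolding T_def by measurable
  have \<phi>: "\<phi> b \<in> borel_measurable borel" if "b \<in> Basis" for b
    using borel_measurable_integrable[OF assms[OF that]] by simp
  have m: "(\<lambda>x::'a. \<Prod>b\<in>Basis. \<phi> b (x \<bullet> b)) \<in> borel_measurable borel"
  proof (intro borel_measurable_prod)
    fix b :: 'a assume "b \<in> Basis"
    have "(\<lambda>x::'a. x \<bullet> b) \<in> borel_measurable borel" by measurable
    from measurable_compose[OF this \<phi>[OF \<open>b \<in> Basis\<close>]]
    show "(\<lambda>x. \<phi> b (x \<bullet> b)) \<in> borel_measurable borel" .
  qed
  have eq: "(\<Prod>b\<in>Basis. \<phi> b (T f \<bullet> b)) = (\<Prod>b\<in>Basis. \<phi> b (f b))" for f
    by (intro prod.cong) (auto simp: T_def inner_sum_left_Basis)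
  have L: "(lborel :: 'a measure) = distr (\<Pi>\<^sub>M b\<in>Basis. lborel) borel T"
    unfolding T_def by (rule lborel_eq)
  show "integrable lborel (\<lambda>x::'a. \<Prod>b\<in>Basis. \<phi> b (x \<bullet> b))"
    unfolding L by (subst integrable_distr_eq[OF T m], unfold eq)
      (intro product_integrable_prod finite_Basis assms)
  show "(LINT x|lborel. (\<Prod>b\<in>Basis. \<phi> b ((x::'a) \<bullet> b))) = (\<Prod>b\<in>Basis. LINT u|lborel. \<phi> b u)"
    unfolding L by (subst integral_distr[OF T m], unfold eq)
      (intro product_integral_prod finite_Basis assms)
qed

lemma prod_Basis_cart:
  fixes f :: "real ^ 'd::finite \<Rightarrow> 'b::comm_monoid_mult"
  shows "(\<Prod>b\<in>Basis. f b) = (\<Prod>j\<in>UNIV. f (axis j 1))"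
proof -
  have *: "Basis = range (\<lambda>j::'d. axis j (1::real))" by (auto simp: Basis_vec_def)
  show ?thesis unfolding *
    by (subst prod.reindex) (auto intro!: injI simp: axis_eq_axis)
qed

lemma torus_iff: "k \<in> torus \<longleftrightarrow> (\<forall>j. \<bar>k $ j\<bar> \<le> pi)"
  unfolding torus_def by (auto simp: mem_box_cart abs_le_iff minus_le_iff)

lemma exp_sum_Basis: 
  "exp (\<i> * complex_of_real (k \<bullet> w)) = (\<Prod>b\<in>Basis. exp (\<i> * complex_of_real ((k \<bullet> b) * (w \<bullet> b))))"
  by (subst euclidean_inner) (simp add: exp_sum[symmetric] sum_distrib_left)

lemma integral_character_interval:
  "(LINT u:{-pi..pi}|lborel. exp (\<i> * complex_of_real (u * real_of_int n))) = (if n = 0 then 2 * pi else 0)"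
proof (cases "n = 0")
  case True
  then show ?thesis by (simp add: set_lebesgue_integral_def scaleR_conv_of_real)
next
  case False
  define G where "G = (\<lambda>u. exp (\<i> * complex_of_real (u * real_of_int n)) / (\<i> * of_int n))"
  have "((\<lambda>z. exp (\<i> * (z * of_int n)) / (\<i> * of_int n)) has_field_derivative exp (\<i> * (z * of_int n))) (at z)"
    for z :: complex
  proof -
    have "((\<lambda>z. exp (z * (\<i> * of_int n))) has_field_derivative exp (z * (\<i> * of_int n)) * (\<i> * of_int n)) (at z)"
      by (auto intro!: derivative_eq_intros)
    from DERIV_cdivide[OF this, of "\<i> * of_int n"] show ?thesis using False by (simp add: mult_ac)
  qed
  then have "((\<lambda>u. exp (\<i> * (complex_of_real u * of_int n)) / (\<i> * of_int n)) has_vector_derivative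
      exp (\<i> * (complex_of_real u * of_int n))) (at u within {-pi..pi})" for u
    by (rule has_vector_derivative_real_field)
  then have "(G has_vector_derivative exp (\<i> * complex_of_real (u * real_of_int n))) (at u within {-pi..pi})" for u
    by (simp add: G_def)
  then have I: "((\<lambda>u. exp (\<i> * complex_of_real (u * real_of_int n))) has_integral (G pi - G (-pi))) {-pi..pi}"
    by (intro fundamental_theorem_of_calculus) auto
  have Z: "G pi - G (-pi) = 0"
  proof -
    have "exp (\<i> * complex_of_real (pi * real_of_int n)) = exp (\<i> * complex_of_real (-pi * real_of_int n))"
      by (rule iffD2[OF exp_eq]) (rule exI[of _ n], simp add: algebra_simps)
    then show ?thesis by (simp add: G_def)
  qed
  have S: "set_integrable lborel {-pi..pi} (\<lambda>u. exp (\<i> * complex_of_real (u * real_of_int n)))"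
    by (intro borel_integrable_atLeastAtMost' continuous_intros)
  show ?thesis using False Z integral_unique[OF I] set_borel_integral_eq_integral(2)[OF S] by simp
qed

lemma indicator_torus:
  "(indicator torus k :: real) = (\<Prod>b\<in>Basis. indicator {-pi..pi} (k \<bullet> b))"
proof (cases "k \<in> torus")
  case True
  then have "k \<bullet> b \<in> {-pi..pi}" if "b \<in> Basis" for b
    using that by (auto simp: torus_iff Basis_vec_def inner_axis abs_le_iff minus_le_iff)
  with True show ?thesis by simp
next
  case False
  then obtain j where "\<bar>k $ j\<bar> > pi" by (auto simp: torus_iff not_le)
  then have "(indicator {-pi..pi} (k \<bullet> axis j 1) :: real) = 0"
    by (auto simp: inner_axis abs_if split: if_splits)
  moreover have "axis j 1 \<in> (Basis :: (real ^ _) set)" by (auto simp: Basis_vec_def)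
  ultimately show ?thesis using False
    by (intro trans[OF _ prod_zero[symmetric]]) (auto intro!: bexI[of _ "axis j 1"])
qed

text \<open>The indicator of the cube and the character both factor over the coordinates; a single
  nonzero component of \<open>y\<close> already gives a vanishing factor.\<close>

lemma torus_orthogonality:
  fixes y :: "int ^ 'd::finite"
  shows "(LINT k:torus|lborel. exp (\<i> * complex_of_real (k \<bullet> rvec y))) = (if y = 0 then (2 * pi) ^ CARD('d) else 0)"
proof -
  define \<phi> where "\<phi> = (\<lambda>b u. indicator {-pi..pi} u *\<^sub>R exp (\<i> * complex_of_real (u * (rvec y \<bullet> b))))"
  have 1: "indicator torus k *\<^sub>R exp (\<i> * complex_of_real (k \<bullet> rvec y)) = (\<Prod>b\<in>Basis. \<phi> b (k \<bullet> b))" for k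
    unfolding \<phi>_def indicator_torus exp_sum_Basis by (simp add: scaleR_conv_of_real prod.distrib)
  have 2: "integrable lborel (\<phi> b)" for b
    unfolding \<phi>_def set_integrable_def[symmetric]
    by (intro borel_integrable_atLeastAtMost' continuous_intros)
  have "(LINT k:torus|lborel. exp (\<i> * complex_of_real (k \<bullet> rvec y))) = (\<Prod>b\<in>Basis. LINT u|lborel. \<phi> b u)"
    unfolding set_lebesgue_integral_def 1 by (rule lborel_integral_prod(2)[OF 2])
  also have "\<dots> = (\<Prod>j\<in>UNIV. LINT u|lborel. \<phi> (axis j 1) u)" by (rule prod_Basis_cart)
  also have "\<dots> = (\<Prod>j\<in>UNIV. if y $ j = 0 then complex_of_real (2 * pi) else 0)"
    using integral_character_interval
    by (intro prod.cong refl) (simp add: \<phi>_def set_lebesgue_integral_def inner_axis)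
  also have "\<dots> = (if y = 0 then (2 * pi) ^ CARD('d) else 0)"
    by (auto simp: vec_eq_iff)
  finally show ?thesis .
qed

lemma gaussian_char_1:
  "integrable lborel (\<lambda>u. exp (\<i> * complex_of_real (u * w)) * complex_of_real (exp (- u\<^sup>2 / 2)))"
  "(LINT u|lborel. exp (\<i> * complex_of_real (u * w)) * complex_of_real (exp (- u\<^sup>2 / 2)))
     = complex_of_real (sqrt (2 * pi) * exp (- w\<^sup>2 / 2))"
proof -
  have g: "exp (- u\<^sup>2 / 2) = sqrt (2 * pi) * std_normal_density u" for u
    by (simp add: std_normal_density_def)
  have "integrable lborel (\<lambda>u. sqrt (2 * pi) * std_normal_density u)" by simp
  then have i: "integrable lborel (\<lambda>u. exp (- u\<^sup>2 / 2) :: real)" by (simp only: g)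
  show "integrable lborel (\<lambda>u. exp (\<i> * complex_of_real (u * w)) * complex_of_real (exp (- u\<^sup>2 / 2)))"
    by (rule Bochner_Integration.integrable_bound[OF i]) (auto simp: norm_mult)
  have "(LINT u|lborel. exp (\<i> * complex_of_real (u * w)) * complex_of_real (exp (- u\<^sup>2 / 2)))
      = (LINT u|lborel. complex_of_real (sqrt (2 * pi)) * (std_normal_density u *\<^sub>R iexp (w * u)))"
    by (simp only: g) (simp add: scaleR_conv_of_real mult_ac)
  also have "\<dots> = complex_of_real (sqrt (2 * pi)) * char std_normal_distribution w"
    by (subst integral_mult_right_zero) (simp add: char_def integral_density)
  also have "\<dots> = complex_of_real (sqrt (2 * pi) * exp (- w\<^sup>2 / 2))"
    by (simp add: char_std_normal_distribution)
  finally show "(LINT u|lborel. exp (\<i> * complex_of_real (u * w)) * complex_of_real (exp (- u\<^sup>2 / 2)))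
     = complex_of_real (sqrt (2 * pi) * exp (- w\<^sup>2 / 2))" .
qed

lemma exp_norm_Basis:
  fixes u :: "'a::euclidean_space"
  shows "exp (- c * (norm u)\<^sup>2) = (\<Prod>b\<in>Basis. exp (- c * (u \<bullet> b)\<^sup>2))"
proof -
  have "(norm u)\<^sup>2 = (\<Sum>b\<in>Basis. (u \<bullet> b)\<^sup>2)"
    by (subst power2_norm_eq_inner, subst euclidean_inner) (simp add: power2_eq_square)
  then show ?thesis by (simp add: exp_sum[symmetric] sum_distrib_left sum_negf)
qed

lemma gaussian_char:
  fixes w :: "real ^ 'd::finite"
  shows "integrable lborel (\<lambda>u. exp (\<i> * complex_of_real (u \<bullet> w)) * complex_of_real (exp (- (norm u)\<^sup>2 / 2)))"
  and "(LINT u|lborel. exp (\<i> * complex_of_real (u \<bullet> w)) * complex_of_real (exp (- (norm u)\<^sup>2 / 2)))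
     = complex_of_real ((2 * pi) powr (real CARD('d) / 2) * exp (- (norm w)\<^sup>2 / 2))"
proof -
  define \<phi> where "\<phi> = (\<lambda>b u. exp (\<i> * complex_of_real (u * (w \<bullet> b))) * complex_of_real (exp (- u\<^sup>2 / 2)))"
  have 1: "exp (\<i> * complex_of_real (u \<bullet> w)) * complex_of_real (exp (- (norm u)\<^sup>2 / 2)) = (\<Prod>b\<in>Basis. \<phi> b (u \<bullet> b))" for u
    using exp_norm_Basis[of "1/2" u] unfolding \<phi>_def exp_sum_Basis by (simp add: prod.distrib)
  have 2: "integrable lborel (\<phi> b)" for b
    unfolding \<phi>_def by (rule gaussian_char_1)
  show "integrable lborel (\<lambda>u. exp (\<i> * complex_of_real (u \<bullet> w)) * complex_of_real (exp (- (norm u)\<^sup>2 / 2)))"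
    unfolding 1 by (rule lborel_integral_prod(1)[OF 2])
  have "(LINT u|lborel. exp (\<i> * complex_of_real (u \<bullet> w)) * complex_of_real (exp (- (norm u)\<^sup>2 / 2)))
     = (\<Prod>b\<in>Basis. LINT u|lborel. \<phi> b u)"
    unfolding 1 by (rule lborel_integral_prod(2)[OF 2])
  also have "\<dots> = (\<Prod>b\<in>Basis. complex_of_real (sqrt (2 * pi) * exp (- (w \<bullet> b)\<^sup>2 / 2)))"
    unfolding \<phi>_def gaussian_char_1 ..
  also have "\<dots> = complex_of_real (sqrt (2 * pi) ^ CARD('d) * exp (- (norm w)\<^sup>2 / 2))"
    using exp_norm_Basis[of "1/2" w] by (simp add: prod.distrib)
  also have "sqrt (2 * pi) ^ CARD('d) = (2 * pi) powr (real CARD('d) / 2)"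
    by (simp add: powr_half_sqrt[symmetric] powr_powr powr_realpow[symmetric] mult.commute)
  finally show "(LINT u|lborel. exp (\<i> * complex_of_real (u \<bullet> w)) * complex_of_real (exp (- (norm u)\<^sup>2 / 2)))
     = complex_of_real ((2 * pi) powr (real CARD('d) / 2) * exp (- (norm w)\<^sup>2 / 2))" .
qed

section \<open>Linear change of variables and the Gaussian Fourier transform\<close>

text \<open>The change of variables theorems of the library need a well-ordered index type. For an arbitrary finite index
  type the scaling property is obtained here by induction over elementary matrices. It is vacuous for singular maps,
  because the induction also passes through these.\<close>

definition scales_lborel :: "(real ^ 'd::finite \<Rightarrow> real ^ 'd) \<Rightarrow> bool" where
  "scales_lborel f \<longleftrightarrow> linear f \<and> (det (matrix f) \<noteq> 0 \<longrightarrow>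
     (\<forall>h \<in> borel_measurable borel.
        (\<integral>\<^sup>+ x. h x \<partial>lborel) = ennreal \<bar>det (matrix f)\<bar> * (\<integral>\<^sup>+ x. h (f x) \<partial>lborel)))"

lemma linear_borel_measurable_cart:
  fixes f :: "real ^ 'd::finite \<Rightarrow> real ^ 'd"
  shows "linear f \<Longrightarrow> f \<in> borel_measurable borel"
  by (intro borel_measurable_continuous_onI linear_continuous_on) (simp add: linear_conv_bounded_linear)

lemma scales_lborelI_eq:
  assumes "linear f" "det (matrix f) \<noteq> 0 \<Longrightarrow> lborel = density (distr lborel borel f) (\<lambda>_. ennreal \<bar>det (matrix f)\<bar>)"
  shows "scales_lborel f"
  unfolding scales_lborel_def
proof (intro conjI impI ballI assms(1))
  fix h :: "(real, 'a) vec \<Rightarrow> ennreal"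
  assume nz: "det (matrix f) \<noteq> 0" and [measurable]: "h \<in> borel_measurable borel"
  have [measurable]: "f \<in> borel_measurable borel" by (rule linear_borel_measurable_cart[OF assms(1)])
  show "(\<integral>\<^sup>+ x. h x \<partial>lborel) = ennreal \<bar>det (matrix f)\<bar> * (\<integral>\<^sup>+ x. h (f x) \<partial>lborel)"
    by (subst assms(2)[OF nz]) (simp add: nn_integral_density nn_integral_distr nn_integral_cmult)
qed

lemma scales_lborelD:
  assumes "scales_lborel f" "det (matrix f) \<noteq> 0" "h \<in> borel_measurable borel"
  shows "(\<integral>\<^sup>+ x. h x \<partial>lborel) = ennreal \<bar>det (matrix f)\<bar> * (\<integral>\<^sup>+ x. h (f x) \<partial>lborel)"
  using assms unfolding scales_lborel_def by blast

text \<open>If a composition has nonzero determinant, so do both factors; hence the conditional form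
  of \<open>scales_lborel\<close> survives composition.\<close>

lemma scales_lborel_comp:
  assumes "scales_lborel f" "scales_lborel g"
  shows "scales_lborel (f \<circ> g)"
proof -
  have lin: "linear f" "linear g" using assms by (auto simp: scales_lborel_def)
  have det: "det (matrix (f \<circ> g)) = det (matrix f) * det (matrix g)"
    by (simp add: matrix_compose lin det_mul)
  have fm: "f \<in> borel_measurable borel"
    by (rule linear_borel_measurable_cart[OF lin(1)])
  show ?thesis
    unfolding scales_lborel_def
  proof (intro conjI impI ballI)
    show "linear (f \<circ> g)" by (rule linear_compose[OF lin(2,1)])
    fix h :: "(real, 'a) vec \<Rightarrow> ennreal"
    assume nz: "det (matrix (f \<circ> g)) \<noteq> 0" and h: "h \<in> borel_measurable borel"
    from nz have nz': "det (matrix f) \<noteq> 0" "det (matrix g) \<noteq> 0" unfolding det by auto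
    have "(\<integral>\<^sup>+ x. h x \<partial>lborel) = ennreal \<bar>det (matrix f)\<bar> * (\<integral>\<^sup>+ x. h (f x) \<partial>lborel)"
      by (rule scales_lborelD[OF assms(1) nz'(1) h])
    also have "(\<integral>\<^sup>+ x. h (f x) \<partial>lborel) = ennreal \<bar>det (matrix g)\<bar> * (\<integral>\<^sup>+ x. h (f (g x)) \<partial>lborel)"
      by (rule scales_lborelD[OF assms(2) nz'(2) measurable_compose[OF fm h]])
    finally show "(\<integral>\<^sup>+ x. h x \<partial>lborel) = ennreal \<bar>det (matrix (f \<circ> g))\<bar> * (\<integral>\<^sup>+ x. h ((f \<circ> g) x) \<partial>lborel)"
      unfolding det abs_mult by (subst ennreal_mult) (simp_all only: abs_ge_zero mult.assoc comp_apply)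
  qed
qed

lemma scales_lborel_stretch: "scales_lborel (\<lambda>x::real^'d::finite. \<chi> i. c i * x $ i)"
proof (rule scales_lborelI_eq)
  let ?f = "\<lambda>x::real^'d. \<chi> i. c i * x $ i"
  show "linear ?f" by (rule linearI) (auto simp: vec_eq_iff algebra_simps)
  have det: "det (matrix ?f) = prod c UNIV"
    by (simp add: axis_def matrix_def det_diagonal)
  assume nz: "det (matrix ?f) \<noteq> 0"
  \<comment> \<open>\<open>lborel_affine_euclidean\<close> indexes its factors by basis vectors, so
    the factors \<open>c\<close> are transported from indices to \<open>axis j 1\<close>.\<close>
  define c' where "c' = (\<lambda>b::real^'d. \<Sum>i\<in>UNIV. c i * b $ i)"
  have c': "c' (axis j 1) = c j" for j
    by (simp add: c'_def axis_def if_distrib sum.delta cong: if_cong)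
  have nz': "c' b \<noteq> 0" if "b \<in> Basis" for b
    using that nz det by (auto simp: Basis_vec_def c')
  have f: "?f = (\<lambda>x. 0 + (\<Sum>b\<in>Basis. (c' b * (x \<bullet> b)) *\<^sub>R b))"
  proof
    fix x :: "real^'d"
    have "?f x \<bullet> b = (\<Sum>b\<in>Basis. (c' b * (x \<bullet> b)) *\<^sub>R b) \<bullet> b" if "b \<in> Basis" for b
    proof -
      from that obtain j where "b = axis j 1" by (auto simp: Basis_vec_def)
      moreover have "(\<Sum>b\<in>Basis. (c' b * (x \<bullet> b)) *\<^sub>R b) \<bullet> b = c' b * (x \<bullet> b)"
        using that by (simp add: inner_sum_left_Basis)
      ultimately show ?thesis by (simp add: c' inner_axis)
    qed
    then show "?f x = 0 + (\<Sum>b\<in>Basis. (c' b * (x \<bullet> b)) *\<^sub>R b)"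
      by (subst euclidean_eq_iff) simp
  qed
  have "(\<Prod>b\<in>Basis. \<bar>c' b\<bar>) = \<bar>det (matrix ?f)\<bar>"
    by (simp add: prod_Basis_cart c' det abs_prod)
  then show "lborel = density (distr lborel borel ?f) (\<lambda>_. ennreal \<bar>det (matrix ?f)\<bar>)"
    using lborel_affine_euclidean[of c' 0, OF nz'] unfolding f by simp
qed

lemma scales_lborel_swap: "scales_lborel (\<lambda>x::real^'d::finite. \<chi> i. x $ Transposition.transpose m n i)"
proof (rule scales_lborelI_eq)
  let ?h = "\<lambda>x::real^'d. \<chi> i. x $ Transposition.transpose m n i"
  show lin: "linear ?h" by (rule linearI) (auto simp: vec_eq_iff)
  have [measurable]: "?h \<in> borel_measurable borel" by (rule linear_borel_measurable_cart[OF lin])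
  have "(\<chi> i j. if Transposition.transpose m n i = j then 1 else 0) = (\<chi> i j. if j = Transposition.transpose m n i then 1 else (0::real))"
    by (auto intro!: Cart_lambda_cong)
  then have "matrix ?h = transpose(\<chi> i j. mat 1 $ i $ Transposition.transpose m n j)"
    by (auto simp: matrix_eq transpose_def axis_def mat_def matrix_def)
  then have 1: "\<bar>det (matrix ?h)\<bar> = 1"
    by (simp add: det_permute_columns permutes_swap_id sign_swap_id abs_mult)
  \<comment> \<open>Boxes determine Lebesgue measure, and swapping two coordinates only permutes the
    sides of a box.\<close>
  have "lborel = distr lborel borel ?h"
  proof (rule lborel_eqI)
    fix l u :: "real^'d" assume lu: "\<And>b. b \<in> Basis \<Longrightarrow> l \<bullet> b \<le> u \<bullet> b"
    have lu': "l $ i \<le> u $ i" for i using lu[of "axis i 1"] by (auto simp: Basis_vec_def inner_axis)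
    have "?h -` box l u = box (?h l) (?h u)"
      by (auto simp: mem_box_cart) (metis transpose_involutory)+
    then have "emeasure (distr lborel borel ?h) (box l u) = emeasure lborel (box (?h l) (?h u))"
      by (simp add: emeasure_distr)
    also have "\<dots> = ennreal (\<Prod>b\<in>Basis. (?h u - ?h l) \<bullet> b)"
      using lu' by (subst emeasure_lborel_box) (auto simp: Basis_vec_def inner_axis)
    also have "(\<Prod>b\<in>Basis. (?h u - ?h l) \<bullet> b) = (\<Prod>i\<in>UNIV. (u - l) $ Transposition.transpose m n i)"
      by (subst prod_Basis_cart) (simp add: inner_axis)
    also have "\<dots> = (\<Prod>i\<in>UNIV. (u - l) $ i)"
      using prod.permute [OF permutes_swap_id, where S=UNIV and g="\<lambda>i. (u - l)$i", symmetric] by (simp add: o_def)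
    also have "\<dots> = (\<Prod>b\<in>Basis. (u - l) \<bullet> b)"
      by (subst prod_Basis_cart) (simp add: inner_axis)
    finally show "emeasure (distr lborel borel ?h) (box l u) = ennreal (\<Prod>b\<in>Basis. (u - l) \<bullet> b)" .
  qed simp
  then show "lborel = density (distr lborel borel ?h) (\<lambda>_. ennreal \<bar>det (matrix ?h)\<bar>)"
    by (simp add: 1 density_1)
qed

text \<open>By Tonelli the coordinate along \<open>m\<close> may be integrated first. With the other
  coordinates fixed the shear is a translation in that coordinate, by the \<open>n\<close>
  coordinate.\<close>

lemma nn_integral_lborel_shear:
  fixes h :: "'a::euclidean_space \<Rightarrow> ennreal"
  assumes [measurable]: "h \<in> borel_measurable borel" and mn: "m \<in> Basis" "n \<in> Basis" "m \<noteq> n"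
  shows "(\<integral>\<^sup>+ x. h (x + (x \<bullet> n) *\<^sub>R m) \<partial>lborel) = (\<integral>\<^sup>+ x. h x \<partial>lborel)"
proof -
  interpret product_sigma_finite "\<lambda>_::'a. lborel :: real measure" ..
  define T where "T = (\<lambda>f. \<Sum>b\<in>Basis. f b *\<^sub>R b :: 'a)"
  define B where "B = (Basis :: 'a set) - {m}"
  have B: "Basis = insert m B" "m \<notin> B" "finite B" "n \<in> B" using mn by (auto simp: B_def)
  have L: "(lborel :: 'a measure) = distr (\<Pi>\<^sub>M b\<in>Basis. lborel) borel T"
    unfolding T_def by (rule lborel_eq)
  have T [measurable]: "T \<in> (\<Pi>\<^sub>M b\<in>(Basis::'a set). lborel) \<rightarrow>\<^sub>M borel"
    unfolding T_def by measurable
  have T' [measurable]: "T \<in> (\<Pi>\<^sub>M b\<in>insert m B. lborel) \<rightarrow>\<^sub>M borel"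
    using T by (simp only: B(1)[symmetric])
  have s: "T f + (T f \<bullet> n) *\<^sub>R m = T (f(m := f m + f n))" for f
  proof -
    have "T f \<bullet> n = f n" using mn by (simp add: T_def inner_sum_left_Basis)
    moreover have "T (f(m := f m + f n)) = (f m + f n) *\<^sub>R m + (\<Sum>b\<in>B. f b *\<^sub>R b)"
      unfolding T_def B(1) using B(2,3) by (simp add: sum.insert) (intro sum.cong, auto)
    moreover have "T f = f m *\<^sub>R m + (\<Sum>b\<in>B. f b *\<^sub>R b)"
      unfolding T_def B(1) using B(2,3) by simp
    ultimately show ?thesis by (simp add: algebra_simps)
  qed
  have "(\<integral>\<^sup>+ x. h (x + (x \<bullet> n) *\<^sub>R m) \<partial>lborel) = (\<integral>\<^sup>+ f. h (T f + (T f \<bullet> n) *\<^sub>R m) \<partial>(\<Pi>\<^sub>M b\<in>insert m B. lborel))"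
    unfolding L by (subst nn_integral_distr[OF T]) (simp_all add: B(1)[symmetric])
  also have "\<dots> = (\<integral>\<^sup>+ f. (\<integral>\<^sup>+ y. h (T (f(m := y)) + (T (f(m := y)) \<bullet> n) *\<^sub>R m) \<partial>lborel) \<partial>(\<Pi>\<^sub>M b\<in>B. lborel))"
    by (rule product_nn_integral_insert[OF B(3,2)]) measurable
  also have "\<dots> = (\<integral>\<^sup>+ f. (\<integral>\<^sup>+ y. h (T (f(m := y))) \<partial>lborel) \<partial>(\<Pi>\<^sub>M b\<in>B. lborel))"
  proof (rule nn_integral_cong)
    fix f assume f: "f \<in> space (\<Pi>\<^sub>M b\<in>B. (lborel::real measure))"
    have "T (f(m := y)) = y *\<^sub>R m + (\<Sum>b\<in>B. f b *\<^sub>R b)" for y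
      unfolding T_def B(1) using B(2,3) by (simp add: sum.insert) (intro sum.cong, auto)
    then have [measurable]: "(\<lambda>y. T (f(m := y))) \<in> borel_measurable borel"
      by simp
    have "(\<integral>\<^sup>+ y. h (T (f(m := y)) + (T (f(m := y)) \<bullet> n) *\<^sub>R m) \<partial>lborel)
        = (\<integral>\<^sup>+ y. h (T (f(m := f n + 1 * y))) \<partial>lborel)"
      using mn by (simp add: s add.commute)
    also have "\<dots> = (\<integral>\<^sup>+ y. h (T (f(m := y))) \<partial>lborel)"
      using nn_integral_real_affine[of "\<lambda>y. h (T (f(m := y)))" 1 "f n"] by simp
    finally show "(\<integral>\<^sup>+ y. h (T (f(m := y)) + (T (f(m := y)) \<bullet> n) *\<^sub>R m) \<partial>lborel) = (\<integral>\<^sup>+ y. h (T (f(m := y))) \<partial>lborel)" .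
  qed
  also have "\<dots> = (\<integral>\<^sup>+ f. h (T f) \<partial>(\<Pi>\<^sub>M b\<in>insert m B. lborel))"
    by (rule product_nn_integral_insert[OF B(3,2), symmetric]) measurable
  also have "\<dots> = (\<integral>\<^sup>+ x. h x \<partial>lborel)"
    unfolding L by (subst nn_integral_distr[OF T]) (simp_all add: B(1)[symmetric])
  finally show ?thesis .
qed

lemma scales_lborel_shear:
  assumes "m \<noteq> n"
  shows "scales_lborel (\<lambda>x::real^'d::finite. \<chi> i. if i = m then x $ m + x $ n else x $ i)"
proof -
  let ?f = "\<lambda>x::real^'d. \<chi> i. if i = m then x $ m + x $ n else x $ i"
  have lin: "linear ?f" by (rule linearI) (auto simp: vec_eq_iff algebra_simps)
  have m: "matrix ?f = (\<chi> k. if k = m then row m (mat 1) + 1 *s row n (mat 1) else row k (mat 1))"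
    by (auto simp: matrix_def axis_def mat_def row_def vec_eq_iff)
  have det: "det (matrix ?f) = 1"
    unfolding m by (subst det_row_operation[OF assms]) simp
  have f: "?f x = x + (x \<bullet> axis n 1) *\<^sub>R axis m 1" for x
    by (auto simp: vec_eq_iff inner_axis) (auto simp: axis_def)
  show ?thesis
    unfolding scales_lborel_def det
    using nn_integral_lborel_shear[of _ "axis m 1" "axis n (1::real)"] assms
    by (auto simp: lin) (auto simp: f Basis_vec_def axis_eq_axis)
qed

lemma scales_lborel_linear:
  assumes "linear f"
  shows "scales_lborel f"
proof (rule induct_linear_elementary[OF assms])
  fix f :: "real ^ 'a \<Rightarrow> real ^ 'a" and i
  assume f: "linear f" "\<And>x. f x $ i = 0"
  \<comment> \<open>With coordinate \<open>i\<close> always zero, \<open>f\<close> misses some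
    vector, and a linear endomorphism that is not surjective is not injective.\<close>
  then have "\<not> inj f"
    by (metis (full_types) linear_injective_imp_surjective one_neq_zero surjE vec_component)
  then have "det (matrix f) = 0"
    using det_nz_iff_inj[OF f(1)] by blast
  with f show "scales_lborel f" by (simp add: scales_lborel_def)
qed (rule scales_lborel_comp scales_lborel_stretch scales_lborel_swap scales_lborel_shear; assumption?)+

lemma lborel_matrix:
  fixes P :: "real ^ 'd::finite ^ 'd"
  assumes "det P \<noteq> 0"
  shows "lborel = density (distr lborel borel ((*v) P)) (\<lambda>_. ennreal \<bar>det P\<bar>)"
proof (rule measure_eqI)
  have [measurable]: "(*v) P \<in> borel_measurable borel"
    by (intro linear_borel_measurable_cart matrix_vector_mul_linear)
  fix A :: "(real^'d) set" assume A: "A \<in> sets lborel"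
  then have [measurable]: "A \<in> sets borel" by simp
  have "scales_lborel ((*v) P)" by (intro scales_lborel_linear matrix_vector_mul_linear)
  then have "(\<integral>\<^sup>+ x. indicator A x \<partial>lborel) = ennreal \<bar>det P\<bar> * (\<integral>\<^sup>+ x. indicator A (P *v x) \<partial>lborel)"
    using scales_lborelD[of "(*v) P" "indicator A"] assms by (simp add: matrix_of_matrix_vector_mul)
  also have "(\<integral>\<^sup>+ x. indicator A (P *v x) \<partial>lborel) = emeasure (distr lborel borel ((*v) P)) A"
    by (subst nn_integral_indicator[symmetric]) (simp_all add: nn_integral_distr del: nn_integral_indicator)
  also have "ennreal \<bar>det P\<bar> * \<dots> = emeasure (density (distr lborel borel ((*v) P)) (\<lambda>_. ennreal \<bar>det P\<bar>)) A"
    by (simp add: emeasure_density nn_integral_cmult)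
  finally show "emeasure lborel A = emeasure (density (distr lborel borel ((*v) P)) (\<lambda>_. ennreal \<bar>det P\<bar>)) A"
    by simp
qed simp

lemma lborel_integral_matrix:
  fixes h :: "real ^ 'd::finite \<Rightarrow> complex"
  assumes P: "det P \<noteq> 0" and i: "integrable lborel (\<lambda>u. h (P *v u))" and [measurable]: "h \<in> borel_measurable borel"
  shows "integrable lborel h" "(LINT k|lborel. h k) = \<bar>det P\<bar> * (LINT u|lborel. h (P *v u))"
proof -
  have [measurable]: "(*v) P \<in> borel_measurable borel"
    by (intro linear_borel_measurable_cart matrix_vector_mul_linear)
  have i': "integrable (distr lborel borel ((*v) P)) h"
    using i by (subst integrable_distr_eq) auto
  show "integrable lborel h"
    using i' by (subst lborel_matrix[OF P]) (subst integrable_density, auto)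
  show "(LINT k|lborel. h k) = \<bar>det P\<bar> * (LINT u|lborel. h (P *v u))"
    by (subst lborel_matrix[OF P]) (simp add: integral_density integral_distr scaleR_conv_of_real)
qed

section \<open>Quadratic forms and their Gaussian integrals\<close>

lemma inner_transpose_matrix_vector:
  fixes A :: "real ^ 'n::finite ^ 'm::finite"
  shows "u \<bullet> (transpose A *v w) = (A *v u) \<bullet> w"
  by (metis dot_lmul_matrix inner_commute transpose_matrix_vector)

text \<open>Gram-Schmidt for the inner product \<open>v \<bullet> (L *v w)\<close>: the columns of
  \<open>P\<close> are an orthonormal basis for this form.\<close>

lemma ex_congruence_identity:
  fixes L :: "real ^ 'd::finite ^ 'd"
  assumes sym: "transpose L = L" and pos: "\<And>v. v \<noteq> 0 \<Longrightarrow> v \<bullet> (L *v v) > 0"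
  shows "\<exists>P :: real ^ 'd ^ 'd. transpose P ** L ** P = mat 1"
proof -
  have sw: "v \<bullet> (L *v w) = w \<bullet> (L *v v)" for v w
    by (metis inner_transpose_matrix_vector inner_commute sym)
  have "\<exists>S. finite S \<and> card S = n \<and> (\<forall>v\<in>S. v \<bullet> (L *v v) = 1) \<and> (\<forall>v\<in>S. \<forall>w\<in>S. v \<noteq> w \<longrightarrow> v \<bullet> (L *v w) = 0)"
    if "n \<le> CARD('d)" for n
    using that
  proof (induction n)
    case 0 show ?case by (rule exI[of _ "{}"]) auto
  next
    case (Suc n)
    then obtain S where S: "finite S" "card S = n" "\<forall>v\<in>S. v \<bullet> (L *v v) = 1"
      "\<forall>v\<in>S. \<forall>w\<in>S. v \<noteq> w \<longrightarrow> v \<bullet> (L *v w) = 0" by auto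
    \<comment> \<open>Fewer than \<open>d\<close> vectors \<open>L *v v\<close> cannot span the
      space, so some \<open>u\<close> is Euclidean-orthogonal to all of them, that is, orthogonal to
      \<open>S\<close> for the form.\<close>
    have "dim ((*v) L ` S) \<le> card ((*v) L ` S)" using S by (intro dim_le_card') auto
    also have "\<dots> \<le> n" using S card_image_le by auto
    also have "\<dots> < DIM(real^'d)" using Suc.prems by simp
    finally have "dim ((*v) L ` S) < DIM(real^'d)" .
    from orthogonal_to_subspace_exists[OF this]
    obtain u where u: "u \<noteq> 0" "\<And>y. y \<in> span ((*v) L ` S) \<Longrightarrow> orthogonal u y" by blast
    define w where "w = u /\<^sub>R sqrt (u \<bullet> (L *v u))"
    have p: "u \<bullet> (L *v u) > 0" using pos u by auto
    have w1: "w \<bullet> (L *v w) = 1"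
      using p by (simp add: w_def matrix_vector_mult_scaleR field_simps)
    have w0: "w \<bullet> (L *v v) = 0" if "v \<in> S" for v
      using u(2)[of "L *v v"] that by (auto simp: w_def orthogonal_def span_base)
    have "w \<notin> S" using w0 w1 by fastforce
    moreover have "v \<bullet> (L *v w) = 0" if "v \<in> S" for v using w0[OF that] sw by metis
    ultimately show ?case using S w1 w0
      by (intro exI[of _ "insert w S"]) auto
  qed
  from this[of "CARD('d)"] obtain S where S: "finite S" "card S = CARD('d)" "\<forall>v\<in>S. v \<bullet> (L *v v) = 1"
      "\<forall>v\<in>S. \<forall>w\<in>S. v \<noteq> w \<longrightarrow> v \<bullet> (L *v w) = 0" by auto
  from S(1,2) obtain f :: "'d \<Rightarrow> real^'d" where f: "bij_betw f UNIV S"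
    using finite_same_card_bij[of "UNIV::'d set" S] by auto
  define P :: "real^'d^'d" where "P = (\<chi> i j. f j $ i)"
  have Pf: "P *v axis j 1 = f j" for j
    by (simp add: matrix_vector_mult_basis P_def column_def)
  have "(transpose P ** L ** P) $ i $ j = f i \<bullet> (L *v f j)" for i j
  proof -
    have "(transpose P ** L ** P) $ i $ j = axis i 1 \<bullet> ((transpose P ** L ** P) *v axis j 1)"
      by (simp add: matrix_vector_mult_basis column_def inner_axis')
    also have "\<dots> = (P *v axis i 1) \<bullet> (L *v (P *v axis j 1))"
      by (simp only: matrix_vector_mul_assoc[symmetric] inner_transpose_matrix_vector)
    finally show ?thesis by (simp add: Pf)
  qed
  moreover have "f i \<bullet> (L *v f j) = (if i = j then 1 else 0)" for i j
    using S(3,4) f by (auto simp: bij_betw_def inj_on_eq_iff)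
  ultimately have "transpose P ** L ** P = mat 1"
    by (auto simp: vec_eq_iff mat_def)
  then show ?thesis by blast
qed

text \<open>The substitution \<open>k = P *v u\<close> with \<open>P = P0 / sqrt t\<close> turns
  \<open>t * (k \<bullet> (L *v k))\<close> into the square of \<open>norm u\<close> and reduces
  everything to the standard Gaussian. Taking determinants in the congruence gives the sign of
  \<open>det L\<close>, and \<open>P0 ** transpose P0\<close> is the inverse of
  \<open>L\<close>.\<close>

lemma gaussian_fourier:
  fixes L :: "real ^ 'd::finite ^ 'd" and z :: "real ^ 'd"
  assumes sym: "transpose L = L" and pos: "\<And>v. v \<noteq> 0 \<Longrightarrow> v \<bullet> (L *v v) > 0" and t: "t > 0"
  shows "integrable lborel (\<lambda>k. exp (\<i> * complex_of_real (k \<bullet> z)) * complex_of_real (exp (- t * (k \<bullet> (L *v k)) / 2)))"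
    and "(LINT k|lborel. exp (\<i> * complex_of_real (k \<bullet> z)) * complex_of_real (exp (- t * (k \<bullet> (L *v k)) / 2)))
      = complex_of_real ((2 * pi / t) powr (real CARD('d) / 2) / sqrt (det L) * exp (- (z \<bullet> (matrix_inv L *v z)) / (2 * t)))"
    and "det L > 0"
proof -
  obtain P0 :: "real^'d^'d" where P0: "transpose P0 ** L ** P0 = mat 1" using ex_congruence_identity[OF sym pos] by blast
  have "det P0 * det L * det P0 = 1"
    using arg_cong[OF P0, of det] by (simp add: det_mul det_transpose)
  then have d0: "(det P0)\<^sup>2 * det L = 1" by (simp add: power2_eq_square mult_ac)
  then have dP0: "det P0 \<noteq> 0" and dL: "det L \<noteq> 0" by auto
  show dLp: "det L > 0"
    using d0 by (metis dL linorder_neqE_linordered_idom mult_pos_neg not_one_less_zero power2_less_0 zero_less_power2 dP0)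
  define s where "s = 1 / sqrt t"
  have s: "s > 0" "s\<^sup>2 * t = 1" using t by (auto simp: s_def power_divide)
  define P where "P = s *\<^sub>R P0"
  have Pv: "P *v u = s *\<^sub>R (P0 *v u)" for u
    by (simp add: P_def scaleR_matrix_vector_assoc)
  have "P = (\<chi> i. s *s (P0 $ i))"
    by (simp add: P_def vec_eq_iff)
  then have dP: "det P = s ^ CARD('d) * det P0"
    by (simp add: det_rows_mul)
  have nP: "det P \<noteq> 0" using s dP0 by (simp add: dP)
  have q: "t * ((P *v u) \<bullet> (L *v (P *v u))) = (norm u)\<^sup>2" for u
  proof -
    have "(P0 *v u) \<bullet> (L *v (P0 *v u)) = u \<bullet> ((transpose P0 ** L ** P0) *v u)"
      by (simp only: matrix_vector_mul_assoc[symmetric] inner_transpose_matrix_vector)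
    also have "\<dots> = (norm u)\<^sup>2" by (simp add: P0 power2_norm_eq_inner)
    finally have "(P0 *v u) \<bullet> (L *v (P0 *v u)) = (norm u)\<^sup>2" .
    then have "t * ((P *v u) \<bullet> (L *v (P *v u))) = (s\<^sup>2 * t) * (norm u)\<^sup>2"
      by (simp add: Pv matrix_vector_mult_scaleR power2_eq_square)
    then show ?thesis using s by simp
  qed
  define w where "w = s *\<^sub>R (transpose P0 *v z)"
  have l: "(P *v u) \<bullet> z = u \<bullet> w" for u
    by (simp only: Pv w_def inner_scaleR_left inner_scaleR_right inner_transpose_matrix_vector)
  have inv: "matrix_inv L = P0 ** transpose P0"
  proof -
    have "(transpose P0 ** L) ** P0 = mat 1" using P0 by simp
    then have "P0 ** (transpose P0 ** L) = mat 1" by (simp add: matrix_left_right_inverse)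
    then have i: "(P0 ** transpose P0) ** L = mat 1" by (simp add: matrix_mul_assoc)
    then have "L ** (P0 ** transpose P0) = mat 1" by (simp add: matrix_left_right_inverse)
    \<comment> \<open>\<open>matrix_inv\<close> is a choice among two-sided inverses: its defining
      property needs a witness first, and uniqueness then identifies it with
      \<open>P0 ** transpose P0\<close>.\<close>
    with i have "L ** matrix_inv L = mat 1 \<and> matrix_inv L ** L = mat 1"
      unfolding matrix_inv_def by (intro someI) auto
    then show ?thesis using i by (metis matrix_mul_assoc matrix_mul_lid matrix_mul_rid)
  qed
  have "z \<bullet> (matrix_inv L *v z) = (transpose P0 *v z) \<bullet> (transpose P0 *v z)"
    by (metis inv matrix_vector_mul_assoc inner_transpose_matrix_vector inner_commute)
  then have nw: "(norm w)\<^sup>2 = (z \<bullet> (matrix_inv L *v z)) / t"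
    using t by (simp add: w_def s_def power_divide power2_norm_eq_inner)
  define h where "h = (\<lambda>k. exp (\<i> * complex_of_real (k \<bullet> z)) * complex_of_real (exp (- t * (k \<bullet> (L *v k)) / 2)))"
  have h: "h (P *v u) = exp (\<i> * complex_of_real (u \<bullet> w)) * complex_of_real (exp (- (norm u)\<^sup>2 / 2))" for u
    using q[of u] by (simp add: h_def l mult.assoc)
  have hm: "h \<in> borel_measurable borel"
    unfolding h_def by (intro borel_measurable_continuous_onI continuous_intros) simp_all
  show "integrable lborel (\<lambda>k. exp (\<i> * complex_of_real (k \<bullet> z)) * complex_of_real (exp (- t * (k \<bullet> (L *v k)) / 2)))"
    unfolding h_def[symmetric] using gaussian_char(1)[of w]
    by (intro lborel_integral_matrix(1)[OF nP _ hm]) (simp add: h)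
  have "(LINT k|lborel. h k) = \<bar>det P\<bar> * complex_of_real ((2 * pi) powr (real CARD('d) / 2) * exp (- (norm w)\<^sup>2 / 2))"
    using gaussian_char[of w] by (subst lborel_integral_matrix(2)[OF nP _ hm]) (simp_all add: h)
  also have "\<bar>det P\<bar> = (1 / t) powr (real CARD('d) / 2) / sqrt (det L)"
  proof -
    have "s ^ CARD('d) = (1 / t) powr (real CARD('d) / 2)"
      using t by (simp add: s_def powr_half_sqrt[symmetric] powr_powr powr_realpow[symmetric] mult.commute
          powr_divide real_sqrt_divide)
    moreover have "\<bar>det P0\<bar> = 1 / sqrt (det L)"
    proof -
      have "(\<bar>det P0\<bar> * sqrt (det L))\<^sup>2 = 1" using d0 dLp by (simp add: power_mult_distrib)
      moreover have "\<bar>det P0\<bar> * sqrt (det L) \<ge> 0" using dLp by simp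
      ultimately have "\<bar>det P0\<bar> * sqrt (det L) = 1" by (simp add: power2_eq_1_iff)
      then show ?thesis using dLp by (simp add: field_simps)
    qed
    ultimately show ?thesis using s by (simp add: dP abs_mult)
  qed
  also have "complex_of_real ((1 / t) powr (real CARD('d) / 2) / sqrt (det L)) * 
        complex_of_real ((2 * pi) powr (real CARD('d) / 2) * exp (- (norm w)\<^sup>2 / 2))
      = complex_of_real ((2 * pi / t) powr (real CARD('d) / 2) / sqrt (det L) * exp (- (z \<bullet> (matrix_inv L *v z)) / (2 * t)))"
    using t by (simp add: nw powr_divide mult.commute)
  finally show "(LINT k|lborel. exp (\<i> * complex_of_real (k \<bullet> z)) * complex_of_real (exp (- t * (k \<bullet> (L *v k)) / 2)))
      = complex_of_real ((2 * pi / t) powr (real CARD('d) / 2) / sqrt (det L) * exp (- (z \<bullet> (matrix_inv L *v z)) / (2 * t)))"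
    unfolding h_def .
qed

section \<open>Fourier transforms on the torus\<close>

text \<open>Divergence is encoded by the value \<open>\<infinity>\<close>, so a finite bound on the
  norm already yields summability.\<close>

lemma lp_norm_leD:
  fixes f :: "int ^ 'd::finite \<Rightarrow> real"
  assumes "lp_norm p f \<le> ennreal M" "p > 0" "M \<ge> 0"
  shows "(\<lambda>y. \<bar>f y\<bar> powr p) summable_on UNIV" "(\<Sum>\<^sub>\<infinity>y. \<bar>f y\<bar> powr p) \<le> M powr p"
proof -
  show s: "(\<lambda>y. \<bar>f y\<bar> powr p) summable_on UNIV"
    using assms(1) by (auto simp: lp_norm_def top_unique split: if_splits)
  have nn: "0 \<le> (\<Sum>\<^sub>\<infinity>y. \<bar>f y\<bar> powr p)" by (intro infsum_nonneg) auto
  have "(\<Sum>\<^sub>\<infinity>y. \<bar>f y\<bar> powr p) powr (1 / p) \<le> M"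
    using assms s by (auto simp: lp_norm_def)
  then have "((\<Sum>\<^sub>\<infinity>y. \<bar>f y\<bar> powr p) powr (1 / p)) powr p \<le> M powr p"
    using assms by (intro powr_mono2) auto
  then show "(\<Sum>\<^sub>\<infinity>y. \<bar>f y\<bar> powr p) \<le> M powr p"
    using assms nn by (simp add: powr_powr)
qed

lemma lp_norm_1_leD:
  fixes f :: "int ^ 'd::finite \<Rightarrow> real"
  assumes "lp_norm 1 f \<le> ennreal M" "M \<ge> 0"
  shows "(\<lambda>y. \<bar>f y\<bar>) summable_on UNIV" "(\<Sum>\<^sub>\<infinity>y. \<bar>f y\<bar>) \<le> M"
  using lp_norm_leD[OF assms(1) _ assms(2)] assms(2) by simp_all

text \<open>The common form of the moment estimates: \<open>c\<close> is a character or a Taylor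
  remainder dominated by the weight \<open>w\<close>, and the class controls \<open>f\<close>
  against \<open>w\<close>.\<close>

lemma weighted_infsum_bound:
  fixes f :: "'a \<Rightarrow> real" and c :: "'a \<Rightarrow> complex"
  assumes "(\<lambda>y. w y * \<bar>f y\<bar>) summable_on UNIV" "(\<Sum>\<^sub>\<infinity>y. w y * \<bar>f y\<bar>) \<le> M"
    and "\<And>y. cmod (c y) \<le> B * w y" "B \<ge> 0"
  shows "(\<lambda>y. complex_of_real (f y) * c y) summable_on UNIV"
    and "cmod (\<Sum>\<^sub>\<infinity>y. complex_of_real (f y) * c y) \<le> B * M"
proof -
  have s: "(\<lambda>y. B * (w y * \<bar>f y\<bar>)) summable_on UNIV"
    by (rule summable_on_cmult_right[OF assms(1)])
  have b: "cmod (complex_of_real (f y) * c y) \<le> B * (w y * \<bar>f y\<bar>)" for y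
  proof -
    have "cmod (c y) * \<bar>f y\<bar> \<le> (B * w y) * \<bar>f y\<bar>" by (intro mult_right_mono assms) auto
    then show ?thesis by (simp add: norm_mult mult_ac)
  qed
  show 1: "(\<lambda>y. complex_of_real (f y) * c y) summable_on UNIV"
    by (rule abs_summable_summable) (rule Infinite_Sum.summable_on_comparison_test[OF s], use b in auto)
  have "cmod (\<Sum>\<^sub>\<infinity>y. complex_of_real (f y) * c y) \<le> (\<Sum>\<^sub>\<infinity>y. B * (w y * \<bar>f y\<bar>))"
    using has_sum_infsum[OF 1] has_sum_infsum[OF s] by (rule norm_infsum_le) (use b in auto)
  also have "\<dots> = B * (\<Sum>\<^sub>\<infinity>y. w y * \<bar>f y\<bar>)" by (rule infsum_cmult_right) (use assms in auto)
  also have "\<dots> \<le> B * M" by (intro mult_left_mono assms)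
  finally show "cmod (\<Sum>\<^sub>\<infinity>y. complex_of_real (f y) * c y) \<le> B * M" .
qed

definition trig :: "(int ^ 'd::finite) set \<Rightarrow> (int ^ 'd \<Rightarrow> real) \<Rightarrow> real ^ 'd \<Rightarrow> complex" where
  "trig A f k = (\<Sum>y\<in>A. complex_of_real (f y) * exp (- (\<i> * complex_of_real (k \<bullet> rvec y))))"

lemma continuous_on_trig [continuous_intros]: "continuous_on S (trig A f)"
  unfolding trig_def by (intro continuous_intros)

lemma norm_character [simp]: "cmod (exp (- (\<i> * complex_of_real r))) = 1"
  by (metis norm_exp_i_times of_real_minus mult_minus_right)

lemma fourier_summable:
  assumes "(\<lambda>y. \<bar>f y\<bar>) summable_on UNIV"
  shows "(\<lambda>y. complex_of_real (f y) * exp (- (\<i> * complex_of_real (k \<bullet> rvec y)))) summable_on UNIV"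
    "cmod (fourier f k) \<le> (\<Sum>\<^sub>\<infinity>y. \<bar>f y\<bar>)"
  using weighted_infsum_bound[of "\<lambda>_. 1" f "\<Sum>\<^sub>\<infinity>y. \<bar>f y\<bar>" "\<lambda>y. exp (- (\<i> * complex_of_real (k \<bullet> rvec y)))" 1] assms
  by (auto simp: fourier_def)

lemma fourier_uniform_limit:
  assumes "(\<lambda>y. \<bar>f y\<bar>) summable_on UNIV"
  shows "uniform_limit UNIV (\<lambda>A. trig A f) (fourier f) (finite_subsets_at_top UNIV)"
  using Weierstrass_m_test_general[of UNIV UNIV "\<lambda>y k. complex_of_real (f y) * exp (- (\<i> * complex_of_real (k \<bullet> rvec y)))" "\<lambda>y. \<bar>f y\<bar>"] assms
  by (simp add: trig_def[abs_def] fourier_def[abs_def] norm_mult)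

lemma continuous_on_fourier:
  assumes "(\<lambda>y. \<bar>f y\<bar>) summable_on UNIV"
  shows "continuous_on UNIV (fourier f)"
  by (rule uniform_limit_theorem[OF _ fourier_uniform_limit[OF assms]]) (auto intro: continuous_on_trig)

lemma fourier_approx_trig:
  assumes "(\<lambda>y. \<bar>f y\<bar>) summable_on UNIV" "e > 0"
  obtains A where "finite A" "\<And>k. cmod (fourier f k - trig A f k) \<le> e"
proof -
  from uniform_limitD[OF fourier_uniform_limit[OF assms(1)] assms(2)]
  obtain A where "finite A" "\<And>B. finite B \<Longrightarrow> A \<subseteq> B \<Longrightarrow> (\<forall>k\<in>UNIV. dist (trig B f k) (fourier f k) < e)"
    by (auto simp: eventually_finite_subsets_at_top)
  then have "\<forall>k\<in>UNIV. dist (trig A f k) (fourier f k) < e" by blast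
  with \<open>finite A\<close> show ?thesis by (intro that[of A]) (auto simp: dist_norm norm_minus_commute intro: less_imp_le)
qed

lemma fourier_split:
  assumes "(\<lambda>y. \<bar>f y\<bar>) summable_on UNIV" "finite A"
  shows "fourier f k = trig A f k + fourier (\<lambda>y. if y \<in> A then 0 else f y) k"
proof -
  let ?e = "\<lambda>y. exp (- (\<i> * complex_of_real (k \<bullet> rvec y)))"
  note s = fourier_summable(1)[OF assms(1)]
  have s': "(\<lambda>y. complex_of_real (f y) * ?e y) summable_on (-A)"
    by (rule summable_on_subset_banach[OF s]) auto
  have "fourier f k = infsum (\<lambda>y. complex_of_real (f y) * ?e y) (A \<union> -A)"
    by (simp add: fourier_def)
  also have "\<dots> = infsum (\<lambda>y. complex_of_real (f y) * ?e y) A + infsum (\<lambda>y. complex_of_real (f y) * ?e y) (-A)"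
    by (rule infsum_Un_disjoint) (use s' assms in auto)
  also have "infsum (\<lambda>y. complex_of_real (f y) * ?e y) A = trig A f k"
    using assms by (simp add: trig_def)
  also have "infsum (\<lambda>y. complex_of_real (f y) * ?e y) (-A) = fourier (\<lambda>y. if y \<in> A then 0 else f y) k"
    unfolding fourier_def by (rule infsum_cong_neutral) auto
  finally show ?thesis .
qed

lemma torus_sets [measurable]: "torus \<in> sets borel"
  by (simp add: torus_def)

lemma emeasure_torus: "emeasure lborel (torus :: (real ^ 'd::finite) set) < \<infinity>"
  using emeasure_lborel_cbox_finite[of "\<chi> i::'d. - pi" "\<chi> i. pi"] by (simp add: torus_def less_top)

lemma measure_torus: "measure lborel (torus :: (real ^ 'd::finite) set) = (2 * pi) ^ CARD('d)"
  unfolding torus_def by (subst measure_lborel_cbox_eq)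
    (auto simp: Basis_vec_def inner_axis prod_Basis_cart[unfolded Basis_vec_def, simplified])

lemma torus_set_integrable:
  fixes h :: "real ^ 'd::finite \<Rightarrow> 'b::{banach, second_countable_topology}"
  assumes [measurable]: "h \<in> borel_measurable borel" and "\<And>k. k \<in> torus \<Longrightarrow> norm (h k) \<le> B"
  shows "set_integrable lborel torus h"
  unfolding set_integrable_def
proof (rule integrableI_bounded_set[where A=torus and B=B])
  show "AE x in lborel. x \<in> torus \<longrightarrow> norm (indicat_real torus x *\<^sub>R h x) \<le> B"
    using assms(2) by auto
qed (use emeasure_torus in auto)

lemma gaussian_integral:
  assumes "c > 0"
  shows "integrable lborel (\<lambda>k :: real ^ 'd::finite. exp (- c * (norm k)\<^sup>2))"
    and "(LINT k|lborel. exp (- c * (norm (k :: real ^ 'd::finite))\<^sup>2)) = (pi / c) powr (real CARD('d) / 2)"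
proof -
  \<comment> \<open>The instance of \<open>gaussian_fourier\<close> with \<open>L = mat 1\<close>,
    time \<open>2 * c\<close> and \<open>z = 0\<close>.\<close>
  have q: "2 * c * (k \<bullet> (mat 1 *v k)) / 2 = c * (norm k)\<^sup>2" for k :: "real ^ 'd"
    by (simp add: power2_norm_eq_inner)
  have *: "exp (\<i> * complex_of_real (k \<bullet> 0)) * complex_of_real (exp (- (2 * c) * (k \<bullet> (mat 1 *v k)) / 2))
      = complex_of_real (exp (- c * (norm k)\<^sup>2))" for k :: "real ^ 'd"
    using q[of k] by simp
  have L: "v \<bullet> ((mat 1 :: real ^ 'd ^ 'd) *v v) > 0" if "v \<noteq> 0" for v :: "real ^ 'd"
    using that by simp
  have c: "2 * c > 0" using assms by simp
  note G = gaussian_fourier(1,2)[OF transpose_mat L c, of 0, unfolded *]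
  have i: "integrable lborel (\<lambda>k :: real ^ 'd. complex_of_real (exp (- c * (norm k)\<^sup>2)))"
    by (rule G)
  show i': "integrable lborel (\<lambda>k :: real ^ 'd. exp (- c * (norm k)\<^sup>2))"
    using integrable_Re[OF i] by simp
  have "complex_of_real (LINT k|lborel. exp (- c * (norm (k :: real ^ 'd))\<^sup>2))
      = complex_of_real ((pi / c) powr (real CARD('d) / 2))"
    by (subst integral_complex_of_real[symmetric], subst G) (use assms in auto)
  then show "(LINT k|lborel. exp (- c * (norm (k :: real ^ 'd::finite))\<^sup>2)) = (pi / c) powr (real CARD('d) / 2)"
    by (simp only: of_real_eq_iff)
qed

text \<open>The first summand is the volume of the torus and serves \<open>t <= 1\<close>; the
  second is the integral of the Gaussian of rate \<open>c\<close> over the whole space and serves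
  \<open>t > 1\<close>. Their sum allows one bound in \<open>max 1 t\<close>.\<close>

definition gauss_const :: "'d::finite itself \<Rightarrow> real \<Rightarrow> real" where
  "gauss_const _ c = (2 * pi) ^ CARD('d) + (pi / c) powr (real CARD('d) / 2)"

lemma gauss_const_ge: "gauss_const TYPE('d::finite) c \<ge> (2 * pi) ^ CARD('d)" "gauss_const TYPE('d::finite) c > 0"
  by (auto simp: gauss_const_def intro: add_pos_nonneg)

lemma torus_gaussian_bound:
  assumes "c > 0" "t > 0"
  shows "(LINT k:torus|lborel. exp (- (c * t) * (norm (k :: real ^ 'd::finite))\<^sup>2))
    \<le> gauss_const TYPE('d) c * max 1 t powr (- real CARD('d) / 2)"
proof (cases "t \<le> 1")
  case True
  have "(LINT k:torus|lborel. exp (- (c * t) * (norm (k :: real ^ 'd))\<^sup>2)) \<le> (LINT k:(torus::(real^'d) set)|lborel. 1)"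
    using assms by (intro set_integral_mono torus_set_integrable[of _ 1]) auto
  also have "\<dots> = (2 * pi) ^ CARD('d)" by (simp add: set_lebesgue_integral_def measure_torus)
  also have "\<dots> \<le> gauss_const TYPE('d) c" by (rule gauss_const_ge)
  finally show ?thesis using True by simp
next
  case False
  note G = gaussian_integral[of "c * t", where 'd='d]
  have "(LINT k:torus|lborel. exp (- (c * t) * (norm (k :: real ^ 'd))\<^sup>2)) \<le> (LINT k|lborel. exp (- (c * t) * (norm (k :: real ^ 'd))\<^sup>2))"
    unfolding set_lebesgue_integral_def
    using assms by (intro integral_mono G torus_set_integrable[of _ 1, unfolded set_integrable_def]) (auto simp: indicator_def)
  also have "\<dots> = (pi / c) powr (real CARD('d) / 2) * t powr (- real CARD('d) / 2)"
    using assms by (subst G) (auto simp: powr_divide powr_mult powr_minus field_simps)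
  also have "\<dots> \<le> gauss_const TYPE('d) c * t powr (- real CARD('d) / 2)"
    by (intro mult_right_mono) (auto simp: gauss_const_def)
  finally show ?thesis using False by simp
qed

lemma trig_plancherel:
  assumes "finite A"
  shows "(LINT k:torus|lborel. (cmod (trig A f (k :: real ^ 'd::finite)))\<^sup>2) = (2 * pi) ^ CARD('d) * (\<Sum>y\<in>A. (f y)\<^sup>2)"
proof -
  have e: "exp (- (\<i> * complex_of_real (k \<bullet> rvec y))) * cnj (exp (- (\<i> * complex_of_real (k \<bullet> rvec z))))
      = exp (\<i> * complex_of_real (k \<bullet> rvec (z - y)))" for k :: "real^'d" and y z
    by (simp add: exp_cnj exp_add[symmetric] rvec_diff inner_diff_right algebra_simps)
  have "complex_of_real ((cmod (trig A f k))\<^sup>2) = (\<Sum>y\<in>A. \<Sum>z\<in>A. complex_of_real (f y * f z) * exp (\<i> * complex_of_real (k \<bullet> rvec (z - y))))"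
    for k :: "real^'d"
    unfolding complex_norm_square trig_def
    by (simp only: cnj_sum sum_product e[symmetric] complex_cnj_mult complex_cnj_complex_of_real of_real_mult mult_ac)
  then have "complex_of_real (LINT k:torus|lborel. (cmod (trig A f (k :: real ^ 'd)))\<^sup>2)
      = (LINT k:torus|lborel. (\<Sum>y\<in>A. \<Sum>z\<in>A. complex_of_real (f y * f z) * exp (\<i> * complex_of_real ((k::real^'d) \<bullet> rvec (z - y)))))"
    unfolding set_lebesgue_integral_def
    by (subst integral_complex_of_real[symmetric]) (simp add: scaleR_conv_of_real)
  also have "\<dots> = (\<Sum>y\<in>A. \<Sum>z\<in>A. LINT k:torus|lborel. complex_of_real (f y * f z) * exp (\<i> * complex_of_real ((k::real^'d) \<bullet> rvec (z - y))))"
  proof -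
    have i: "set_integrable lborel torus (\<lambda>k. complex_of_real (f y * f z) * exp (\<i> * complex_of_real ((k::real^'d) \<bullet> rvec (z - y))))" for y z
      by (rule torus_set_integrable[of _ "\<bar>f y * f z\<bar>"])
        (auto simp: norm_mult abs_mult intro!: borel_measurable_continuous_onI continuous_intros)
    show ?thesis
      using i unfolding set_lebesgue_integral_def set_integrable_def
      by (simp add: scaleR_sum_right)
  qed
  also have "\<dots> = (\<Sum>y\<in>A. \<Sum>z\<in>A. complex_of_real (f y * f z) * (if z = y then (2 * pi) ^ CARD('d) else 0))"
    by (simp only: set_integral_mult_right torus_orthogonality right_minus_eq)
  also have "\<dots> = complex_of_real ((2 * pi) ^ CARD('d) * (\<Sum>y\<in>A. (f y)\<^sup>2))"
    using assms by (simp add: if_distrib sum.delta power2_eq_square sum_distrib_left mult_ac cong: if_cong)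
  finally show ?thesis by (simp only: of_real_eq_iff)
qed

lemma trig_split_sum:
  assumes "finite A"
  shows "trig A f k = trig {y\<in>A. P y} f k + trig {y\<in>A. \<not> P y} f k"
  unfolding trig_def using assms
  by (subst sum.union_disjoint[symmetric]) (auto intro!: sum.cong)

lemma norm_trig_le: "cmod (trig A f k) \<le> (\<Sum>y\<in>A. \<bar>f y\<bar>)"
  unfolding trig_def by (rule order_trans[OF norm_sum]) (simp add: norm_mult)

text \<open>A weak form of the Hausdorff-Young and Hoelder inequalities: the part of \<open>f\<close> above the threshold
  \<open>lam = N \<tau> powr (1/p)\<close> is small in \<open>l^1\<close>, the part below it is small in \<open>l^2\<close>, where Plancherel applies.\<close>

lemma torus_pairing_trig:
  fixes f :: "int ^ 'd::finite \<Rightarrow> real" and h :: "real ^ 'd \<Rightarrow> complex"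
  assumes p: "1 \<le> p" "p \<le> 2" and A: "finite A" "(\<Sum>y\<in>A. \<bar>f y\<bar> powr p) \<le> N powr p" "N > 0"
    and hm: "h \<in> borel_measurable borel"
    and hb: "\<And>k. k \<in> torus \<Longrightarrow> cmod (h k) \<le> B * exp (- (c * t) * (norm k)\<^sup>2)" and "B > 0" "c > 0" "t > 0"
  shows "cmod (LINT k:torus|lborel. trig A f k * h k)
     \<le> 2 * gauss_const TYPE('d) c * N * B * max 1 t powr (- real CARD('d) / (2 * p))"
proof -
  \<comment> \<open>\<open>\<tau>\<close> is the order of the integral of the Gaussian factor over
    the torus, so \<open>h\<close> has \<open>L^1\<close> norm of order \<open>B * \<tau>\<close>
    and squared \<open>L^2\<close> norm of order \<open>B^2 * \<tau>\<close>.\<close>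
  define \<tau> where "\<tau> = max 1 t powr (- real CARD('d) / 2)"
  define g where "g = gauss_const TYPE('d) c"
  have \<tau>: "\<tau> > 0" by (auto simp: \<tau>_def)
  have g: "g > 0" "(2 * pi) ^ CARD('d) \<le> g" unfolding g_def by (rule gauss_const_ge)+
  define lam where "lam = N * \<tau> powr (1 / p)"
  \<comment> \<open>The weight in the inequality
    \<open>a * b <= \<mu> / 2 * a^2 + b^2 / (2 * \<mu>)\<close>. It is the ratio of the
    \<open>L^2\<close> bound \<open>B * \<tau> powr (1/2)\<close> for \<open>h\<close> to the
    \<open>l^2\<close> bound \<open>N * \<tau> powr (1/p - 1/2)\<close> for the small part of
    \<open>f\<close>, which makes both terms equal.\<close>
  define \<mu> where "\<mu> = B * \<tau> powr (1 - 1 / p) / N"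
  have pos: "lam > 0" "\<mu> > 0" using \<tau> \<open>N > 0\<close> \<open>B > 0\<close> by (auto simp: lam_def \<mu>_def)
  note [measurable] = hm
  have cont: "trig A' f \<in> borel_measurable borel" for A'
    by (intro borel_measurable_continuous_onI continuous_on_trig)
  note [measurable] = cont
  have hB: "cmod (h k) \<le> B" if "k \<in> torus" for k
  proof -
    have "B * exp (- (c * t) * (norm k)\<^sup>2) \<le> B * 1"
      using \<open>c > 0\<close> \<open>t > 0\<close> \<open>B > 0\<close> by (intro mult_left_mono) auto
    with hb[OF that] show ?thesis by simp
  qed
  have h1: "(LINT k:torus|lborel. cmod (h k)) \<le> B * g * \<tau>"
  proof -
    have "(LINT k:torus|lborel. cmod (h k)) \<le> (LINT k:torus|lborel. B * exp (- (c * t) * (norm (k::real^'d))\<^sup>2))"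
      by (intro set_integral_mono torus_set_integrable[of _ B]) (use hb hB \<open>c > 0\<close> \<open>t > 0\<close> \<open>B > 0\<close> in auto)
    also have "\<dots> = B * (LINT k:torus|lborel. exp (- (c * t) * (norm (k::real^'d))\<^sup>2))" by simp
    also have "\<dots> \<le> B * (g * \<tau>)"
      unfolding g_def \<tau>_def using \<open>B > 0\<close> \<open>c > 0\<close> \<open>t > 0\<close> by (intro mult_left_mono torus_gaussian_bound) auto
    finally show ?thesis by (simp add: mult_ac)
  qed
  have h2: "(LINT k:torus|lborel. (cmod (h k))\<^sup>2) \<le> B\<^sup>2 * g * \<tau>"
  proof -
    have "(LINT k:torus|lborel. (cmod (h k))\<^sup>2) \<le> (LINT k:torus|lborel. B * cmod (h k))"
      by (intro set_integral_mono torus_set_integrable[of _ "B\<^sup>2"])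
        (use hB \<open>B > 0\<close> in \<open>auto simp: power2_eq_square intro!: mult_mono mult_right_mono\<close>)
    also have "\<dots> = B * (LINT k:torus|lborel. cmod (h k))" by simp
    also have "\<dots> \<le> B * (B * g * \<tau>)" using \<open>B > 0\<close> by (intro mult_left_mono h1) auto
    finally show ?thesis by (simp add: power2_eq_square mult_ac)
  qed
  define L where "L = {y\<in>A. \<bar>f y\<bar> > lam}"
  define S where "S = {y\<in>A. \<not> \<bar>f y\<bar> > lam}"
  have fin: "finite L" "finite S" using A by (auto simp: L_def S_def)
  have bd: "cmod (trig A' f k * h k) \<le> (\<Sum>y\<in>A'. \<bar>f y\<bar>) * B" if "k \<in> torus" for A' k
    unfolding norm_mult by (intro mult_mono norm_trig_le hB that) (auto intro: sum_nonneg)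
  have int: "set_integrable lborel torus (\<lambda>k. trig A' f k * h k)" for A'
    by (rule torus_set_integrable[of _ "(\<Sum>y\<in>A'. \<bar>f y\<bar>) * B"]) (use bd in auto)
  have lN: "lam / N = \<tau> powr (1 / p)" using \<open>N > 0\<close> by (simp add: lam_def)
  have "cmod (LINT k:torus|lborel. trig L f k * h k) \<le> (LINT k:torus|lborel. cmod (trig L f k * h k))"
    by (rule set_integral_norm_bound[OF int])
  also have "\<dots> \<le> (LINT k:torus|lborel. (\<Sum>y\<in>L. \<bar>f y\<bar>) * cmod (h k))"
    unfolding norm_mult
    by (intro set_integral_mono torus_set_integrable[of _ "(\<Sum>y\<in>L. \<bar>f y\<bar>) * B"] mult_right_mono norm_trig_le)
      (use bd[of _ L] hB in \<open>auto simp: norm_mult abs_mult sum_nonneg intro!: mult_left_mono\<close>)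
  also have "\<dots> \<le> (\<Sum>y\<in>L. \<bar>f y\<bar>) * (B * g * \<tau>)"
    using h1 by (simp add: mult_left_mono sum_nonneg)
  also have "\<dots> \<le> (lam powr (1 - p) * N powr p) * (B * g * \<tau>)"
  proof (intro mult_right_mono)
    \<comment> \<open>On \<open>L\<close> the values exceed \<open>lam\<close> and
      \<open>1 - p\<close> is not positive, so the factor \<open>|f| powr (1 - p)\<close> is at most
      \<open>lam powr (1 - p)\<close>. On \<open>S\<close> the same is done with the nonnegative
      exponent \<open>2 - p\<close>.\<close>
    have "(\<Sum>y\<in>L. \<bar>f y\<bar>) \<le> (\<Sum>y\<in>L. lam powr (1 - p) * \<bar>f y\<bar> powr p)"
    proof (intro sum_mono)
      fix y assume "y \<in> L"
      then have y: "\<bar>f y\<bar> > lam" by (simp add: L_def)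
      then have "\<bar>f y\<bar> = \<bar>f y\<bar> powr (1 - p) * \<bar>f y\<bar> powr p"
        using pos by (simp add: powr_add[symmetric])
      also have "\<dots> \<le> lam powr (1 - p) * \<bar>f y\<bar> powr p"
        using pos p y by (intro mult_right_mono powr_mono2') auto
      finally show "\<bar>f y\<bar> \<le> lam powr (1 - p) * \<bar>f y\<bar> powr p" .
    qed
    also have "\<dots> = lam powr (1 - p) * (\<Sum>y\<in>L. \<bar>f y\<bar> powr p)" by (simp add: sum_distrib_left)
    also have "\<dots> \<le> lam powr (1 - p) * (\<Sum>y\<in>A. \<bar>f y\<bar> powr p)"
      using A by (intro mult_left_mono sum_mono2) (auto simp: L_def)
    also have "\<dots> \<le> lam powr (1 - p) * N powr p" using A by (intro mult_left_mono) auto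
    finally show "(\<Sum>y\<in>L. \<bar>f y\<bar>) \<le> lam powr (1 - p) * N powr p" .
  qed (use g \<tau> \<open>B > 0\<close> in auto)
  also have "\<dots> = g * N * B * \<tau> powr (1 / p)"
  proof -
    have "lam powr (1 - p) * N powr p * \<tau> = N powr (1 - p) * N powr p * (\<tau> powr ((1 - p) / p) * \<tau> powr 1)"
      using \<open>N > 0\<close> \<tau> by (simp add: lam_def powr_mult powr_powr)
    also have "N powr (1 - p) * N powr p = N" using \<open>N > 0\<close> by (simp add: powr_add[symmetric])
    also have "N * (\<tau> powr ((1 - p) / p) * \<tau> powr 1) = N * \<tau> powr ((1 - p) / p + 1)"
      by (simp only: powr_add)
    also have "(1 - p) / p + 1 = 1 / p" using p by (simp add: field_simps)
    finally show ?thesis by (simp add: mult_ac)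
  qed
  finally have I1: "cmod (LINT k:torus|lborel. trig L f k * h k) \<le> g * N * B * \<tau> powr (1 / p)" .
  have s2: "(\<Sum>y\<in>S. (f y)\<^sup>2) \<le> N\<^sup>2 * \<tau> powr (2 / p - 1)"
  proof -
    have "(\<Sum>y\<in>S. (f y)\<^sup>2) \<le> (\<Sum>y\<in>S. lam powr (2 - p) * \<bar>f y\<bar> powr p)"
    proof (intro sum_mono)
      fix y assume "y \<in> S"
      then have y: "\<bar>f y\<bar> \<le> lam" by (simp add: S_def)
      show "(f y)\<^sup>2 \<le> lam powr (2 - p) * \<bar>f y\<bar> powr p"
      proof (cases "f y = 0")
        case False
        then have "(f y)\<^sup>2 = \<bar>f y\<bar> powr (2 - p) * \<bar>f y\<bar> powr p"
          by (simp add: powr_add[symmetric])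
        also have "\<dots> \<le> lam powr (2 - p) * \<bar>f y\<bar> powr p"
          using p y by (intro mult_right_mono powr_mono2) auto
        finally show ?thesis .
      qed auto
    qed
    also have "\<dots> = lam powr (2 - p) * (\<Sum>y\<in>S. \<bar>f y\<bar> powr p)" by (simp add: sum_distrib_left)
    also have "\<dots> \<le> lam powr (2 - p) * (\<Sum>y\<in>A. \<bar>f y\<bar> powr p)"
      using A by (intro mult_left_mono sum_mono2) (auto simp: S_def)
    also have "\<dots> \<le> lam powr (2 - p) * N powr p" using A by (intro mult_left_mono) auto
    also have "\<dots> = N powr (2 - p) * N powr p * \<tau> powr ((2 - p) / p)"
      using \<open>N > 0\<close> \<tau> by (simp add: lam_def powr_mult powr_powr)
    also have "\<dots> = N\<^sup>2 * \<tau> powr (2 / p - 1)"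
      using \<open>N > 0\<close> p by (simp add: powr_add[symmetric] diff_divide_distrib)
    finally show ?thesis .
  qed
  have cb: "(cmod (trig S f k))\<^sup>2 \<le> (\<Sum>y\<in>S. \<bar>f y\<bar>)\<^sup>2" for k
    by (intro power_mono norm_trig_le) auto
  have hb2: "(cmod (h k))\<^sup>2 \<le> B\<^sup>2" if "k \<in> torus" for k
    by (intro power_mono hB that) auto
  have i1: "set_integrable lborel torus (\<lambda>k. (cmod (trig S f k))\<^sup>2)"
    by (rule torus_set_integrable[of _ "(\<Sum>y\<in>S. \<bar>f y\<bar>)\<^sup>2"]) (use cb in auto)
  have i2: "set_integrable lborel torus (\<lambda>k. (cmod (h k))\<^sup>2)"
    by (rule torus_set_integrable[of _ "B\<^sup>2"]) (use hb2 in auto)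
  have "cmod (LINT k:torus|lborel. trig S f k * h k) \<le> (LINT k:torus|lborel. cmod (trig S f k * h k))"
    by (rule set_integral_norm_bound[OF int])
  also have "\<dots> \<le> (LINT k:torus|lborel. \<mu> / 2 * (cmod (trig S f k))\<^sup>2 + 1 / (2 * \<mu>) * (cmod (h k))\<^sup>2)"
  proof (intro set_integral_mono set_integral_add(1) set_integrable_mult_right i1 i2 set_integrable_norm int)
    fix k
    have "0 \<le> (\<mu> * cmod (trig S f k) - cmod (h k))\<^sup>2 / (2 * \<mu>)" using pos by simp
    also have "\<dots> = \<mu> / 2 * (cmod (trig S f k))\<^sup>2 + 1 / (2 * \<mu>) * (cmod (h k))\<^sup>2 - cmod (trig S f k) * cmod (h k)"
      using pos by (simp add: field_simps power2_eq_square)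
    finally show "cmod (trig S f k * h k) \<le> \<mu> / 2 * (cmod (trig S f k))\<^sup>2 + 1 / (2 * \<mu>) * (cmod (h k))\<^sup>2"
      by (simp add: norm_mult)
  qed
  also have "\<dots> = \<mu> / 2 * (LINT k:torus|lborel. (cmod (trig S f k))\<^sup>2) + 1 / (2 * \<mu>) * (LINT k:torus|lborel. (cmod (h k))\<^sup>2)"
    using i1 i2 by (subst set_integral_add(2)) auto
  also have "\<dots> \<le> \<mu> / 2 * (g * (N\<^sup>2 * \<tau> powr (2 / p - 1))) + 1 / (2 * \<mu>) * (B\<^sup>2 * g * \<tau>)"
    unfolding trig_plancherel[OF fin(2)]
    using pos g s2 h2 by (intro add_mono mult_left_mono mult_mono) (auto intro: sum_nonneg)
  also have "\<dots> = g * N * B * \<tau> powr (1 / p)"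
  proof -
    have "\<mu> * (N\<^sup>2 * \<tau> powr (2 / p - 1)) = N * B * (\<tau> powr (1 - 1 / p) * \<tau> powr (2 / p - 1))"
      using \<open>N > 0\<close> by (simp add: \<mu>_def power2_eq_square)
    also have "\<tau> powr (1 - 1 / p) * \<tau> powr (2 / p - 1) = \<tau> powr (1 / p)"
      by (simp add: powr_add[symmetric])
    finally have e1: "\<mu> * (N\<^sup>2 * \<tau> powr (2 / p - 1)) = N * B * \<tau> powr (1 / p)" .
    have "\<tau> = \<tau> powr (1 - 1 / p) * \<tau> powr (1 / p)"
      using \<tau> by (simp add: powr_add[symmetric])
    then have "B\<^sup>2 * \<tau> = \<mu> * (N * B * \<tau> powr (1 / p))"
      using \<open>N > 0\<close> by (simp add: \<mu>_def power2_eq_square)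
    then have e2: "B\<^sup>2 * \<tau> / \<mu> = N * B * \<tau> powr (1 / p)" using pos by (simp add: field_simps)
    have "\<mu> / 2 * (g * (N\<^sup>2 * \<tau> powr (2 / p - 1))) + 1 / (2 * \<mu>) * (B\<^sup>2 * g * \<tau>)
       = g / 2 * (\<mu> * (N\<^sup>2 * \<tau> powr (2 / p - 1))) + g / 2 * (B\<^sup>2 * \<tau> / \<mu>)"
      by (simp add: field_simps)
    then show ?thesis unfolding e1 e2 by (simp add: field_simps)
  qed
  finally have I2: "cmod (LINT k:torus|lborel. trig S f k * h k) \<le> g * N * B * \<tau> powr (1 / p)" .
  have "trig A f k = trig L f k + trig S f k" for k
    unfolding L_def S_def by (rule trig_split_sum[OF A(1)])
  then have "(LINT k:torus|lborel. trig A f k * h k) = (LINT k:torus|lborel. trig L f k * h k) + (LINT k:torus|lborel. trig S f k * h k)"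
    using int by (simp add: distrib_right set_integral_add(2))
  then have "cmod (LINT k:torus|lborel. trig A f k * h k) \<le> 2 * g * N * B * \<tau> powr (1 / p)"
    using I1 I2 norm_triangle_ineq[of "LINT k:torus|lborel. trig L f k * h k" "LINT k:torus|lborel. trig S f k * h k"] by simp
  also have "\<tau> powr (1 / p) = max 1 t powr (- real CARD('d) / (2 * p))"
    by (simp add: \<tau>_def powr_powr)
  finally show ?thesis by (simp add: g_def)
qed

text \<open>A finite set of frequencies approximates the transform uniformly within
  \<open>e / W\<close>. Integrated against \<open>h\<close>, which is bounded by \<open>B\<close>,
  over the torus this costs at most \<open>e\<close>, and the \<open>l^p\<close> bound is inherited
  by finite sets.\<close>

lemma torus_pairing_fourier:
  fixes f :: "int ^ 'd::finite \<Rightarrow> real" and h :: "real ^ 'd \<Rightarrow> complex"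
  assumes p: "1 \<le> p" "p \<le> 2"
    and f1: "(\<lambda>y. \<bar>f y\<bar>) summable_on UNIV"
    and fp: "(\<lambda>y. \<bar>f y\<bar> powr p) summable_on UNIV" "(\<Sum>\<^sub>\<infinity>y. \<bar>f y\<bar> powr p) \<le> N powr p" and N: "N > 0"
    and hm: "h \<in> borel_measurable borel"
    and hb: "\<And>k. k \<in> torus \<Longrightarrow> cmod (h k) \<le> B * exp (- (c * t) * (norm k)\<^sup>2)" and B: "B > 0" and c: "c > 0" and t: "t > 0"
  shows "cmod (LINT k:torus|lborel. fourier f k * h k)
     \<le> 2 * gauss_const TYPE('d) c * N * B * max 1 t powr (- real CARD('d) / (2 * p))" (is "_ \<le> ?R")
proof (rule field_le_epsilon)
  fix e :: real assume e: "e > 0"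
  define W where "W = (2 * pi) ^ CARD('d) * B"
  have W: "W > 0" using B by (simp add: W_def)
  obtain A where A: "finite A" "\<And>k. cmod (fourier f k - trig A f k) \<le> e / W"
    using fourier_approx_trig[OF f1, of "e / W"] e W by auto
  note [measurable] = hm
  have [measurable]: "trig A f \<in> borel_measurable borel"
    by (intro borel_measurable_continuous_onI continuous_on_trig)
  have [measurable]: "fourier f \<in> borel_measurable borel"
    by (intro borel_measurable_continuous_onI continuous_on_fourier f1)
  have hB: "cmod (h k) \<le> B" if "k \<in> torus" for k
  proof -
    have "B * exp (- (c * t) * (norm k)\<^sup>2) \<le> B * 1"
      using c t B by (intro mult_left_mono) auto
    with hb[OF that] show ?thesis by simp
  qed
  have b1: "cmod (trig A f k * h k) \<le> (\<Sum>y\<in>A. \<bar>f y\<bar>) * B" if "k \<in> torus" for k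
    unfolding norm_mult by (intro mult_mono norm_trig_le hB that) (auto intro: sum_nonneg)
  have i1: "set_integrable lborel torus (\<lambda>k. trig A f k * h k)"
    by (rule torus_set_integrable[OF _ b1]) auto
  have b2: "cmod ((fourier f k - trig A f k) * h k) \<le> e / W * B" if "k \<in> torus" for k
    unfolding norm_mult using e W by (intro mult_mono A hB that) auto
  have i2: "set_integrable lborel torus (\<lambda>k. (fourier f k - trig A f k) * h k)"
    by (rule torus_set_integrable[OF _ b2]) auto
  have "(LINT k:torus|lborel. fourier f k * h k) = (LINT k:torus|lborel. trig A f k * h k + (fourier f k - trig A f k) * h k)"
    by (simp add: algebra_simps)
  also have "\<dots> = (LINT k:torus|lborel. trig A f k * h k) + (LINT k:torus|lborel. (fourier f k - trig A f k) * h k)"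
    by (rule set_integral_add(2)[OF i1 i2])
  finally have "cmod (LINT k:torus|lborel. fourier f k * h k) \<le> cmod (LINT k:torus|lborel. trig A f k * h k)
      + cmod (LINT k:torus|lborel. (fourier f k - trig A f k) * h k)"
    by (simp add: norm_triangle_ineq)
  also have "cmod (LINT k:torus|lborel. trig A f k * h k) \<le> ?R"
  proof (rule torus_pairing_trig[OF p A(1) _ N hm hb B c t])
    have "(\<Sum>y\<in>A. \<bar>f y\<bar> powr p) \<le> (\<Sum>\<^sub>\<infinity>y. \<bar>f y\<bar> powr p)"
      by (rule finite_sum_le_infsum[OF fp(1) A(1)]) auto
    with fp(2) show "(\<Sum>y\<in>A. \<bar>f y\<bar> powr p) \<le> N powr p" by simp
  qed
  also have "cmod (LINT k:torus|lborel. (fourier f k - trig A f k) * h k) \<le> (LINT k:torus|lborel. cmod ((fourier f k - trig A f k) * h k))"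
    by (rule set_integral_norm_bound[OF i2])
  also have "\<dots> \<le> (LINT k:(torus::(real^'d) set)|lborel. e / W * B)"
    by (intro set_integral_mono set_integrable_norm i2 b2 torus_set_integrable[of _ "\<bar>e / W * B\<bar>"]) auto
  also have "\<dots> = e" using W B by (simp add: set_lebesgue_integral_def measure_torus W_def field_simps)
  finally show "cmod (LINT k:torus|lborel. fourier f k * h k) \<le> ?R + e" by simp
qed

section \<open>Exponential tilting\<close>

text \<open>\<open>tilted \<theta> P P'\<close> says that \<open>P' k = P (k + i \<theta>)\<close> for a trigonometric polynomial \<open>P\<close>. The constant
  Fourier coefficient is the same for both, so no contour has to be moved explicitly.\<close>

inductive tilted :: "real ^ 'd::finite \<Rightarrow> (real ^ 'd \<Rightarrow> complex) \<Rightarrow> (real ^ 'd \<Rightarrow> complex) \<Rightarrow> bool" for \<theta> where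
  tilted_0: "tilted \<theta> (\<lambda>k. 0) (\<lambda>k. 0)"
| tilted_step: "tilted \<theta> P P' \<Longrightarrow> tilted \<theta>
     (\<lambda>k. P k + c * exp (- (\<i> * complex_of_real (k \<bullet> rvec y))))
     (\<lambda>k. P' k + c * exp (complex_of_real (\<theta> \<bullet> rvec y)) * exp (- (\<i> * complex_of_real (k \<bullet> rvec y))))"

lemma tilted_monomial:
  "tilted \<theta> (\<lambda>k. c * exp (- (\<i> * complex_of_real (k \<bullet> rvec y))))
     (\<lambda>k. c * exp (complex_of_real (\<theta> \<bullet> rvec y)) * exp (- (\<i> * complex_of_real (k \<bullet> rvec y))))"
  using tilted_step[OF tilted_0, of \<theta> c y] by simp

lemma tilted_const: "tilted \<theta> (\<lambda>k. c) (\<lambda>k. c)"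
  using tilted_monomial[of \<theta> c 0] by simp

lemma tilted_add:
  assumes "tilted \<theta> P P'" "tilted \<theta> R R'"
  shows "tilted \<theta> (\<lambda>k. P k + R k) (\<lambda>k. P' k + R' k)"
  using assms
proof induction
  case tilted_0 then show ?case by simp
next
  case (tilted_step P P' c y)
  from tilted.tilted_step[OF tilted_step.IH[OF tilted_step.prems], of c y]
  show ?case by (simp add: algebra_simps)
qed

text \<open>Under multiplication frequencies add, and the weight
  \<open>exp (\<theta> \<bullet> rvec y)\<close> is multiplicative in \<open>y\<close>; therefore
  tilting respects products.\<close>

lemma tilted_monomial_mult:
  assumes "tilted \<theta> P P'"
  shows "tilted \<theta> (\<lambda>k. c * exp (- (\<i> * complex_of_real (k \<bullet> rvec y))) * P k)
     (\<lambda>k. c * exp (complex_of_real (\<theta> \<bullet> rvec y)) * exp (- (\<i> * complex_of_real (k \<bullet> rvec y))) * P' k)"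
  using assms
proof induction
  case tilted_0 then show ?case by (simp add: tilted.tilted_0)
next
  case (tilted_step P P' c' z)
  have e: "exp (- (\<i> * complex_of_real (k \<bullet> rvec (y + z)))) = exp (- (\<i> * complex_of_real (k \<bullet> rvec y))) * exp (- (\<i> * complex_of_real (k \<bullet> rvec z)))"
    "exp (complex_of_real (\<theta> \<bullet> rvec (y + z))) = exp (complex_of_real (\<theta> \<bullet> rvec y)) * exp (complex_of_real (\<theta> \<bullet> rvec z))" for k
    by (simp_all add: rvec_add inner_add_right exp_add[symmetric] algebra_simps)
  from tilted.tilted_step[OF tilted_step.IH, of "c * c'" "y + z"]
  show ?case unfolding e by (simp add: algebra_simps)
qed

lemma tilted_mult:
  assumes "tilted \<theta> P P'" "tilted \<theta> R R'"
  shows "tilted \<theta> (\<lambda>k. P k * R k) (\<lambda>k. P' k * R' k)"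
  using assms
proof induction
  case tilted_0 then show ?case by (simp add: tilted.tilted_0)
next
  case (tilted_step P P' c y)
  from tilted_add[OF tilted_step.IH[OF tilted_step.prems] tilted_monomial_mult[OF tilted_step.prems]]
  show ?case by (simp add: algebra_simps)
qed

lemma tilted_power: "tilted \<theta> P P' \<Longrightarrow> tilted \<theta> (\<lambda>k. P k ^ n) (\<lambda>k. P' k ^ n)"
  by (induction n) (auto intro: tilted_const tilted_mult)

lemma tilted_sum:
  assumes "finite A" "\<And>j. j \<in> A \<Longrightarrow> tilted \<theta> (P j) (P' j)"
  shows "tilted \<theta> (\<lambda>k. \<Sum>j\<in>A. P j k) (\<lambda>k. \<Sum>j\<in>A. P' j k)"
  using assms by (induction A) (auto intro: tilted_0 tilted_add)

lemma tilted_trig: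
  assumes "finite A"
  shows "tilted \<theta> (trig A f) (trig A (\<lambda>y. f y * exp (\<theta> \<bullet> rvec y)))"
  unfolding trig_def[abs_def] of_real_mult exp_of_real[symmetric]
  by (intro tilted_sum assms tilted_monomial)

lemma tilted_continuous:
  assumes "tilted \<theta> P P'"
  shows "continuous_on S P" "continuous_on S P'"
  using assms by (induction; intro continuous_intros; simp)+

lemma torus_continuous_integrable:
  fixes h :: "real ^ 'd::finite \<Rightarrow> complex"
  assumes "continuous_on UNIV h"
  shows "set_integrable lborel torus h"
proof -
  have "compact (h ` torus)"
    unfolding torus_def by (intro compact_continuous_image continuous_on_subset[OF assms] compact_cbox) auto
  then obtain B where "\<And>k. k \<in> torus \<Longrightarrow> norm (h k) \<le> B"
    by (meson bounded_iff compact_imp_bounded imageI)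
  then show ?thesis using assms by (intro torus_set_integrable) (auto intro: borel_measurable_continuous_onI)
qed

text \<open>Against \<open>exp (i k x)\<close> orthogonality keeps only the monomial of frequency
  \<open>x\<close>, and tilting has multiplied its coefficient by
  \<open>exp (\<theta> \<bullet> rvec x)\<close>. The compensating factor is the source of all
  spatial decay.\<close>

lemma tilted_integral:
  fixes x :: "int ^ 'd::finite"
  assumes "tilted \<theta> P P'"
  shows "(LINT k:torus|lborel. exp (\<i> * complex_of_real (k \<bullet> rvec x)) * P k)
    = exp (- complex_of_real (\<theta> \<bullet> rvec x)) * (LINT k:torus|lborel. exp (\<i> * complex_of_real (k \<bullet> rvec x)) * P' k)"
  using assms
proof induction
  case tilted_0 then show ?case by (simp add: set_lebesgue_integral_def)
next
  case (tilted_step P P' c y)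
  have e: "exp (\<i> * complex_of_real (k \<bullet> rvec x)) * exp (- (\<i> * complex_of_real (k \<bullet> rvec y)))
      = exp (\<i> * complex_of_real (k \<bullet> rvec (x - y)))" for k
    by (simp add: exp_add[symmetric] rvec_diff inner_diff_right algebra_simps)
  have i: "set_integrable lborel torus (\<lambda>k. exp (\<i> * complex_of_real (k \<bullet> rvec x)) * P k)"
    "set_integrable lborel torus (\<lambda>k. exp (\<i> * complex_of_real (k \<bullet> rvec x)) * P' k)"
    "set_integrable lborel torus (\<lambda>k. c * exp (\<i> * complex_of_real (k \<bullet> rvec (x - y))))" for c
    by (intro torus_continuous_integrable continuous_intros tilted_continuous[OF tilted_step.hyps])+
  have a: "exp (\<i> * complex_of_real (k \<bullet> rvec x)) * (p + c * exp (- (\<i> * complex_of_real (k \<bullet> rvec y))))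
      = exp (\<i> * complex_of_real (k \<bullet> rvec x)) * p + c * exp (\<i> * complex_of_real (k \<bullet> rvec (x - y)))" for k p c
    unfolding e[symmetric] by (simp add: algebra_simps)
  show ?case
    unfolding a set_integral_add(2)[OF i(1) i(3)] set_integral_add(2)[OF i(2) i(3)]
      set_integral_mult_right torus_orthogonality tilted_step.IH
    by (auto simp: algebra_simps exp_minus)
qed

text \<open>The exponential of a trigonometric polynomial is no longer one. Its Taylor partial sums
  are, and dominated convergence with majorant \<open>exp (cmod z)\<close> transfers the identity to
  the limit on both sides.\<close>

lemma tilted_exp_integral:
  fixes x :: "int ^ 'd::finite"
  assumes G: "tilted \<theta> G G'" and S: "tilted \<theta> S S'"
  shows "(LINT k:torus|lborel. exp (\<i> * complex_of_real (k \<bullet> rvec x)) * (G k * exp (S k)))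
    = exp (- complex_of_real (\<theta> \<bullet> rvec x)) * (LINT k:torus|lborel. exp (\<i> * complex_of_real (k \<bullet> rvec x)) * (G' k * exp (S' k)))"
proof -
  define E where "E = (\<lambda>n z. \<Sum>j\<le>n. z ^ j / fact j :: complex)"
  have Elim: "(\<lambda>n. E n z) \<longlonglongrightarrow> exp z" for z
    using exp_converges[of z] unfolding sums_def_le E_def by (simp add: scaleR_conv_of_real divide_inverse mult.commute)
  have Eb: "cmod (E n z) \<le> exp (cmod z)" for n z
  proof -
    have "cmod (E n z) \<le> (\<Sum>j\<le>n. cmod z ^ j / fact j)"
      unfolding E_def by (rule order_trans[OF norm_sum]) (simp add: norm_divide norm_power)
    also have "\<dots> \<le> (\<Sum>j. cmod z ^ j / fact j)"
      using summable_exp[of "cmod z"] by (intro sum_le_suminf) (auto simp: field_simps)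
    also have "\<dots> = exp (cmod z)" by (simp add: exp_def scaleR_conv_of_real divide_inverse mult.commute)
    finally show ?thesis .
  qed
  have lim: "(\<lambda>n. LINT k:torus|lborel. exp (\<i> * complex_of_real (k \<bullet> rvec x)) * (g k * E n (s k)))
      \<longlonglongrightarrow> (LINT k:torus|lborel. exp (\<i> * complex_of_real (k \<bullet> rvec x)) * (g k * exp (s k)))"
    if c: "continuous_on UNIV g" "continuous_on UNIV s" for g s :: "real^'d \<Rightarrow> complex"
  proof -
    have cE: "continuous_on UNIV (\<lambda>k. E n (s k))" for n
      unfolding E_def by (intro continuous_intros c) auto
    have [measurable]: "g \<in> borel_measurable borel" "s \<in> borel_measurable borel" "(\<lambda>k. E n (s k)) \<in> borel_measurable borel" for n
      by (intro borel_measurable_continuous_onI c cE)+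
    have i: "set_integrable lborel torus (\<lambda>k. complex_of_real (cmod (g k) * exp (cmod (s k))))"
      by (intro torus_continuous_integrable continuous_intros c)
    have i': "integrable lborel (\<lambda>k. indicator torus k *\<^sub>R (cmod (g k) * exp (cmod (s k))))"
      using integrable_norm[OF i[unfolded set_integrable_def]] by (simp add: norm_mult)
    show ?thesis
      unfolding set_lebesgue_integral_def
    proof (rule integral_dominated_convergence[OF _ _ i'])
      show "AE k in lborel. (\<lambda>n. indicat_real torus k *\<^sub>R (exp (\<i> * complex_of_real (k \<bullet> rvec x)) * (g k * E n (s k))))
         \<longlonglongrightarrow> indicat_real torus k *\<^sub>R (exp (\<i> * complex_of_real (k \<bullet> rvec x)) * (g k * exp (s k)))"
        by (intro AE_I2 tendsto_intros Elim)
      show "AE k in lborel. norm (indicat_real torus k *\<^sub>R (exp (\<i> * complex_of_real (k \<bullet> rvec x)) * (g k * E n (s k))))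
         \<le> indicat_real torus k *\<^sub>R (cmod (g k) * exp (cmod (s k)))" for n
        using Eb by (intro AE_I2) (auto simp: norm_mult intro!: mult_left_mono)
    qed measurable
  qed
  have tE: "tilted \<theta> (\<lambda>k. G k * E n (S k)) (\<lambda>k. G' k * E n (S' k))" for n
  proof -
    have "tilted \<theta> (\<lambda>k. S k ^ j / fact j) (\<lambda>k. S' k ^ j / fact j)" for j
      using tilted_mult[OF tilted_const[of \<theta> "1 / fact j"] tilted_power[OF S, of j]] by simp
    then show ?thesis unfolding E_def by (intro tilted_mult G tilted_sum) auto
  qed
  note c = tilted_continuous[OF G, of UNIV] tilted_continuous[OF S, of UNIV]
  have "(\<lambda>n. LINT k:torus|lborel. exp (\<i> * complex_of_real (k \<bullet> rvec x)) * (G k * E n (S k)))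
     \<longlonglongrightarrow> exp (- complex_of_real (\<theta> \<bullet> rvec x)) * (LINT k:torus|lborel. exp (\<i> * complex_of_real (k \<bullet> rvec x)) * (G' k * exp (S' k)))"
    unfolding tilted_integral[OF tE] by (intro tendsto_intros lim c)
  with lim[OF c(1,3)] show ?thesis by (rule LIMSEQ_unique)
qed

section \<open>Moments of the pair (Q, g)\<close>

lemma has_sum_diff':
  fixes f :: "'a \<Rightarrow> 'b::{topological_ab_group_add}"
  assumes "(f has_sum a) A" "(g has_sum b) A"
  shows "((\<lambda>x. f x - g x) has_sum (a - b)) A"
proof -
  have "((\<lambda>x. - g x) has_sum (- b)) A" using assms(2) by (simp add: has_sum_uminus)
  from has_sum_add[OF assms(1) this] show ?thesis by simp
qed

lemma has_sum_finite_sum: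
  fixes f :: "'i \<Rightarrow> 'a \<Rightarrow> 'b::{topological_comm_monoid_add}"
  assumes "finite I" "\<And>i. i \<in> I \<Longrightarrow> (f i has_sum s i) A"
  shows "((\<lambda>x. \<Sum>i\<in>I. f i x) has_sum (\<Sum>i\<in>I. s i)) A"
  using assms by (induction I) (auto intro: has_sum_add)

lemma has_sum_weight_bound:
  fixes f :: "'a \<Rightarrow> real" and c :: "'a \<Rightarrow> complex"
  assumes "((\<lambda>y. complex_of_real (f y) * c y) has_sum s) UNIV"
    and "(\<lambda>y. w y * \<bar>f y\<bar>) summable_on UNIV" "(\<Sum>\<^sub>\<infinity>y. w y * \<bar>f y\<bar>) \<le> M"
    and "\<And>y. cmod (c y) \<le> B * w y" "B \<ge> 0"
  shows "cmod s \<le> B * M"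
  using weighted_infsum_bound(2)[OF assms(2-5)] infsumI[OF assms(1)] by simp

lemma powr_le_powr_ge_1_or_0:
  fixes x :: real
  assumes "x = 0 \<or> x \<ge> 1" "0 < a" "a \<le> b"
  shows "x powr a \<le> x powr b"
  using assms by (auto intro: powr_mono)

lemma norm_rvec_cases: "norm (rvec y) = 0 \<or> norm (rvec y) \<ge> 1"
  using norm_rvec_ge_1[of y] by auto

text \<open>A lattice vector is zero or has length at least 1, so a higher moment dominates a lower
  one with the same bound.\<close>

lemma lp_norm_weight:
  fixes f :: "int ^ 'd::finite \<Rightarrow> real"
  assumes "lp_norm 1 (\<lambda>y. norm (rvec y) powr b * f y) \<le> ennreal M" "M \<ge> 0" "0 < a" "a \<le> b"
  shows "(\<lambda>y. norm (rvec y) powr a * \<bar>f y\<bar>) summable_on UNIV"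
    and "(\<Sum>\<^sub>\<infinity>y. norm (rvec y) powr a * \<bar>f y\<bar>) \<le> M"
proof -
  have 1: "(\<lambda>y. norm (rvec y) powr b * \<bar>f y\<bar>) summable_on UNIV" "(\<Sum>\<^sub>\<infinity>y. norm (rvec y) powr b * \<bar>f y\<bar>) \<le> M"
    using lp_norm_1_leD[OF assms(1,2)] by (simp_all add: abs_mult)
  have le: "norm (rvec y) powr a * \<bar>f y\<bar> \<le> norm (rvec y) powr b * \<bar>f y\<bar>" for y
    by (intro mult_right_mono powr_le_powr_ge_1_or_0 norm_rvec_cases assms) auto
  show 2: "(\<lambda>y. norm (rvec y) powr a * \<bar>f y\<bar>) summable_on UNIV"
    by (rule summable_on_comparison_test[OF 1(1)]) (use le in auto)
  show "(\<Sum>\<^sub>\<infinity>y. norm (rvec y) powr a * \<bar>f y\<bar>) \<le> M"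
    using infsum_mono[OF 2 1(1)] le 1(2) by force
qed

text \<open>Markov's inequality for a weighted norm: outside the ball the weight is at least
  \<open>R\<close>, so passing to the tail gains the factor \<open>1 / R\<close>. In this form the
  decay hypotheses of the class enter the truncation.\<close>

lemma tail_weight:
  fixes f :: "int ^ 'd::finite \<Rightarrow> real"
  assumes w: "lp_norm p (\<lambda>y. w y * f y) \<le> ennreal M" and p: "p > 0" "M > 0" and R: "R > 0"
    "\<And>y. norm (rvec y) > r \<Longrightarrow> w y \<ge> R"
  shows "(\<lambda>y. \<bar>if norm (rvec y) \<le> r then 0 else f y\<bar> powr p) summable_on UNIV"
    and "(\<Sum>\<^sub>\<infinity>y. \<bar>if norm (rvec y) \<le> r then 0 else f y\<bar> powr p) \<le> (M / R) powr p"
proof -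
  note L = lp_norm_leD[OF w p(1)]
  have s: "(\<lambda>y. (1 / R powr p) * \<bar>w y * f y\<bar> powr p) summable_on UNIV"
    using L p by (intro summable_on_cmult_right) auto
  have le: "\<bar>if norm (rvec y) \<le> r then 0 else f y\<bar> powr p \<le> (1 / R powr p) * \<bar>w y * f y\<bar> powr p" for y
  proof (cases "norm (rvec y) \<le> r")
    case False
    then have "R \<le> w y" using R by auto
    then have "R * \<bar>f y\<bar> \<le> \<bar>w y * f y\<bar>" using R by (auto simp: abs_mult intro!: mult_right_mono)
    then have "(R * \<bar>f y\<bar>) powr p \<le> \<bar>w y * f y\<bar> powr p" using R p by (intro powr_mono2) auto
    then show ?thesis using False R by (simp add: powr_mult field_simps)
  qed simp
  show 1: "(\<lambda>y. \<bar>if norm (rvec y) \<le> r then 0 else f y\<bar> powr p) summable_on UNIV"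
    by (rule summable_on_comparison_test[OF s]) (use le in auto)
  have "(\<Sum>\<^sub>\<infinity>y. \<bar>if norm (rvec y) \<le> r then 0 else f y\<bar> powr p) \<le> (\<Sum>\<^sub>\<infinity>y. (1 / R powr p) * \<bar>w y * f y\<bar> powr p)"
    using le by (intro infsum_mono 1 s) auto
  also have "\<dots> = (1 / R powr p) * (\<Sum>\<^sub>\<infinity>y. \<bar>w y * f y\<bar> powr p)"
    using L p by (intro infsum_cmult_right) auto
  also have "\<dots> \<le> (1 / R powr p) * M powr p" using L p R by (intro mult_left_mono) auto
  finally show "(\<Sum>\<^sub>\<infinity>y. \<bar>if norm (rvec y) \<le> r then 0 else f y\<bar> powr p) \<le> (M / R) powr p"
    using p R by (simp add: powr_divide)
qed

section \<open>Taylor remainders of the exponential\<close>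

text \<open>Mean value inequality on a half plane, which is convex and on which the derivative of
  \<open>exp\<close> has modulus at most \<open>exp m\<close>.\<close>

lemma cmod_exp_diff_le:
  assumes "Re a \<le> m" "Re b \<le> m"
  shows "cmod (exp a - exp b) \<le> exp m * cmod (a - b)"
proof (rule field_differentiable_bound[where S="{z. Re z \<le> m}" and f'=exp])
  show "convex {z. Re z \<le> m}" by (rule convex_halfspace_Re_le)
qed (use assms in \<open>auto simp: norm_exp_eq_Re intro!: derivative_eq_intros\<close>)

text \<open>Interpolation between the cubic remainder, which is good for \<open>|u| <= 1\<close>,
  and the quadratic one, which is good for \<open>|u| >= 1\<close>. The exponent
  \<open>2 + z\<close> is one that the moments of \<open>Q\<close> can sum.\<close>

lemma iexp_taylor2:
  assumes "0 \<le> z" "z \<le> 1"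
  shows "cmod (1 - exp (- (\<i> * complex_of_real u)) - \<i> * complex_of_real u - complex_of_real (u\<^sup>2 / 2)) \<le> \<bar>u\<bar> powr (2 + z)"
proof -
  have s: "(\<Sum>k\<le>2. (\<i> * complex_of_real (-u)) ^ k / fact k) = 1 - \<i> * complex_of_real u - complex_of_real (u\<^sup>2 / 2)"
    by (simp add: numeral_2_eq_2 power2_eq_square field_simps)
  have "1 - exp (- (\<i> * complex_of_real u)) - \<i> * complex_of_real u - complex_of_real (u\<^sup>2 / 2)
      = - (iexp (-u) - (\<Sum>k\<le>2. (\<i> * complex_of_real (-u)) ^ k / fact k))"
    unfolding s by simp
  then have e: "cmod (1 - exp (- (\<i> * complex_of_real u)) - \<i> * complex_of_real u - complex_of_real (u\<^sup>2 / 2))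
      = cmod (iexp (-u) - (\<Sum>k\<le>2. (\<i> * complex_of_real (-u)) ^ k / fact k))" (is "?l = _")
    by (simp only: norm_minus_cancel)
  have f3: "Suc 2 = 3" "fact 3 = (6::real)" by (simp_all add: fact_numeral)
  have b1: "?l \<le> \<bar>u\<bar> ^ 3"
    unfolding e using iexp_approx1[of "-u" 2] zero_le_power[of "\<bar>u\<bar>" 3]
    unfolding f3 abs_minus_cancel by linarith
  have b2: "?l \<le> \<bar>u\<bar> ^ 2"
    unfolding e using iexp_approx2[of "-u" 2] by (simp add: fact_numeral)
  show ?thesis
  proof (cases "\<bar>u\<bar> \<le> 1")
    case True
    have "\<bar>u\<bar> ^ 3 \<le> \<bar>u\<bar> powr (2 + z)"
    proof (cases "u = 0")
      case False
      then have "\<bar>u\<bar> ^ 3 = \<bar>u\<bar> powr 3" by simp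
      also have "\<dots> \<le> \<bar>u\<bar> powr (2 + z)" using True False assms by (intro powr_mono') auto
      finally show ?thesis .
    qed auto
    with b1 show ?thesis by simp
  next
    case False
    then have "\<bar>u\<bar> ^ 2 = \<bar>u\<bar> powr 2" by simp
    also have "\<dots> \<le> \<bar>u\<bar> powr (2 + z)" using False assms by (intro powr_mono) auto
    finally show ?thesis using b2 by simp
  qed
qed

lemma iexp_taylor0:
  assumes "0 \<le> z" "z \<le> 1"
  shows "cmod (exp (- (\<i> * complex_of_real u)) - 1) \<le> 2 * \<bar>u\<bar> powr z"
proof (cases "\<bar>u\<bar> \<le> 1")
  case True
  have "cmod (exp (- (\<i> * complex_of_real u)) - 1) \<le> \<bar>u\<bar>"
    using iexp_approx1[of "-u" 0] by simp
  also have "\<dots> \<le> \<bar>u\<bar> powr z"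
  proof (cases "u = 0")
    case False
    then have "\<bar>u\<bar> = \<bar>u\<bar> powr 1" by simp
    also have "\<dots> \<le> \<bar>u\<bar> powr z" using True False assms by (intro powr_mono') auto
    finally show ?thesis .
  qed auto
  finally show ?thesis using powr_ge_zero[of "\<bar>u\<bar>" z] by linarith
next
  case False
  have "cmod (exp (- (\<i> * complex_of_real u)) - 1) \<le> cmod (exp (- (\<i> * complex_of_real u))) + cmod 1"
    by (rule norm_triangle_ineq4)
  also have "\<dots> = 2 * 1" by simp
  also have "1 \<le> \<bar>u\<bar> powr z" using False assms by (simp add: ge_one_powr_ge_zero)
  finally show ?thesis by simp
qed

section \<open>Consequences of membership in the class: moments, expansions, ellipticity\<close>

locale class_pair =
  fixes Q g :: "int ^ 'd::finite \<Rightarrow> real" and M K \<zeta> :: real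
  assumes class_Q: "(Q, g) \<in> class_Q M K \<zeta>" and M: "M > 0" and K: "K > 0" and \<zeta>: "\<zeta> > 0"
begin

abbreviation "F k \<equiv> fourier Q 0 - fourier Q k"
abbreviation "\<eta> \<equiv> drift Q"
abbreviation "\<Lambda> \<equiv> second_moment Q"
text \<open>The Taylor remainders in use gain at most one extra power of \<open>norm k\<close>, so a
  moment exponent above 1 is cut down to 1.\<close>

definition "z1 = min \<zeta> 1"

lemma z1: "0 < z1" "z1 \<le> 1" "z1 \<le> \<zeta>" using \<zeta> by (auto simp: z1_def)

lemma class_QD:
  "lp_norm 1 Q \<le> ennreal M"
  "lp_norm 1 (\<lambda>y. norm (rvec y) powr (2 + \<zeta>) * Q y) \<le> ennreal M"
  "k \<in> torus \<Longrightarrow> K * (norm k)\<^sup>2 \<le> Re (F k)"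
  "lp_norm 1 g \<le> ennreal M"
  "lp_norm 1 (\<lambda>y. norm (rvec y) powr \<zeta> * g y) \<le> ennreal M"
  "lp_norm (min (p_exp CARD('d) \<zeta>) 2) (\<lambda>y. (norm (rvec y))\<^sup>2 * g y) \<le> ennreal M"
  "CARD('d) \<ge> 4 \<Longrightarrow> lp_norm (min (real CARD('d) / 3) 2) (\<lambda>y. norm (rvec y) ^ (CARD('d) - 1) * Q y) \<le> ennreal M"
  "CARD('d) \<ge> 4 \<Longrightarrow> lp_norm 2 (\<lambda>y. norm (rvec y) ^ (CARD('d) - 1) * g y) \<le> ennreal M"
proof -
  note c = class_Q[unfolded class_Q_def mem_Collect_eq prod.case]
  show "lp_norm 1 Q \<le> ennreal M" by (rule c[THEN conjunct1])
  note c = c[THEN conjunct2]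
  show "lp_norm 1 (\<lambda>y. norm (rvec y) powr (2 + \<zeta>) * Q y) \<le> ennreal M" by (rule c[THEN conjunct1])
  note c = c[THEN conjunct2]
  show "k \<in> torus \<Longrightarrow> K * (norm k)\<^sup>2 \<le> Re (F k)" by (rule c[THEN conjunct1, THEN bspec])
  note c = c[THEN conjunct2]
  show "lp_norm 1 g \<le> ennreal M" by (rule c[THEN conjunct1])
  note c = c[THEN conjunct2]
  show "lp_norm 1 (\<lambda>y. norm (rvec y) powr \<zeta> * g y) \<le> ennreal M" by (rule c[THEN conjunct1])
  note c = c[THEN conjunct2]
  show "lp_norm (min (p_exp CARD('d) \<zeta>) 2) (\<lambda>y. (norm (rvec y))\<^sup>2 * g y) \<le> ennreal M" by (rule c[THEN conjunct1])
  note c = c[THEN conjunct2, THEN mp]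
  show "CARD('d) \<ge> 4 \<Longrightarrow> lp_norm (min (real CARD('d) / 3) 2) (\<lambda>y. norm (rvec y) ^ (CARD('d) - 1) * Q y) \<le> ennreal M"
    by (rule c[THEN conjunct1])
  show "CARD('d) \<ge> 4 \<Longrightarrow> lp_norm 2 (\<lambda>y. norm (rvec y) ^ (CARD('d) - 1) * g y) \<le> ennreal M"
    by (rule c[THEN conjunct2])
qed

lemmas Re_F_ge = class_QD(3)

lemma Q_sum: "(\<lambda>y. \<bar>Q y\<bar>) summable_on UNIV" "(\<Sum>\<^sub>\<infinity>y. \<bar>Q y\<bar>) \<le> M"
  by (rule lp_norm_1_leD[OF class_QD(1) less_imp_le[OF M]])+

lemma g_sum: "(\<lambda>y. \<bar>g y\<bar>) summable_on UNIV" "(\<Sum>\<^sub>\<infinity>y. \<bar>g y\<bar>) \<le> M"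
  by (rule lp_norm_1_leD[OF class_QD(4) less_imp_le[OF M]])+

lemma Q_moment:
  assumes "0 < a" "a \<le> 2 + \<zeta>"
  shows "(\<lambda>y. norm (rvec y) powr a * \<bar>Q y\<bar>) summable_on UNIV" "(\<Sum>\<^sub>\<infinity>y. norm (rvec y) powr a * \<bar>Q y\<bar>) \<le> M"
  by (rule lp_norm_weight[OF class_QD(2) less_imp_le[OF M] assms])+

lemma g_moment:
  assumes "0 < a" "a \<le> \<zeta>"
  shows "(\<lambda>y. norm (rvec y) powr a * \<bar>g y\<bar>) summable_on UNIV" "(\<Sum>\<^sub>\<infinity>y. norm (rvec y) powr a * \<bar>g y\<bar>) \<le> M"
  by (rule lp_norm_weight[OF class_QD(5) less_imp_le[OF M] assms])+

lemma Q_moment_nat: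
  assumes "n = 1 \<or> n = 2"
  shows "(\<lambda>y. norm (rvec y) ^ n * \<bar>Q y\<bar>) summable_on UNIV" "(\<Sum>\<^sub>\<infinity>y. norm (rvec y) ^ n * \<bar>Q y\<bar>) \<le> M"
  using Q_moment[of "real n"] assms \<zeta> powr_realpow'[of "norm (rvec _)" n] by (auto simp: powr_realpow')

lemma component_bound: "\<bar>v \<bullet> rvec y\<bar> \<le> norm v * norm (rvec y)"
  by (rule Cauchy_Schwarz_ineq2)

lemma has_sum_drift: "((\<lambda>y. (v \<bullet> rvec y) * Q y) has_sum (v \<bullet> \<eta>)) UNIV"
proof -
  have "(\<lambda>y. rvec y $ j * Q y) summable_on UNIV" for j
  proof (rule abs_summable_summable, rule Infinite_Sum.summable_on_comparison_test[OF Q_moment_nat(1)[of 1]])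
    show "norm (rvec y $ j * Q y) \<le> norm (rvec y) ^ 1 * \<bar>Q y\<bar>" for y
      using component_le_norm_cart[of "rvec y" j] by (auto simp: abs_mult intro!: mult_right_mono)
  qed auto
  then have "((\<lambda>y. rvec y $ j * Q y) has_sum (\<eta> $ j)) UNIV" for j
    by (simp add: drift_def)
  then have "((\<lambda>y. \<Sum>j\<in>UNIV. v $ j * (rvec y $ j * Q y)) has_sum (\<Sum>j\<in>UNIV. v $ j * \<eta> $ j)) UNIV"
    by (intro has_sum_finite_sum has_sum_cmult_right) auto
  then show ?thesis by (simp add: inner_vec_def sum_distrib_right mult.assoc)
qed

lemma has_sum_second_moment: "((\<lambda>y. (v \<bullet> rvec y) * (w \<bullet> rvec y) * Q y) has_sum (v \<bullet> (\<Lambda> *v w))) UNIV"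
proof -
  have "(\<lambda>y. rvec y $ j * rvec y $ l * Q y) summable_on UNIV" for j l
  proof (rule abs_summable_summable, rule Infinite_Sum.summable_on_comparison_test[OF Q_moment_nat(1)[of 2]])
    show "norm (rvec y $ j * rvec y $ l * Q y) \<le> norm (rvec y) ^ 2 * \<bar>Q y\<bar>" for y
      using mult_mono[OF component_le_norm_cart[of "rvec y" j] component_le_norm_cart[of "rvec y" l]]
      by (auto simp: abs_mult power2_eq_square intro!: mult_right_mono)
  qed auto
  then have "((\<lambda>y. rvec y $ j * rvec y $ l * Q y) has_sum (\<Lambda> $ j $ l)) UNIV" for j l
    by (simp add: second_moment_def)
  then have "((\<lambda>y. \<Sum>j\<in>UNIV. \<Sum>l\<in>UNIV. (v $ j * w $ l) * (rvec y $ j * rvec y $ l * Q y))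
      has_sum (\<Sum>j\<in>UNIV. \<Sum>l\<in>UNIV. (v $ j * w $ l) * \<Lambda> $ j $ l)) UNIV"
    by (intro has_sum_finite_sum has_sum_cmult_right) auto
  also have "(\<lambda>y. \<Sum>j\<in>UNIV. \<Sum>l\<in>UNIV. (v $ j * w $ l) * (rvec y $ j * rvec y $ l * Q y))
      = (\<lambda>y. (v \<bullet> rvec y) * (w \<bullet> rvec y) * Q y)"
  proof
    fix y
    have "(v \<bullet> rvec y) * (w \<bullet> rvec y) = (\<Sum>j\<in>UNIV. v $ j * rvec y $ j) * (\<Sum>l\<in>UNIV. w $ l * rvec y $ l)"
      by (simp add: inner_vec_def)
    also have "\<dots> = (\<Sum>j\<in>UNIV. \<Sum>l\<in>UNIV. (v $ j * rvec y $ j) * (w $ l * rvec y $ l))"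
      by (rule sum_product)
    finally show "(\<Sum>j\<in>UNIV. \<Sum>l\<in>UNIV. (v $ j * w $ l) * (rvec y $ j * rvec y $ l * Q y)) = (v \<bullet> rvec y) * (w \<bullet> rvec y) * Q y"
      by (simp only: sum_distrib_right) (intro sum.cong refl, simp only: mult_ac)
  qed
  also have "(\<Sum>j\<in>UNIV. \<Sum>l\<in>UNIV. (v $ j * w $ l) * \<Lambda> $ j $ l) = v \<bullet> (\<Lambda> *v w)"
    by (simp add: inner_vec_def matrix_vector_mult_def sum_distrib_left mult_ac)
  finally show ?thesis .
qed

lemma drift_bound: "\<bar>v \<bullet> \<eta>\<bar> \<le> norm v * M" "norm \<eta> \<le> M"
proof -
  have *: "\<bar>v \<bullet> \<eta>\<bar> \<le> norm v * M" for v
  proof -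
    have "((\<lambda>y. complex_of_real (Q y) * complex_of_real (v \<bullet> rvec y)) has_sum complex_of_real (v \<bullet> \<eta>)) UNIV"
      using has_sum_of_real[OF has_sum_drift[of v], where 'a=complex] by (simp add: mult.commute)
    from has_sum_weight_bound[OF this Q_moment_nat[of 1], of "norm v"] show ?thesis
      using component_bound[of v] by auto
  qed
  then show "\<bar>v \<bullet> \<eta>\<bar> \<le> norm v * M" .
  have "norm \<eta> * norm \<eta> \<le> norm \<eta> * M" using *[of \<eta>] by (simp add: power2_norm_eq_inner[symmetric] power2_eq_square)
  then show "norm \<eta> \<le> M" using M by (cases "norm \<eta> = 0") auto
qed

lemma second_moment_bound: "\<bar>v \<bullet> (\<Lambda> *v w)\<bar> \<le> norm v * norm w * M"
proof -
  have "((\<lambda>y. complex_of_real (Q y) * complex_of_real ((v \<bullet> rvec y) * (w \<bullet> rvec y))) has_sum complex_of_real (v \<bullet> (\<Lambda> *v w))) UNIV"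
    using has_sum_of_real[OF has_sum_second_moment[of v w], where 'a=complex] by (simp add: mult_ac)
  from has_sum_weight_bound[OF this Q_moment_nat[of 2], of "norm v * norm w"] show ?thesis
    using mult_mono[OF component_bound[of v] component_bound[of w]]
    by (auto simp: norm_mult abs_mult power2_eq_square mult_ac)
qed

lemma transpose_second_moment: "transpose \<Lambda> = \<Lambda>"
  by (simp add: transpose_def second_moment_def vec_eq_iff mult_ac)

lemma has_sum_F: "((\<lambda>y. complex_of_real (Q y) * (1 - exp (- (\<i> * complex_of_real (k \<bullet> rvec y))))) has_sum F k) UNIV"
proof -
  have "((\<lambda>y. complex_of_real (Q y) * exp (- (\<i> * complex_of_real (k \<bullet> rvec y)))) has_sum fourier Q k) UNIV" for k
    unfolding fourier_def using fourier_summable(1)[OF Q_sum(1)] by simp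
  from has_sum_diff'[OF this[of 0] this[of k]] show ?thesis
    by (simp add: algebra_simps)
qed

text \<open>The linear and quadratic Taylor terms sum to the drift and to the second moment, and the
  remainder is summed against the moment of order \<open>2 + z1\<close>. The linear term is purely
  imaginary and hence invisible to the infrared bound.\<close>

lemma F_expansion:
  "cmod (F k - (\<i> * complex_of_real (k \<bullet> \<eta>) + complex_of_real (k \<bullet> (\<Lambda> *v k) / 2))) \<le> norm k powr (2 + z1) * M"
proof -
  define c where "c = (\<lambda>y. 1 - exp (- (\<i> * complex_of_real (k \<bullet> rvec y))) - \<i> * complex_of_real (k \<bullet> rvec y)
      - complex_of_real ((k \<bullet> rvec y)\<^sup>2 / 2))"
  have 1: "((\<lambda>y. \<i> * complex_of_real ((k \<bullet> rvec y) * Q y)) has_sum (\<i> * complex_of_real (k \<bullet> \<eta>))) UNIV"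
    by (intro has_sum_cmult_right has_sum_of_real has_sum_drift)
  have 2: "((\<lambda>y. complex_of_real (1/2 * ((k \<bullet> rvec y) * (k \<bullet> rvec y) * Q y))) has_sum (complex_of_real (1/2 * (k \<bullet> (\<Lambda> *v k))))) UNIV"
    by (intro has_sum_cmult_right has_sum_of_real has_sum_second_moment)
  have "((\<lambda>y. complex_of_real (Q y) * c y) has_sum (F k - \<i> * complex_of_real (k \<bullet> \<eta>) - complex_of_real (1/2 * (k \<bullet> (\<Lambda> *v k))))) UNIV"
    using has_sum_diff'[OF has_sum_diff'[OF has_sum_F[of k] 1] 2]
    by (simp add: c_def algebra_simps power2_eq_square)
  note h = this
  have b: "cmod (c y) \<le> norm k powr (2 + z1) * norm (rvec y) powr (2 + z1)" for y
  proof -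
    have "cmod (c y) \<le> \<bar>k \<bullet> rvec y\<bar> powr (2 + z1)"
      unfolding c_def using z1 by (intro iexp_taylor2) auto
    also have "\<dots> \<le> (norm k * norm (rvec y)) powr (2 + z1)"
      using z1 by (intro powr_mono2 component_bound) auto
    finally show ?thesis by (simp add: powr_mult)
  qed
  have "cmod (F k - \<i> * complex_of_real (k \<bullet> \<eta>) - complex_of_real (1/2 * (k \<bullet> (\<Lambda> *v k)))) \<le> norm k powr (2 + z1) * M"
    by (rule has_sum_weight_bound[OF h Q_moment b]) (use z1 in auto)
  then show ?thesis by (simp add: algebra_simps)
qed

lemma g_expansion: "cmod (fourier g k - fourier g 0) \<le> 2 * norm k powr z1 * M"
proof -
  have h: "((\<lambda>y. complex_of_real (g y) * exp (- (\<i> * complex_of_real (k \<bullet> rvec y)))) has_sum fourier g k) UNIV" for k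
    unfolding fourier_def using fourier_summable(1)[OF g_sum(1)] by simp
  from has_sum_diff'[OF h[of k] h[of 0]]
  have "((\<lambda>y. complex_of_real (g y) * (exp (- (\<i> * complex_of_real (k \<bullet> rvec y))) - 1)) has_sum (fourier g k - fourier g 0)) UNIV"
    by (simp add: algebra_simps)
  note h' = this
  have b: "cmod (exp (- (\<i> * complex_of_real (k \<bullet> rvec y))) - 1) \<le> 2 * norm k powr z1 * norm (rvec y) powr z1" for y
  proof -
    have "cmod (exp (- (\<i> * complex_of_real (k \<bullet> rvec y))) - 1) \<le> 2 * \<bar>k \<bullet> rvec y\<bar> powr z1"
      using z1 by (intro iexp_taylor0) auto
    also have "\<dots> \<le> 2 * (norm k * norm (rvec y)) powr z1"
      using z1 by (intro mult_left_mono powr_mono2 component_bound) auto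
    finally show ?thesis by (simp add: powr_mult)
  qed
  show ?thesis
    by (rule has_sum_weight_bound[OF h' g_moment b]) (use z1 in auto)
qed

lemma fourier_g_bound: "cmod (fourier g k) \<le> M"
  using fourier_summable(2)[OF g_sum(1), of k] g_sum(2) by linarith

text \<open>The infrared bound is applied at \<open>s *\<^sub>R k\<close> with \<open>s\<close>
  small. Since the linear term is imaginary, the real part of \<open>F\<close> there is
  \<open>s^2 / 2\<close> times the quadratic form up to a higher order, so ellipticity of
  \<open>\<Lambda>\<close> is the limit of condition (b) at the origin.\<close>

lemma second_moment_ge: "k \<bullet> (\<Lambda> *v k) \<ge> 2 * K * (norm k)\<^sup>2"
proof -
  have "2 * K * (norm k)\<^sup>2 \<le> k \<bullet> (\<Lambda> *v k) + e" if e: "e > 0" for e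
  proof -
    define b where "b = 2 * norm k powr (2 + z1) * M + 1"
    have b: "b > 0" using M by (auto simp: b_def add_nonneg_pos)
    \<comment> \<open>The first bound makes the remainder, of relative size
      \<open>s powr z1 * b\<close>, at most \<open>e\<close>; the second keeps
      \<open>s *\<^sub>R k\<close> inside the torus. The summand 1 in \<open>b\<close> protects the
      division when \<open>k = 0\<close>.\<close>
    define s where "s = min ((e / b) powr (1 / z1)) (1 / (norm k + 1))"
    have n: "norm k + 1 > 0" by (simp add: add_nonneg_pos)
    have s: "s > 0" "s \<le> 1 / (norm k + 1)" using e b n by (auto simp: s_def)
    have "s * (norm k + 1) \<le> 1" using s n by (simp add: field_simps)
    then have sk: "s * norm k \<le> 1" using s by (simp add: algebra_simps)
    have sz: "s powr z1 \<le> e / b"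
    proof -
      have "s powr z1 \<le> ((e / b) powr (1 / z1)) powr z1"
        using s z1 by (intro powr_mono2) (auto simp: s_def)
      then show ?thesis using e b z1 by (simp add: powr_powr)
    qed
    have t: "s *\<^sub>R k \<in> torus"
    proof (unfold torus_iff, intro allI)
      fix j
      have "\<bar>(s *\<^sub>R k) $ j\<bar> \<le> norm (s *\<^sub>R k)" by (rule component_le_norm_cart)
      also have "\<dots> \<le> 1" using s sk by simp
      also have "1 \<le> pi" using pi_gt3 by simp
      finally show "\<bar>(s *\<^sub>R k) $ j\<bar> \<le> pi" .
    qed
    define G where "G = \<i> * complex_of_real ((s *\<^sub>R k) \<bullet> \<eta>) + complex_of_real ((s *\<^sub>R k) \<bullet> (\<Lambda> *v (s *\<^sub>R k)) / 2)"
    have "K * (norm (s *\<^sub>R k))\<^sup>2 \<le> Re (F (s *\<^sub>R k))" by (rule Re_F_ge[OF t])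
    also have "\<dots> = Re G + Re (F (s *\<^sub>R k) - G)" by simp
    also have "Re (F (s *\<^sub>R k) - G) \<le> norm (s *\<^sub>R k) powr (2 + z1) * M"
      unfolding G_def by (rule order_trans[OF complex_Re_le_cmod F_expansion])
    also have "Re G = s\<^sup>2 * (k \<bullet> (\<Lambda> *v k)) / 2"
      by (simp add: G_def matrix_vector_mult_scaleR power2_eq_square)
    also have "norm (s *\<^sub>R k) powr (2 + z1) = s\<^sup>2 * s powr z1 * norm k powr (2 + z1)"
      using s by (simp add: powr_mult powr_add)
    finally have "s\<^sup>2 * (2 * K * (norm k)\<^sup>2) \<le> s\<^sup>2 * (k \<bullet> (\<Lambda> *v k) + s powr z1 * (2 * norm k powr (2 + z1) * M))"
      using s by (simp add: power_mult_distrib algebra_simps)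
    then have "2 * K * (norm k)\<^sup>2 \<le> k \<bullet> (\<Lambda> *v k) + s powr z1 * (2 * norm k powr (2 + z1) * M)"
      using s by simp
    also have "s powr z1 * (2 * norm k powr (2 + z1) * M) \<le> e / b * b"
      using sz e b M by (intro mult_mono) (auto simp: b_def)
    finally show ?thesis using b by simp
  qed
  then show ?thesis by (rule field_le_epsilon)
qed

lemma second_moment_pos: "k \<noteq> 0 \<Longrightarrow> k \<bullet> (\<Lambda> *v k) > 0"
  using second_moment_ge[of k] K by (smt (verit) mult_pos_pos norm_eq_zero zero_less_power2)

end

section \<open>The local limit theorem and Gaussian bounds\<close>

text \<open>Trades a power of \<open>u\<close> for a power of \<open>t powr (- 1 / 2)\<close> at the
  price of half the Gaussian rate. It comes from \<open>y <= exp y\<close> at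
  \<open>y = c * t * u^2 / a\<close>, raised to the power \<open>a / 2\<close>.\<close>

lemma powr_mult_gaussian_le:
  fixes u t c a :: real
  assumes "u \<ge> 0" "t > 0" "c > 0" "a > 0"
  shows "u powr a * exp (- (c * t) * u\<^sup>2) \<le> (a / c) powr (a / 2) * t powr (- a / 2) * exp (- (c / 2 * t) * u\<^sup>2)"
proof -
  define s where "s = t * u\<^sup>2"
  have s: "s \<ge> 0" unfolding s_def using assms by (intro mult_nonneg_nonneg) auto
  have "c * s / a \<le> exp (c * s / a)" using exp_ge_add_one_self[of "c * s / a"] by linarith
  then have "s \<le> a / c * exp (c * s / a)" using assms by (simp add: field_simps)
  then have "s powr (a / 2) \<le> (a / c * exp (c * s / a)) powr (a / 2)"
    using s assms by (intro powr_mono2) auto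
  also have "\<dots> = (a / c) powr (a / 2) * exp (c * s / 2)"
    using assms by (subst powr_mult) (simp add: exp_powr_real)
  also have "s powr (a / 2) = t powr (a / 2) * u powr a"
  proof (cases "u = 0")
    case False
    then have "u > 0" using assms by simp
    then have "u\<^sup>2 = u powr 2" by simp
    then have "(u\<^sup>2) powr (a / 2) = u powr a" by (simp only: powr_powr) simp
    then show ?thesis using assms by (simp add: s_def powr_mult)
  qed (use assms in \<open>simp add: s_def\<close>)
  finally have "t powr (- a / 2) * (t powr (a / 2) * u powr a) * exp (- (c * s)) \<le> t powr (- a / 2) * ((a / c) powr (a / 2) * exp (c * s / 2)) * exp (- (c * s))"
    by (intro mult_right_mono mult_left_mono) auto
  also have "t powr (- a / 2) * (t powr (a / 2) * u powr a) = u powr a"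
    using assms by (simp add: powr_add[symmetric] mult.assoc[symmetric])
  also have "t powr (- a / 2) * ((a / c) powr (a / 2) * exp (c * s / 2)) * exp (- (c * s)) = (a / c) powr (a / 2) * t powr (- a / 2) * exp (- (c * s) / 2)"
    by (simp add: exp_add[symmetric] field_simps)
  finally show ?thesis by (simp add: s_def mult_ac)
qed

text \<open>Outside the torus a factor \<open>norm k powr z1\<close> may be inserted, so the part of
  the Gaussian integral that has no counterpart on the torus obeys the same bound as the error
  inside.\<close>

lemma outside_torus_norm:
  fixes k :: "real ^ 'd::finite"
  assumes "k \<notin> torus"
  shows "norm k \<ge> 1"
proof -
  from assms obtain j where "\<bar>k $ j\<bar> > pi" by (auto simp: torus_iff not_le)
  with component_le_norm_cart[of k j] pi_gt3 show ?thesis by linarith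
qed

text \<open>The two summands stem from the expansions of ghat and of \<open>F\<close>; the last
  factor is the Gaussian integral at the rate \<open>K / 2\<close> left over by
  \<open>powr_mult_gaussian_le\<close>.\<close>

definition lclt_const :: "'d::finite itself \<Rightarrow> real \<Rightarrow> real \<Rightarrow> real \<Rightarrow> real" where
  "lclt_const _ M K z = (2 * M * (z / K) powr (z / 2) + M\<^sup>2 * ((2 + z) / K) powr ((2 + z) / 2)) * (2 * pi / K) powr (real CARD('d) / 2)"

context class_pair
begin

lemma norm_exp_F: "k \<in> torus \<Longrightarrow> t \<ge> 0 \<Longrightarrow> cmod (exp (- (complex_of_real t * F k))) \<le> exp (- (K * t) * (norm k)\<^sup>2)"
  using mult_left_mono[OF Re_F_ge, of k t] by (simp add: norm_exp_eq_Re mult_ac)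

lemma green_inner_eq:
  "green_inner Q g x t = (LINT k:torus|lborel. exp (\<i> * complex_of_real (k \<bullet> rvec x)) * (fourier g k * exp (- (complex_of_real t * F k))))
     / complex_of_real ((2 * pi) ^ CARD('d))"
  unfolding green_inner_def by (simp only: set_integral_divide_zero mult.assoc)

lemma fourier_measurable [measurable]: "fourier Q \<in> borel_measurable borel" "fourier g \<in> borel_measurable borel"
  by (intro borel_measurable_continuous_onI continuous_on_fourier Q_sum g_sum)+

lemma two_pi_power_ge_1: "(2 * pi) ^ n \<ge> (1::real)"
  using pi_gt3 by (intro one_le_power) auto

lemma norm_divide_two_pi: "cmod (z / complex_of_real ((2 * pi) ^ n)) \<le> cmod z"
proof -
  have "cmod z * 1 \<le> cmod z * (2 * pi) ^ n" by (intro mult_left_mono two_pi_power_ge_1) auto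
  then show ?thesis using two_pi_power_ge_1[of n] by (simp add: norm_divide norm_power norm_mult divide_le_eq)
qed

lemma integrand_integrable:
  assumes "t \<ge> 0"
  shows "set_integrable lborel torus (\<lambda>k. exp (\<i> * complex_of_real (k \<bullet> rvec x)) * (fourier g k * exp (- (complex_of_real t * F k))))"
proof (rule torus_set_integrable)
  fix k :: "real^'d" assume k: "k \<in> torus"
  have "cmod (exp (- (complex_of_real t * F k))) \<le> exp (- (K * t) * (norm k)\<^sup>2)" by (rule norm_exp_F[OF k assms])
  also have "\<dots> \<le> 1" using K assms by simp
  finally have "cmod (exp (- (complex_of_real t * F k))) \<le> 1" .
  then have "cmod (fourier g k) * cmod (exp (- (complex_of_real t * F k))) \<le> M * 1"
    using M by (intro mult_mono fourier_g_bound) auto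
  then show "cmod (exp (\<i> * complex_of_real (k \<bullet> rvec x)) * (fourier g k * exp (- (complex_of_real t * F k)))) \<le> M"
    by (simp add: norm_mult)
qed measurable

lemma green_inner_sup:
  assumes "t > 0"
  shows "cmod (green_inner Q g x t) \<le> M * gauss_const TYPE('d) K * max 1 t powr (- real CARD('d) / 2)"
proof -
  let ?I = "\<lambda>k. exp (\<i> * complex_of_real (k \<bullet> rvec x)) * (fourier g k * exp (- (complex_of_real t * F k)))"
  have i: "set_integrable lborel torus ?I" using assms by (intro integrand_integrable) auto
  have "cmod (green_inner Q g x t) \<le> cmod (LINT k:torus|lborel. ?I k)"
    unfolding green_inner_eq by (rule norm_divide_two_pi)
  also have "\<dots> \<le> (LINT k:torus|lborel. cmod (?I k))" by (rule set_integral_norm_bound[OF i])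
  also have "\<dots> \<le> (LINT k:torus|lborel. M * exp (- (K * t) * (norm (k::real^'d))\<^sup>2))"
  proof (intro set_integral_mono set_integrable_norm i torus_set_integrable[of _ M])
    fix k :: "real^'d" assume k: "k \<in> torus"
    have "cmod (fourier g k) * cmod (exp (- (complex_of_real t * F k))) \<le> M * exp (- (K * t) * (norm k)\<^sup>2)"
      using M assms k by (intro mult_mono fourier_g_bound norm_exp_F) auto
    then show "cmod (?I k) \<le> M * exp (- (K * t) * (norm k)\<^sup>2)" by (simp add: norm_mult)
    show "norm (M * exp (- (K * t) * (norm k)\<^sup>2)) \<le> M"
      using M K assms by (simp add: abs_mult mult_le_cancel_left1)
  qed measurable
  also have "\<dots> = M * (LINT k:torus|lborel. exp (- (K * t) * (norm (k::real^'d))\<^sup>2))" by simp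
  also have "\<dots> \<le> M * (gauss_const TYPE('d) K * max 1 t powr (- real CARD('d) / 2))"
    using M K assms by (intro mult_left_mono torus_gaussian_bound) auto
  finally show ?thesis by (simp add: mult.assoc)
qed

text \<open>Fourier inversion for the Gaussian, with the drift moved into the phase. It gives
  \<open>rho\<close> the form of \<open>green_inner\<close>, only integrated over the whole
  space.\<close>

lemma rho_fourier:
  fixes z :: "real ^ 'd"
  assumes "t > 0"
  shows "integrable lborel (\<lambda>k. exp (\<i> * complex_of_real (k \<bullet> (z - t *\<^sub>R \<eta>))) * complex_of_real (exp (- t * (k \<bullet> (\<Lambda> *v k)) / 2)))"
    and "complex_of_real (rho t z \<eta> \<Lambda>) = (LINT k|lborel. exp (\<i> * complex_of_real (k \<bullet> (z - t *\<^sub>R \<eta>))) * complex_of_real (exp (- t * (k \<bullet> (\<Lambda> *v k)) / 2)))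
      / complex_of_real ((2 * pi) ^ CARD('d))"
proof -
  note G = gaussian_fourier[OF transpose_second_moment second_moment_pos assms]
  show "integrable lborel (\<lambda>k. exp (\<i> * complex_of_real (k \<bullet> (z - t *\<^sub>R \<eta>))) * complex_of_real (exp (- t * (k \<bullet> (\<Lambda> *v k)) / 2)))"
    by (rule G(1))
  have V: "(LINT k|lborel. exp (\<i> * complex_of_real (k \<bullet> (z - t *\<^sub>R \<eta>))) * complex_of_real (exp (- t * (k \<bullet> (\<Lambda> *v k)) / 2)))
      = complex_of_real ((2 * pi / t) powr (real CARD('d) / 2) / sqrt (det \<Lambda>) * exp (- ((z - t *\<^sub>R \<eta>) \<bullet> (matrix_inv \<Lambda> *v (z - t *\<^sub>R \<eta>))) / (2 * t)))"
    by (rule G(2))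
  have "(2 * pi / t) powr (real CARD('d) / 2) / (2 * pi) ^ CARD('d) = 1 / (2 * pi * t) powr (real CARD('d) / 2)"
  proof -
    have "(2 * pi) ^ CARD('d) = (2 * pi) powr (real CARD('d) / 2) * (2 * pi) powr (real CARD('d) / 2)"
      by (simp add: powr_add[symmetric] powr_realpow)
    then show ?thesis using assms by (simp add: powr_divide powr_mult)
  qed
  note e = this
  have "rho t z \<eta> \<Lambda> = (2 * pi / t) powr (real CARD('d) / 2) / sqrt (det \<Lambda>) * exp (- ((z - t *\<^sub>R \<eta>) \<bullet> (matrix_inv \<Lambda> *v (z - t *\<^sub>R \<eta>))) / (2 * t)) / (2 * pi) ^ CARD('d)"
    unfolding rho_def e[symmetric] by (simp add: field_simps)
  then show "complex_of_real (rho t z \<eta> \<Lambda>) = (LINT k|lborel. exp (\<i> * complex_of_real (k \<bullet> (z - t *\<^sub>R \<eta>))) * complex_of_real (exp (- t * (k \<bullet> (\<Lambda> *v k)) / 2)))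
      / complex_of_real ((2 * pi) ^ CARD('d))"
    by (simp only: V of_real_divide)
qed

text \<open>Both terms become integrals over the whole space, with the lattice integrand cut off to
  the torus. The expansions bound their difference by \<open>|k|^z1 + t |k|^(2+z1)\<close> times a
  Gaussian. Each summand is worth \<open>t^(-z1/2)\<close>, and the Gaussian integral adds
  \<open>t^(-d/2)\<close>. Neither depends on \<open>x\<close>, which enters only through a
  phase.\<close>

lemma local_clt:
  assumes t: "t > 0"
  shows "cmod (green_inner Q g x t - fourier g 0 * complex_of_real (rho t (rvec x) \<eta> \<Lambda>)) \<le> lclt_const TYPE('d) M K z1 * t powr (- real CARD('d) / 2 - z1 / 2)"
proof -
  define G where "G = (\<lambda>k. \<i> * complex_of_real (k \<bullet> \<eta>) + complex_of_real (k \<bullet> (\<Lambda> *v k) / 2))"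
  define e where "e = (\<lambda>k. exp (\<i> * complex_of_real (k \<bullet> rvec x)))"
  define I where "I = (\<lambda>k. indicator torus k *\<^sub>R (e k * (fourier g k * exp (- (complex_of_real t * F k)))))"
  define J where "J = (\<lambda>k. fourier g 0 * (e k * exp (- (complex_of_real t * G k))))"
  have eG: "e k * exp (- (complex_of_real t * G k)) = exp (\<i> * complex_of_real (k \<bullet> (rvec x - t *\<^sub>R \<eta>))) * complex_of_real (exp (- t * (k \<bullet> (\<Lambda> *v k)) / 2))" for k
    by (simp add: e_def G_def exp_of_real[symmetric] exp_add[symmetric] inner_diff_right algebra_simps)
  have iI: "integrable lborel I"
    using integrand_integrable[of t x] t unfolding I_def e_def set_integrable_def by simp
  have iJ: "integrable lborel J"
    unfolding J_def eG by (intro integrable_mult_right rho_fourier(1) t)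
  have eq: "green_inner Q g x t - fourier g 0 * complex_of_real (rho t (rvec x) \<eta> \<Lambda>) = (LINT k|lborel. I k - J k) / complex_of_real ((2 * pi) ^ CARD('d))"
  proof -
    have "(LINT k|lborel. J k) = fourier g 0 * (LINT k|lborel. exp (\<i> * complex_of_real (k \<bullet> (rvec x - t *\<^sub>R \<eta>))) * complex_of_real (exp (- t * (k \<bullet> (\<Lambda> *v k)) / 2)))"
      unfolding J_def eG by simp
    then have "fourier g 0 * complex_of_real (rho t (rvec x) \<eta> \<Lambda>) = (LINT k|lborel. J k) / complex_of_real ((2 * pi) ^ CARD('d))"
      unfolding rho_fourier(2)[OF t] by simp
    then show ?thesis
      unfolding green_inner_eq using iI iJ
      by (simp add: diff_divide_distrib set_lebesgue_integral_def I_def e_def)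
  qed
  define A1 where "A1 = (z1 / K) powr (z1 / 2)"
  define A2 where "A2 = ((2 + z1) / K) powr ((2 + z1) / 2)"
  define B where "B = (2 * M * A1 + M\<^sup>2 * A2) * t powr (- z1 / 2)"
  have bound: "cmod (I k - J k) \<le> B * exp (- (K / 2 * t) * (norm k)\<^sup>2)" for k
  proof -
    let ?E = "exp (- (K * t) * (norm k)\<^sup>2)"
    let ?n = "norm k"
    have ReG: "Re (- (complex_of_real t * G k)) \<le> - (K * t) * (norm k)\<^sup>2"
      using mult_left_mono[OF second_moment_ge[of k], of "t / 2"] t by (simp add: G_def mult_ac)
    have ne: "cmod (e k) = 1" by (simp add: e_def)
    have eGb: "cmod (exp (- (complex_of_real t * G k))) \<le> ?E"
      using ReG by (simp add: norm_exp_eq_Re)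
    have "cmod (I k - J k) \<le> 2 * M * (?n powr z1 * ?E) + M\<^sup>2 * t * (?n powr (2 + z1) * ?E)"
    proof (cases "k \<in> torus")
      case True
      have "I k - J k = e k * ((fourier g k - fourier g 0) * exp (- (complex_of_real t * F k))
          + fourier g 0 * (exp (- (complex_of_real t * F k)) - exp (- (complex_of_real t * G k))))"
        using True by (simp add: I_def J_def algebra_simps)
      then have "cmod (I k - J k) = cmod ((fourier g k - fourier g 0) * exp (- (complex_of_real t * F k))
          + fourier g 0 * (exp (- (complex_of_real t * F k)) - exp (- (complex_of_real t * G k))))"
        by (simp add: norm_mult ne)
      also have "\<dots> \<le> cmod (fourier g k - fourier g 0) * cmod (exp (- (complex_of_real t * F k)))
          + cmod (fourier g 0) * cmod (exp (- (complex_of_real t * F k)) - exp (- (complex_of_real t * G k)))"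
        by (rule order_trans[OF norm_triangle_ineq]) (simp only: norm_mult order_refl)
      also have "\<dots> \<le> (2 * ?n powr z1 * M) * ?E + M * (?E * (t * (?n powr (2 + z1) * M)))"
      proof (intro add_mono mult_mono g_expansion norm_exp_F True fourier_g_bound)
        have "cmod (exp (- (complex_of_real t * F k)) - exp (- (complex_of_real t * G k)))
            \<le> ?E * cmod (- (complex_of_real t * F k) - - (complex_of_real t * G k))"
        proof (rule cmod_exp_diff_le[OF _ ReG])
          show "Re (- (complex_of_real t * F k)) \<le> - (K * t) * (norm k)\<^sup>2"
            using mult_left_mono[OF Re_F_ge[OF True], of t] t by (simp add: mult_ac)
        qed
        also have "- (complex_of_real t * F k) - - (complex_of_real t * G k) = - (complex_of_real t * (F k - G k))"
          by (simp add: algebra_simps)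
        also have "cmod (- (complex_of_real t * (F k - G k))) = t * cmod (F k - G k)"
          using t by (simp only: norm_minus_cancel norm_mult norm_of_real)
        also have "?E * (t * cmod (F k - G k)) \<le> ?E * (t * (?n powr (2 + z1) * M))"
          using t F_expansion[of k] by (intro mult_left_mono) (auto simp: G_def)
        finally show "cmod (exp (- (complex_of_real t * F k)) - exp (- (complex_of_real t * G k))) \<le> ?E * (t * (?n powr (2 + z1) * M))" .
      qed (use M t in auto)
      finally show ?thesis by (simp add: power2_eq_square mult_ac)
    next
      case False
      then have "cmod (I k - J k) = cmod (fourier g 0) * cmod (exp (- (complex_of_real t * G k)))"
        by (simp add: I_def J_def norm_mult ne)
      also have "\<dots> \<le> M * ?E" using M by (intro mult_mono fourier_g_bound eGb) auto
      also have "\<dots> \<le> 2 * M * (?n powr z1 * ?E)"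
      proof -
        have "1 \<le> ?n powr z1" using outside_torus_norm[OF False] z1 by (intro ge_one_powr_ge_zero) auto
        then have "1 * ?E \<le> ?n powr z1 * ?E" by (intro mult_right_mono) auto
        then have "M * ?E \<le> M * (?n powr z1 * ?E)" using M by (intro mult_left_mono) auto
        also have "\<dots> \<le> 2 * M * (?n powr z1 * ?E)" using M by simp
        finally show ?thesis .
      qed
      also have "\<dots> \<le> 2 * M * (?n powr z1 * ?E) + M\<^sup>2 * t * (?n powr (2 + z1) * ?E)" using t by simp
      finally show ?thesis .
    qed
    also have "\<dots> \<le> 2 * M * (A1 * t powr (- z1 / 2) * exp (- (K / 2 * t) * ?n\<^sup>2))
        + M\<^sup>2 * t * (A2 * t powr (- (2 + z1) / 2) * exp (- (K / 2 * t) * ?n\<^sup>2))"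
      unfolding A1_def A2_def using M t K z1 by (intro add_mono mult_left_mono powr_mult_gaussian_le) auto
    also have "\<dots> = (2 * M * (A1 * t powr (- z1 / 2)) + M\<^sup>2 * (A2 * (t * t powr (- (2 + z1) / 2)))) * exp (- (K / 2 * t) * ?n\<^sup>2)"
      by (simp only: distrib_right) (simp only: mult_ac)
    also have "t * t powr (- (2 + z1) / 2) = t powr (- z1 / 2)"
    proof -
      have "t * t powr (- (2 + z1) / 2) = t powr 1 * t powr (- (2 + z1) / 2)" using t by simp
      also have "\<dots> = t powr (- z1 / 2)" by (simp only: powr_add[symmetric]) (simp add: field_simps)
      finally show ?thesis .
    qed
    finally show ?thesis by (simp add: B_def algebra_simps)
  qed
  have Kt: "K / 2 * t > 0" using K t by simp
  have "cmod (green_inner Q g x t - fourier g 0 * complex_of_real (rho t (rvec x) \<eta> \<Lambda>)) \<le> cmod (LINT k|lborel. I k - J k)"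
    unfolding eq by (rule norm_divide_two_pi)
  also have "\<dots> \<le> (LINT k|lborel. B * exp (- (K / 2 * t) * (norm (k::real^'d))\<^sup>2))"
    by (rule Bochner_Integration.integral_norm_bound_integral)
      (use iI iJ bound gaussian_integral[OF Kt, where 'd='d] in auto)
  also have "\<dots> = B * (pi / (K / 2 * t)) powr (real CARD('d) / 2)"
    using gaussian_integral(2)[OF Kt, where 'd='d] by simp
  also have "(pi / (K / 2 * t)) powr (real CARD('d) / 2) = (2 * pi / K) powr (real CARD('d) / 2) * t powr (- real CARD('d) / 2)"
  proof -
    have "pi / (K / 2 * t) = (2 * pi / K) * (1 / t)" by (simp add: field_simps)
    also have "\<dots> powr (real CARD('d) / 2) = (2 * pi / K) powr (real CARD('d) / 2) * t powr (- real CARD('d) / 2)"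
      using K t by (subst powr_mult) (auto simp: powr_divide powr_minus_divide)
    finally show ?thesis .
  qed
  also have "B * ((2 * pi / K) powr (real CARD('d) / 2) * t powr (- real CARD('d) / 2))
      = lclt_const TYPE('d) M K z1 * (t powr (- real CARD('d) / 2) * t powr (- z1 / 2))"
    by (simp add: B_def lclt_const_def A1_def A2_def mult_ac)
  also have "t powr (- real CARD('d) / 2) * t powr (- z1 / 2) = t powr (- real CARD('d) / 2 - z1 / 2)"
    by (simp add: powr_add[symmetric])
  finally show ?thesis .
qed

section \<open>Two-sided Gaussian bounds for the Brownian density\<close>

text \<open>With \<open>w = matrix_inv \<Lambda> *v z\<close> both estimates concern
  \<open>z \<bullet> w\<close>, which equals the form of \<open>\<Lambda>\<close> at
  \<open>w\<close>. The lower one uses ellipticity and \<open>norm z <= M * norm w\<close>; the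
  upper one uses Cauchy-Schwarz and \<open>norm w <= norm z / (2 * K)\<close>.\<close>

lemma inverse_second_moment_bounds:
  "z \<bullet> (matrix_inv \<Lambda> *v z) \<ge> 2 * K / M\<^sup>2 * (norm z)\<^sup>2"
  "z \<bullet> (matrix_inv \<Lambda> *v z) \<le> (norm z)\<^sup>2 / (2 * K)"
proof -
  define w where "w = matrix_inv \<Lambda> *v z"
  have "det \<Lambda> \<noteq> 0"
    using gaussian_fourier(3)[OF transpose_second_moment second_moment_pos zero_less_one] by simp
  then have "invertible \<Lambda>" by (simp add: invertible_det_nz)
  then have "\<Lambda> ** matrix_inv \<Lambda> = mat 1 \<and> matrix_inv \<Lambda> ** \<Lambda> = mat 1"
    unfolding invertible_def matrix_inv_def by (rule someI_ex)
  then have Lw: "\<Lambda> *v w = z" by (simp add: w_def matrix_vector_mul_assoc)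
  have zw: "z \<bullet> w \<ge> 2 * K * (norm w)\<^sup>2" using second_moment_ge[of w] Lw by (simp add: inner_commute)
  have "norm z * norm z \<le> norm z * (norm w * M)"
    using second_moment_bound[of z w] by (simp add: Lw power2_norm_eq_inner[symmetric] power2_eq_square mult_ac)
  then have "norm z \<le> norm w * M" using M by (cases "norm z = 0") auto
  then have "(norm z)\<^sup>2 \<le> (norm w * M)\<^sup>2" by (intro power_mono) auto
  then have "(norm z)\<^sup>2 / M\<^sup>2 \<le> (norm w)\<^sup>2" using M by (simp add: field_simps power_mult_distrib)
  then have "2 * K * ((norm z)\<^sup>2 / M\<^sup>2) \<le> 2 * K * (norm w)\<^sup>2" using K by (intro mult_left_mono) auto
  with zw show "z \<bullet> (matrix_inv \<Lambda> *v z) \<ge> 2 * K / M\<^sup>2 * (norm z)\<^sup>2" by (simp add: w_def)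
  have cs: "z \<bullet> w \<le> norm z * norm w" by (rule norm_cauchy_schwarz)
  with zw have "norm w * (2 * K * norm w) \<le> norm w * norm z" by (simp add: power2_eq_square mult_ac)
  then have "2 * K * norm w \<le> norm z" using K by (cases "norm w = 0") auto
  then have "norm w \<le> norm z / (2 * K)" using K by (simp add: field_simps)
  then have "norm z * norm w \<le> norm z * (norm z / (2 * K))" by (intro mult_left_mono) auto
  with cs show "z \<bullet> (matrix_inv \<Lambda> *v z) \<le> (norm z)\<^sup>2 / (2 * K)" by (simp add: w_def power2_eq_square)
qed

text \<open>The Gaussian integral of the form equals
  \<open>(2 pi)^(d/2) / sqrt (det \<Lambda>)\<close>, so comparing quadratic forms pointwise under
  the integral compares determinants.\<close>

lemma det_second_moment_bounds:
  "1 / sqrt (det \<Lambda>) \<le> (1 / (2 * K)) powr (real CARD('d) / 2)"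
  "1 / sqrt (det \<Lambda>) \<ge> (1 / M) powr (real CARD('d) / 2)"
proof -
  note G = gaussian_fourier(1,2)[OF transpose_second_moment second_moment_pos zero_less_one, of 0]
  have i: "integrable lborel (\<lambda>k. exp (- (k \<bullet> (\<Lambda> *v k)) / 2))"
    using integrable_Re[OF G(1)] by simp
  have "complex_of_real (LINT k|lborel. exp (- (k \<bullet> (\<Lambda> *v k)) / 2)) = complex_of_real ((2 * pi) powr (real CARD('d) / 2) / sqrt (det \<Lambda>))"
    using G(2) by simp
  then have e: "(LINT k|lborel. exp (- (k \<bullet> (\<Lambda> *v k)) / 2)) = (2 * pi) powr (real CARD('d) / 2) * (1 / sqrt (det \<Lambda>))"
    by (simp only: of_real_eq_iff times_divide_eq_right mult_1_right)
  have "(LINT k|lborel. exp (- (k \<bullet> (\<Lambda> *v k)) / 2)) \<le> (LINT k|lborel. exp (- K * (norm (k::real^'d))\<^sup>2))"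
    using second_moment_ge K by (intro integral_mono i gaussian_integral) (auto simp: field_simps)
  also have "\<dots> = (2 * pi * (1 / (2 * K))) powr (real CARD('d) / 2)"
    using K by (subst gaussian_integral(2)) auto
  also have "\<dots> = (2 * pi) powr (real CARD('d) / 2) * (1 / (2 * K)) powr (real CARD('d) / 2)"
    by (rule powr_mult)
  finally show "1 / sqrt (det \<Lambda>) \<le> (1 / (2 * K)) powr (real CARD('d) / 2)"
    unfolding e by (rule mult_left_le_imp_le) simp
  have "(2 * pi) powr (real CARD('d) / 2) * (1 / M) powr (real CARD('d) / 2) = (2 * pi * (1 / M)) powr (real CARD('d) / 2)"
    by (rule powr_mult[symmetric])
  also have "\<dots> = (LINT k|lborel. exp (- (M / 2) * (norm (k::real^'d))\<^sup>2))"
    using M by (subst gaussian_integral(2)) (auto simp: mult.commute)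
  also have "\<dots> \<le> (LINT k|lborel. exp (- (k \<bullet> (\<Lambda> *v k)) / 2))"
  proof (intro integral_mono i gaussian_integral)
    show "exp (- (M / 2) * (norm k)\<^sup>2) \<le> exp (- (k \<bullet> (\<Lambda> *v k)) / 2)" for k
      using second_moment_bound[of k k] by (simp add: power2_eq_square abs_le_iff mult_ac)
  qed (use M in auto)
  finally show "1 / sqrt (det \<Lambda>) \<ge> (1 / M) powr (real CARD('d) / 2)"
    unfolding e by (rule mult_left_le_imp_le) simp
qed

lemma rho_upper:
  assumes "t > 0"
  shows "rho t z \<eta> \<Lambda> \<le> (1 / (4 * pi * K)) powr (real CARD('d) / 2) * t powr (- real CARD('d) / 2) * exp (- (K / M\<^sup>2) * (norm (z - t *\<^sub>R \<eta>))\<^sup>2 / t)"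
proof -
  have e: "exp (- (1 / (2 * t)) * ((z - t *\<^sub>R \<eta>) \<bullet> (matrix_inv \<Lambda> *v (z - t *\<^sub>R \<eta>)))) \<le> exp (- (K / M\<^sup>2) * (norm (z - t *\<^sub>R \<eta>))\<^sup>2 / t)"
    using mult_left_mono[OF inverse_second_moment_bounds(1)[of "z - t *\<^sub>R \<eta>"], of "1 / (2 * t)"] assms
    by (simp add: field_simps)
  have p: "(1 / (4 * pi * K)) powr (real CARD('d) / 2) * t powr (- real CARD('d) / 2)
      = (1 / (2 * K)) powr (real CARD('d) / 2) * (1 / (2 * pi * t) powr (real CARD('d) / 2))"
    using K assms by (simp add: powr_divide powr_mult powr_minus field_simps) (simp add: powr_mult[symmetric])
  show ?thesis unfolding p rho_def
    using K by (intro mult_mono det_second_moment_bounds e mult_right_mono) auto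
qed

lemma rho_lower:
  assumes "t > 0"
  shows "rho t z \<eta> \<Lambda> \<ge> (1 / (2 * pi * M)) powr (real CARD('d) / 2) * t powr (- real CARD('d) / 2) * exp (- (norm (z - t *\<^sub>R \<eta>))\<^sup>2 / (4 * K * t))"
proof -
  have e: "exp (- (1 / (2 * t)) * ((z - t *\<^sub>R \<eta>) \<bullet> (matrix_inv \<Lambda> *v (z - t *\<^sub>R \<eta>)))) \<ge> exp (- (norm (z - t *\<^sub>R \<eta>))\<^sup>2 / (4 * K * t))"
    using mult_left_mono[OF inverse_second_moment_bounds(2)[of "z - t *\<^sub>R \<eta>"], of "1 / (2 * t)"] assms
    by (simp add: field_simps)
  have p: "(1 / (2 * pi * M)) powr (real CARD('d) / 2) * t powr (- real CARD('d) / 2)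
      = (1 / M) powr (real CARD('d) / 2) * (1 / (2 * pi * t) powr (real CARD('d) / 2))"
    using M assms by (simp add: powr_divide powr_mult powr_minus field_simps)
  have "0 \<le> 1 / sqrt (det \<Lambda>)" using det_second_moment_bounds(2) by (rule order_trans[rotated]) simp
  then show ?thesis unfolding p rho_def
    by (intro mult_mono det_second_moment_bounds e mult_right_mono mult_nonneg_nonneg) auto
qed

lemma rho_pos: "t > 0 \<Longrightarrow> rho t z \<eta> \<Lambda> > 0"
  by (rule less_le_trans[OF _ rho_lower]) (use M in auto)

end

section \<open>Truncation away from the drift\<close>

lemma abs_exp_minus_linear_le:
  fixes s :: real
  assumes "\<bar>s\<bar> \<le> 1"
  shows "\<bar>exp s - 1 - s\<bar> \<le> s\<^sup>2"
proof -
  have lo: "exp s - 1 - s \<ge> 0" using exp_ge_add_one_self[of s] by linarith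
  have "exp s \<le> 1 + s + s\<^sup>2"
  proof (cases "s \<ge> 0")
    case True then show ?thesis using exp_bound[of s] assms by auto
  next
    case False
    define x where "x = - s"
    have x: "x > 0" using False by (simp add: x_def)
    have "exp s * (1 + x) \<le> exp s * exp x" by (intro mult_left_mono exp_ge_add_one_self) auto
    also have "\<dots> = 1" by (simp add: x_def exp_add[symmetric])
    \<comment> \<open>The product on the right equals \<open>1 + x^3\<close>.\<close>
    also have "1 \<le> (1 - x + x\<^sup>2) * (1 + x)" using x by (simp add: power2_eq_square algebra_simps)
    finally have "exp s \<le> 1 - x + x\<^sup>2" using x by simp
    then show ?thesis by (simp add: x_def)
  qed
  with lo show ?thesis by simp
qed

lemma abs_cos_minus_1_le: "\<bar>cos u - 1\<bar> \<le> \<bar>u\<bar>" for u :: real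
proof -
  have "\<bar>Re (iexp u - 1)\<bar> \<le> cmod (iexp u - 1)" by (rule abs_Re_le_cmod)
  also have "\<dots> \<le> \<bar>u\<bar>" using iexp_approx1[of u 0] by simp
  finally show ?thesis by (simp add: Re_exp)
qed

text \<open>A stretched exponential beats every power: \<open>y <= b * exp (y / b)\<close> with
  \<open>y = x powr \<delta>\<close> and \<open>b = N / \<delta>\<close>, raised to the power
  \<open>b\<close>.\<close>

lemma exp_neg_powr_le:
  fixes x \<delta> N :: real
  assumes "x > 0" "\<delta> > 0" "N > 0"
  shows "exp (- (x powr \<delta>)) \<le> (N / \<delta>) powr (N / \<delta>) * x powr (- N)"
proof -
  define y b where "y = x powr \<delta>" and "b = N / \<delta>"
  have b: "b > 0" and y: "y > 0" using assms by (auto simp: b_def y_def)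
  have "y / b \<le> exp (y / b)" using exp_ge_add_one_self[of "y / b"] by linarith
  then have "y \<le> b * exp (y / b)" using b by (simp add: field_simps)
  then have "y powr b \<le> (b * exp (y / b)) powr b" using y b by (intro powr_mono2) auto
  also have "\<dots> = b powr b * exp y" using b by (subst powr_mult) (simp add: exp_powr_real)
  finally have "y powr b * exp (- y) \<le> b powr b" by (simp add: exp_minus field_simps)
  then have "exp (- y) \<le> b powr b / y powr b" using y by (simp add: field_simps)
  also have "y powr b = x powr N" using assms by (simp add: y_def b_def powr_powr)
  finally show ?thesis using assms by (simp add: y_def b_def powr_minus divide_inverse)
qed

text \<open>The entire function \<open>(exp w - 1) / w\<close>. Splitting off \<open>w\<close>
  displays the change of an exponential as linear in the Fourier transform of the tail of
  \<open>Q\<close>, the form which the pairing bound needs.\<close>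

definition phi :: "complex \<Rightarrow> complex" where
  "phi w = (if w = 0 then 1 else (exp w - 1) / w)"

lemma phi_eq: "exp w = 1 + w * phi w"
  by (simp add: phi_def)

lemma norm_phi_le: "cmod (phi w) \<le> exp (cmod w)"
proof (cases "w = 0")
  case False
  have "cmod (exp w - exp 0) \<le> exp (cmod w) * cmod (w - 0)"
    by (rule cmod_exp_diff_le) (auto simp: complex_Re_le_cmod)
  then show ?thesis using False by (simp add: phi_def norm_divide field_simps)
qed (simp add: phi_def)

lemma phi_measurable [measurable]: "phi \<in> borel_measurable borel"
  unfolding phi_def by measurable

text \<open>The first term is the quadratic error of the tilt; the second comes from completing the
  square in the mixed term \<open>norm k / r * M\<close>.\<close>

definition tilt_const :: "real \<Rightarrow> real \<Rightarrow> real" where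
  "tilt_const M K = 2 * M + M\<^sup>2 / (2 * K)"

definition trunc_const :: "'d::finite itself \<Rightarrow> real \<Rightarrow> real \<Rightarrow> real" where
  "trunc_const _ M K = 2 * gauss_const TYPE('d) K * (1 + M * exp (2 * M)) + M * exp (1 + tilt_const M K) * gauss_const TYPE('d) (K / 2)"

text \<open>In the last factor \<open>2 * M\<close> accounts for the tails of \<open>g\<close> and
  \<open>Q\<close>, and the power of \<open>N / \<delta>\<close> is the constant of
  \<open>exp_neg_powr_le\<close>.\<close>

definition far_const :: "'d::finite itself \<Rightarrow> real \<Rightarrow> real \<Rightarrow> real \<Rightarrow> real \<Rightarrow> real" where
  "far_const _ M K N \<delta> = trunc_const TYPE('d) M K * (2 * M + (N / \<delta>) powr (N / \<delta>))"

context class_pair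
begin

text \<open>To first order the tilt lowers the real part of the symbol by
  \<open>\<theta> \<bullet> \<eta>\<close>; what is left is quadratic in \<open>1 / r\<close>, plus
  a mixed term of order \<open>norm k / r\<close>. The drift sums over all \<open>y\<close> whereas
  the tilt acts only on the ball, but outside it \<open>norm (rvec y) / r >= 1\<close>, so the
  mismatch is bounded by the quadratic term too. Only second moments of \<open>Q\<close> are
  spent.\<close>

lemma Re_tilted_ge:
  fixes \<theta> k :: "real ^ 'd"
  assumes r: "r > 0" and \<theta>: "norm \<theta> \<le> 1 / r"
  shows "Re (fourier Q 0 - trig {y. norm (rvec y) \<le> r} (\<lambda>y. Q y * exp (\<theta> \<bullet> rvec y)) k)
    \<ge> Re (F k) - \<theta> \<bullet> \<eta> - (2 / r\<^sup>2 + norm k / r) * M"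
proof -
  define B where "B = {y :: int ^ 'd. norm (rvec y) \<le> r}"
  have B: "finite B" unfolding B_def by (rule finite_norm_rvec_le)
  let ?e = "\<lambda>y. exp (- (\<i> * complex_of_real (k \<bullet> rvec y)))"
  define T where "T = trig B (\<lambda>y. Q y * exp (\<theta> \<bullet> rvec y)) k"
  define c where "c = (\<lambda>y. (if y \<in> B then complex_of_real (exp (\<theta> \<bullet> rvec y)) * ?e y else 0) - ?e y - complex_of_real (\<theta> \<bullet> rvec y))"
  have "((\<lambda>y. complex_of_real (Q y * exp (\<theta> \<bullet> rvec y)) * ?e y) has_sum T) B"
    unfolding T_def trig_def by (rule has_sum_finite[OF B])
  then have 1: "((\<lambda>y. complex_of_real (Q y) * (if y \<in> B then complex_of_real (exp (\<theta> \<bullet> rvec y)) * ?e y else 0)) has_sum T) UNIV"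
    by (subst has_sum_cong_neutral[of B UNIV]) (auto simp: mult.assoc)
  have 2: "((\<lambda>y. complex_of_real (Q y) * ?e y) has_sum fourier Q k) UNIV"
    unfolding fourier_def using fourier_summable(1)[OF Q_sum(1)] by simp
  have 3: "((\<lambda>y. complex_of_real (Q y) * complex_of_real (\<theta> \<bullet> rvec y)) has_sum complex_of_real (\<theta> \<bullet> \<eta>)) UNIV"
    using has_sum_of_real[OF has_sum_drift[of \<theta>], where 'a=complex] by (simp add: mult.commute)
  have "((\<lambda>y. complex_of_real (Q y) * c y) has_sum (T - fourier Q k - complex_of_real (\<theta> \<bullet> \<eta>))) UNIV"
    using has_sum_diff'[OF has_sum_diff'[OF 1 2] 3] by (simp add: c_def algebra_simps)
  from has_sum_of_real[OF has_sum_Re[OF this], where 'a=complex]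
  have s: "((\<lambda>y. complex_of_real (Q y) * complex_of_real (Re (c y))) has_sum complex_of_real (Re T - Re (fourier Q k) - \<theta> \<bullet> \<eta>)) UNIV"
    by simp
  have b: "cmod (complex_of_real (Re (c y))) \<le> (2 / r\<^sup>2 + norm k / r) * norm (rvec y) ^ 2" for y
  proof -
    define n where "n = norm (rvec y)"
    define u where "u = k \<bullet> rvec y"
    define s where "s = \<theta> \<bullet> rvec y"
    have u: "\<bar>u\<bar> \<le> norm k * n" unfolding u_def n_def by (rule component_bound)
    have "\<bar>s\<bar> \<le> norm \<theta> * n" unfolding s_def n_def by (rule component_bound)
    also have "\<dots> \<le> 1 / r * n" using \<theta> by (intro mult_right_mono) (auto simp: n_def)
    finally have s: "\<bar>s\<bar> \<le> n / r" by simp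
    have n: "n \<ge> 0" by (simp add: n_def)
    have Re: "Re (c y) = (if y \<in> B then exp s * cos u else 0) - cos u - s"
      by (simp add: c_def s_def u_def Re_exp)
    have nn: "n\<^sup>2 / r\<^sup>2 = (n / r)\<^sup>2" by (simp add: power_divide)
    have "\<bar>Re (c y)\<bar> \<le> 2 * (n / r)\<^sup>2 + norm k / r * n\<^sup>2"
    proof (cases "y \<in> B")
      case True
      then have "n / r \<le> 1" using r by (simp add: B_def n_def)
      with s have s1: "\<bar>s\<bar> \<le> 1" by simp
      have "Re (c y) = (exp s - 1 - s) * cos u + s * (cos u - 1)"
        using True by (simp add: Re algebra_simps)
      also have "\<bar>\<dots>\<bar> \<le> \<bar>exp s - 1 - s\<bar> * \<bar>cos u\<bar> + \<bar>s\<bar> * \<bar>cos u - 1\<bar>"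
        by (rule order_trans[OF abs_triangle_ineq]) (simp only: abs_mult order_refl)
      also have "\<dots> \<le> s\<^sup>2 * 1 + n / r * (norm k * n)"
        using abs_exp_minus_linear_le[OF s1] s u abs_cos_minus_1_le[of u]
        by (intro add_mono mult_mono) auto
      also have "s\<^sup>2 \<le> (n / r)\<^sup>2" using s by (simp add: abs_le_square_iff[symmetric] n r less_imp_le)
      finally have "\<bar>Re (c y)\<bar> \<le> (n / r)\<^sup>2 * 1 + n / r * (norm k * n)" by simp
      moreover have "n / r * (norm k * n) = norm k / r * n\<^sup>2" by (simp add: power2_eq_square)
      ultimately show ?thesis using zero_le_power2[of "n / r"] by linarith
    next
      case False
      then have n1: "n / r \<ge> 1" using r by (simp add: B_def n_def)
      have "\<bar>Re (c y)\<bar> \<le> \<bar>cos u\<bar> + \<bar>s\<bar>" using False by (simp add: Re)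
      also have "\<dots> \<le> 1 + n / r" using s by (intro add_mono) auto
      also have "\<dots> \<le> (n / r)\<^sup>2 + (n / r)\<^sup>2"
        using n1 by (intro add_mono) (auto simp: power2_eq_square intro: order_trans mult_left_mono[of 1 "n / r" "n / r", simplified])
      also have "\<dots> \<le> 2 * (n / r)\<^sup>2 + norm k / r * n\<^sup>2" using r by simp
      finally show ?thesis .
    qed
    then show ?thesis unfolding norm_of_real n_def[symmetric] nn[symmetric] by (simp add: algebra_simps)
  qed
  have "cmod (complex_of_real (Re T - Re (fourier Q k) - \<theta> \<bullet> \<eta>)) \<le> (2 / r\<^sup>2 + norm k / r) * M"
    by (rule has_sum_weight_bound[OF s Q_moment_nat b]) (use r in auto)
  then have "\<bar>Re T - Re (fourier Q k) - \<theta> \<bullet> \<eta>\<bar> \<le> (2 / r\<^sup>2 + norm k / r) * M"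
    by (simp only: norm_of_real)
  then show ?thesis unfolding B_def[symmetric] T_def[symmetric] by (simp add: abs_le_iff)
qed

text \<open>\<open>\<theta>\<close> has length \<open>1 / r\<close> and points along the
  displacement \<open>z = rvec x - t *\<^sub>R \<eta>\<close>. The factor
  \<open>exp (- (\<theta> \<bullet> rvec x))\<close> of the tilt and the first order growth
  \<open>exp (t * (\<theta> \<bullet> \<eta>))\<close> of the symbol combine to
  \<open>exp (- (\<theta> \<bullet> z)) = exp (- D / r)\<close>. Within the ball the tilt increases
  \<open>g\<close> by at most the factor \<open>exp 1\<close>.\<close>

lemma tilted_part_bound:
  fixes x :: "int ^ 'd"
  assumes t: "t > 0" and r: "r > 0" and D: "D = norm (rvec x - t *\<^sub>R \<eta>)" "D > 0"
  shows "cmod (LINT k:torus|lborel. exp (\<i> * complex_of_real (k \<bullet> rvec x)) *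
      (trig {y. norm (rvec y) \<le> r} g k * exp (- (complex_of_real t * (fourier Q 0 - trig {y. norm (rvec y) \<le> r} Q k)))))
    \<le> M * exp 1 * gauss_const TYPE('d) (K / 2) * exp (t * tilt_const M K / r\<^sup>2 - D / r) * max 1 t powr (- real CARD('d) / 2)"
proof -
  define B where "B = {y :: int ^ 'd. norm (rvec y) \<le> r}"
  have B: "finite B" unfolding B_def by (rule finite_norm_rvec_le)
  define z where "z = rvec x - t *\<^sub>R \<eta>"
  define \<theta> where "\<theta> = (1 / (D * r)) *\<^sub>R z"
  have n\<theta>: "norm \<theta> = 1 / r" using D r by (simp add: \<theta>_def z_def)
  have \<theta>z: "\<theta> \<bullet> z = D / r"
    using D r by (simp add: \<theta>_def power2_norm_eq_inner[symmetric] z_def power2_eq_square)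
  define Q' where "Q' = trig B (\<lambda>y. Q y * exp (\<theta> \<bullet> rvec y))"
  define g' where "g' = trig B (\<lambda>y. g y * exp (\<theta> \<bullet> rvec y))"
  have tg: "tilted \<theta> (trig B g) g'" unfolding g'_def by (rule tilted_trig[OF B])
  have "tilted \<theta> (\<lambda>k. - complex_of_real t * fourier Q 0 + complex_of_real t * trig B Q k)
     (\<lambda>k. - complex_of_real t * fourier Q 0 + complex_of_real t * Q' k)"
    unfolding Q'_def by (intro tilted_add tilted_const tilted_mult tilted_trig B)
  then have tS: "tilted \<theta> (\<lambda>k. - (complex_of_real t * (fourier Q 0 - trig B Q k))) (\<lambda>k. - (complex_of_real t * (fourier Q 0 - Q' k)))"
    by (simp add: algebra_simps)
  let ?I = "\<lambda>k. exp (\<i> * complex_of_real (k \<bullet> rvec x)) * (g' k * exp (- (complex_of_real t * (fourier Q 0 - Q' k))))"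
  define W where "W = exp (t * (\<theta> \<bullet> \<eta> + tilt_const M K / r\<^sup>2))"
  have iI: "set_integrable lborel torus ?I"
    unfolding g'_def Q'_def by (intro torus_continuous_integrable continuous_intros)
  have g'b: "cmod (g' k) \<le> exp 1 * M" for k
  proof -
    have "cmod (g' k) \<le> (\<Sum>y\<in>B. \<bar>g y * exp (\<theta> \<bullet> rvec y)\<bar>)" unfolding g'_def by (rule norm_trig_le)
    also have "\<dots> \<le> (\<Sum>y\<in>B. exp 1 * \<bar>g y\<bar>)"
    proof (intro sum_mono)
      fix y assume "y \<in> B"
      have "\<theta> \<bullet> rvec y \<le> norm \<theta> * norm (rvec y)" by (rule norm_cauchy_schwarz)
      also have "\<dots> \<le> 1 / r * r" unfolding n\<theta> using \<open>y \<in> B\<close> r by (intro mult_left_mono) (auto simp: B_def)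
      finally have "exp (\<theta> \<bullet> rvec y) \<le> exp 1" using r by simp
      then have "\<bar>g y\<bar> * exp (\<theta> \<bullet> rvec y) \<le> \<bar>g y\<bar> * exp 1" by (rule mult_left_mono) simp
      then show "\<bar>g y * exp (\<theta> \<bullet> rvec y)\<bar> \<le> exp 1 * \<bar>g y\<bar>" by (simp only: abs_mult abs_exp_cancel mult.commute)
    qed
    also have "\<dots> = exp 1 * (\<Sum>y\<in>B. \<bar>g y\<bar>)" by (simp add: sum_distrib_left)
    also have "\<dots> \<le> exp 1 * M"
      using finite_sum_le_infsum[OF g_sum(1) B] g_sum(2) by (intro mult_left_mono) auto
    finally show ?thesis .
  qed
  have Eb: "cmod (exp (- (complex_of_real t * (fourier Q 0 - Q' k)))) \<le> W * exp (- (K / 2 * t) * (norm k)\<^sup>2)"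
    if k: "k \<in> torus" for k
  proof -
    \<comment> \<open>Half of the infrared bound is spent on the mixed term of the tilt, which
      leaves the rate \<open>K / 2\<close>.\<close>
    have "norm k / r * M \<le> K / 2 * (norm k)\<^sup>2 + M\<^sup>2 / (2 * K) / r\<^sup>2"
    proof -
      have "0 \<le> (K * norm k - M / r)\<^sup>2 / (2 * K)" using K by simp
      also have "\<dots> = K / 2 * (norm k)\<^sup>2 + M\<^sup>2 / (2 * K) / r\<^sup>2 - norm k / r * M"
        using K r by (simp add: power2_eq_square field_simps)
      finally show ?thesis by simp
    qed
    moreover have "(2 / r\<^sup>2 + norm k / r) * M = 2 * M / r\<^sup>2 + norm k / r * M" by (simp add: algebra_simps)
    moreover have "tilt_const M K / r\<^sup>2 = 2 * M / r\<^sup>2 + M\<^sup>2 / (2 * K) / r\<^sup>2"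
      by (simp add: tilt_const_def add_divide_distrib)
    ultimately have "Re (fourier Q 0 - Q' k) \<ge> K / 2 * (norm k)\<^sup>2 - \<theta> \<bullet> \<eta> - tilt_const M K / r\<^sup>2"
      using Re_tilted_ge[OF r, of \<theta> k] n\<theta> Re_F_ge[OF k] unfolding Q'_def B_def by simp
    then have "t * (K / 2 * (norm k)\<^sup>2 - \<theta> \<bullet> \<eta> - tilt_const M K / r\<^sup>2) \<le> t * Re (fourier Q 0 - Q' k)"
      using t by (intro mult_left_mono) auto
    then show ?thesis by (simp add: W_def norm_exp_eq_Re exp_add[symmetric] algebra_simps)
  qed
  have "cmod (LINT k:torus|lborel. ?I k) \<le> (LINT k:torus|lborel. cmod (?I k))" by (rule set_integral_norm_bound[OF iI])
  also have "\<dots> \<le> (LINT k:torus|lborel. exp 1 * M * W * exp (- (K / 2 * t) * (norm (k::real^'d))\<^sup>2))"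
  proof (intro set_integral_mono set_integrable_norm iI torus_set_integrable[of _ "exp 1 * M * W"])
    fix k :: "real ^ 'd" assume k: "k \<in> torus"
    have "cmod (g' k) * cmod (exp (- (complex_of_real t * (fourier Q 0 - Q' k)))) \<le> (exp 1 * M) * (W * exp (- (K / 2 * t) * (norm k)\<^sup>2))"
      using M by (intro mult_mono g'b Eb k) auto
    then show "cmod (?I k) \<le> exp 1 * M * W * exp (- (K / 2 * t) * (norm k)\<^sup>2)" by (simp add: norm_mult mult.assoc)
    have W: "exp 1 * M * W \<ge> 0" using M by (simp add: W_def)
    have "exp 1 * M * W * exp (- (K / 2 * t) * (norm k)\<^sup>2) \<le> exp 1 * M * W * 1"
      using W K t by (intro mult_left_mono) auto
    then show "norm (exp 1 * M * W * exp (- (K / 2 * t) * (norm k)\<^sup>2)) \<le> exp 1 * M * W"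
      unfolding real_norm_def abs_mult[of "exp 1 * M * W"] abs_of_nonneg[OF W] by simp
  qed measurable
  also have "\<dots> = exp 1 * M * W * (LINT k:torus|lborel. exp (- (K / 2 * t) * (norm (k::real^'d))\<^sup>2))" by simp
  also have "\<dots> \<le> exp 1 * M * W * (gauss_const TYPE('d) (K / 2) * max 1 t powr (- real CARD('d) / 2))"
    using M K t by (intro mult_left_mono torus_gaussian_bound) (auto simp: W_def)
  finally have *: "cmod (LINT k:torus|lborel. ?I k) \<le> exp 1 * M * W * (gauss_const TYPE('d) (K / 2) * max 1 t powr (- real CARD('d) / 2))" .
  have E: "exp (- (\<theta> \<bullet> rvec x)) * W = exp (t * tilt_const M K / r\<^sup>2 - D / r)"
  proof -
    have "\<theta> \<bullet> rvec x = D / r + t * (\<theta> \<bullet> \<eta>)" using \<theta>z by (simp add: z_def inner_diff_right)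
    then show ?thesis by (simp add: W_def exp_add[symmetric] algebra_simps)
  qed
  have "cmod (LINT k:torus|lborel. exp (\<i> * complex_of_real (k \<bullet> rvec x)) *
      (trig B g k * exp (- (complex_of_real t * (fourier Q 0 - trig B Q k)))))
    = exp (- (\<theta> \<bullet> rvec x)) * cmod (LINT k:torus|lborel. ?I k)"
    unfolding tilted_exp_integral[OF tg tS] by (simp add: norm_mult norm_exp_eq_Re)
  also have "\<dots> \<le> exp (- (\<theta> \<bullet> rvec x)) * (exp 1 * M * W * (gauss_const TYPE('d) (K / 2) * max 1 t powr (- real CARD('d) / 2)))"
    by (intro mult_left_mono *) auto
  also have "\<dots> = M * exp 1 * gauss_const TYPE('d) (K / 2) * (exp (- (\<theta> \<bullet> rvec x)) * W) * max 1 t powr (- real CARD('d) / 2)"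
    by (simp only: mult_ac)
  finally show ?thesis unfolding E B_def .
qed

text \<open>The passage to the truncated pair produces two correction terms, each the pairing of a
  tail's Fourier transform with a function under a Gaussian; the main term is tilted. The tail of
  \<open>Q\<close> has mass at most \<open>M / r^(2+\<zeta>)\<close>, so \<open>t <= r^2\<close>
  keeps \<open>t\<close> times its transform bounded by \<open>M\<close>. Hence the truncated
  exponential obeys the original Gaussian bound up to \<open>exp M\<close>.\<close>

lemma truncation_bound:
  fixes x :: "int ^ 'd"
  assumes t: "t > 0" "t \<le> r\<^sup>2" and r: "r \<ge> 1" and D: "D = norm (rvec x - t *\<^sub>R \<eta>)" "D > 0"
  assumes pg: "1 \<le> pg" "pg \<le> 2" and Ng: "Ng > 0"
    and g2: "(\<lambda>y. \<bar>if norm (rvec y) \<le> r then 0 else g y\<bar> powr pg) summable_on UNIV"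
      "(\<Sum>\<^sub>\<infinity>y. \<bar>if norm (rvec y) \<le> r then 0 else g y\<bar> powr pg) \<le> Ng powr pg"
  assumes pQ: "1 \<le> pQ" "pQ \<le> 2" and NQ: "NQ > 0"
    and Q2: "(\<lambda>y. \<bar>if norm (rvec y) \<le> r then 0 else Q y\<bar> powr pQ) summable_on UNIV"
      "(\<Sum>\<^sub>\<infinity>y. \<bar>if norm (rvec y) \<le> r then 0 else Q y\<bar> powr pQ) \<le> NQ powr pQ"
  shows "cmod (green_inner Q g x t) \<le> trunc_const TYPE('d) M K *
    (Ng * max 1 t powr (- real CARD('d) / (2 * pg)) + t * NQ * max 1 t powr (- real CARD('d) / (2 * pQ))
      + exp (- (D / r)) * max 1 t powr (- real CARD('d) / 2))"
proof -
  define B where "B = {y :: int ^ 'd. norm (rvec y) \<le> r}"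
  have B: "finite B" unfolding B_def by (rule finite_norm_rvec_le)
  define gt where "gt = (\<lambda>y. if norm (rvec y) \<le> r then 0 else g y)"
  define Qt where "Qt = (\<lambda>y. if norm (rvec y) \<le> r then 0 else Q y)"
  have gts: "(\<lambda>y. \<bar>gt y\<bar>) summable_on UNIV"
    by (rule Infinite_Sum.summable_on_comparison_test[OF g_sum(1)]) (auto simp: gt_def)
  have w: "lp_norm 1 (\<lambda>y. norm (rvec y) powr (2 + \<zeta>) * Q y) \<le> ennreal M" by (rule class_QD)
  have wr: "norm (rvec y) powr (2 + \<zeta>) \<ge> r powr (2 + \<zeta>)" if "norm (rvec y) > r" for y :: "int ^ 'd"
    using that r \<zeta> by (intro powr_mono2) auto
  have "r powr (2 + \<zeta>) > 0" using r by simp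
  note tw = tail_weight[OF w zero_less_one M this wr]
  have Qts: "(\<lambda>y. \<bar>Qt y\<bar>) summable_on UNIV" and Qtb: "(\<Sum>\<^sub>\<infinity>y. \<bar>Qt y\<bar>) \<le> M / r powr (2 + \<zeta>)"
    using tw M r by (auto simp: Qt_def)
  have fQt: "t * cmod (fourier Qt k) \<le> M" for k
  proof -
    have "t * cmod (fourier Qt k) \<le> r\<^sup>2 * (M / r powr (2 + \<zeta>))"
      using t fourier_summable(2)[OF Qts, of k] Qtb by (intro mult_mono) auto
    also have "r powr (2 + \<zeta>) = r\<^sup>2 * r powr \<zeta>" using r by (simp add: powr_add)
    also have "r\<^sup>2 * (M / (r\<^sup>2 * r powr \<zeta>)) = M / r powr \<zeta>" using r by simp
    also have "\<dots> \<le> M / 1" using r \<zeta> M by (intro divide_left_mono ge_one_powr_ge_zero) auto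
    finally show ?thesis by simp
  qed
  have sg: "fourier g k = trig B g k + fourier gt k" for k
    using fourier_split[OF g_sum(1) B, of k] by (simp add: gt_def B_def)
  have sQ: "fourier Q k = trig B Q k + fourier Qt k" for k
    using fourier_split[OF Q_sum(1) B, of k] by (simp add: Qt_def B_def)
  have [measurable]: "trig B g \<in> borel_measurable borel" "trig B Q \<in> borel_measurable borel"
    "fourier gt \<in> borel_measurable borel" "fourier Qt \<in> borel_measurable borel"
    by (intro borel_measurable_continuous_onI continuous_on_trig continuous_on_fourier gts Qts)+
  define e where "e = (\<lambda>k. exp (\<i> * complex_of_real (k \<bullet> rvec x)))"
  have ne: "cmod (e k) = 1" for k by (simp add: e_def)
  have [measurable]: "e \<in> borel_measurable borel" unfolding e_def by measurable
  define E1 where "E1 = (\<lambda>k. exp (- (complex_of_real t * (fourier Q 0 - trig B Q k))))"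
  have [measurable]: "E1 \<in> borel_measurable borel" unfolding E1_def by measurable
  define E where "E = (\<lambda>k. exp (- (complex_of_real t * F k)))"
  have [measurable]: "E \<in> borel_measurable borel" unfolding E_def by measurable
  have Eb: "cmod (E k) \<le> exp (- (K * t) * (norm k)\<^sup>2)" if "k \<in> torus" for k
    unfolding E_def using norm_exp_F[OF that] t by simp
  have E1b: "cmod (E1 k) \<le> exp M * exp (- (K * t) * (norm k)\<^sup>2)" if "k \<in> torus" for k
  proof -
    have "E1 k = E k * exp (- (complex_of_real t * fourier Qt k))"
      unfolding E1_def E_def sQ[of k] exp_add[symmetric] by (simp add: algebra_simps)
    then have "cmod (E1 k) = cmod (E k) * cmod (exp (- (complex_of_real t * fourier Qt k)))"
      by (simp add: norm_mult)
    also have "\<dots> \<le> exp (- (K * t) * (norm k)\<^sup>2) * exp M"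
    proof (intro mult_mono Eb that)
      have "cmod (exp (- (complex_of_real t * fourier Qt k))) \<le> exp (cmod (- (complex_of_real t * fourier Qt k)))"
        by (rule norm_exp)
      also have "\<dots> \<le> exp M" using fQt[of k] t by (simp add: norm_mult)
      finally show "cmod (exp (- (complex_of_real t * fourier Qt k))) \<le> exp M" .
    qed auto
    finally show ?thesis by (simp add: mult.commute)
  qed
  define h where "h = (\<lambda>k. e k * (complex_of_real t * (trig B g k * (E1 k * phi (complex_of_real t * fourier Qt k)))))"
  have hm: "h \<in> borel_measurable borel" unfolding h_def by measurable
  have gB: "cmod (trig B g k) \<le> M" for k
    using norm_trig_le[of B g k] finite_sum_le_infsum[OF g_sum(1) B] g_sum(2) by force
  have hb: "cmod (h k) \<le> (t * M * exp (2 * M)) * exp (- (K * t) * (norm k)\<^sup>2)" if k: "k \<in> torus" for k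
  proof -
    have "cmod (h k) = t * (cmod (trig B g k) * (cmod (E1 k) * cmod (phi (complex_of_real t * fourier Qt k))))"
      using t by (simp add: h_def norm_mult ne)
    also have "\<dots> \<le> t * (M * ((exp M * exp (- (K * t) * (norm k)\<^sup>2)) * exp M))"
    proof (intro mult_left_mono mult_mono gB E1b k)
      have "cmod (phi (complex_of_real t * fourier Qt k)) \<le> exp (cmod (complex_of_real t * fourier Qt k))" by (rule norm_phi_le)
      also have "\<dots> \<le> exp M" using fQt[of k] t by (simp add: norm_mult)
      finally show "cmod (phi (complex_of_real t * fourier Qt k)) \<le> exp M" .
    qed (use t M in auto)
    also have "\<dots> = (t * M * (exp M * exp M)) * exp (- (K * t) * (norm k)\<^sup>2)" by (simp only: mult_ac)
    also have "exp M * exp M = exp (2 * M)" by (simp add: exp_add[symmetric])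
    finally show ?thesis .
  qed
  define P where "P = max 1 t"
  have split: "e k * (fourier g k * E k) = fourier gt k * (e k * E k) + fourier Qt k * h k + e k * (trig B g k * E1 k)" for k
  proof -
    have "E k = E1 k * exp (complex_of_real t * fourier Qt k)"
      unfolding E1_def E_def sQ[of k] exp_add[symmetric] by (simp add: algebra_simps)
    then have "E k = E1 k + complex_of_real t * fourier Qt k * E1 k * phi (complex_of_real t * fourier Qt k)"
      unfolding phi_eq[of "complex_of_real t * fourier Qt k"] by (simp add: algebra_simps)
    then have "trig B g k * E k = trig B g k * E1 k + fourier Qt k * (complex_of_real t * (trig B g k * (E1 k * phi (complex_of_real t * fourier Qt k))))"
      by (simp add: algebra_simps)
    then show ?thesis unfolding sg[of k] h_def by (simp add: algebra_simps)
  qed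
  have le1: "exp (- (K * t) * (norm k)\<^sup>2) \<le> 1" for k :: "real^'d" using K t by simp
  have gtb: "cmod (fourier gt k) \<le> (\<Sum>\<^sub>\<infinity>y. \<bar>gt y\<bar>)" for k by (rule fourier_summable(2)[OF gts])
  have Qtb': "cmod (fourier Qt k) \<le> (\<Sum>\<^sub>\<infinity>y. \<bar>Qt y\<bar>)" for k by (rule fourier_summable(2)[OF Qts])
  have i1: "set_integrable lborel torus (\<lambda>k. fourier gt k * (e k * E k))"
  proof (rule torus_set_integrable)
    fix k :: "real^'d" assume k: "k \<in> torus"
    have "cmod (E k) \<le> 1" using Eb[OF k] le1[of k] by linarith
    then show "cmod (fourier gt k * (e k * E k)) \<le> (\<Sum>\<^sub>\<infinity>y. \<bar>gt y\<bar>) * 1"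
      unfolding norm_mult ne mult_1_left by (intro mult_mono gtb) (auto intro: infsum_nonneg)
  qed measurable
  have i2: "set_integrable lborel torus (\<lambda>k. fourier Qt k * h k)"
  proof (rule torus_set_integrable)
    fix k :: "real^'d" assume k: "k \<in> torus"
    have "cmod (h k) \<le> (t * M * exp (2 * M)) * 1"
      by (rule order_trans[OF hb[OF k]]) (use t M le1 in \<open>intro mult_left_mono, auto\<close>)
    then show "cmod (fourier Qt k * h k) \<le> (\<Sum>\<^sub>\<infinity>y. \<bar>Qt y\<bar>) * ((t * M * exp (2 * M)) * 1)"
      unfolding norm_mult by (intro mult_mono Qtb') (auto intro: infsum_nonneg)
  qed (use hm in measurable)
  have i3: "set_integrable lborel torus (\<lambda>k. e k * (trig B g k * E1 k))"
    unfolding e_def E1_def by (intro torus_continuous_integrable continuous_intros)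
  have "cmod (green_inner Q g x t) \<le> cmod (LINT k:torus|lborel. e k * (fourier g k * E k))"
    unfolding green_inner_eq e_def E_def by (rule norm_divide_two_pi)
  also have "(LINT k:torus|lborel. e k * (fourier g k * E k))
     = (LINT k:torus|lborel. fourier gt k * (e k * E k)) + (LINT k:torus|lborel. fourier Qt k * h k) + (LINT k:torus|lborel. e k * (trig B g k * E1 k))"
    unfolding split using i1 i2 i3 by (simp add: set_integral_add)
  also have "cmod \<dots> \<le> cmod (LINT k:torus|lborel. fourier gt k * (e k * E k)) + cmod (LINT k:torus|lborel. fourier Qt k * h k)
      + cmod (LINT k:torus|lborel. e k * (trig B g k * E1 k))"
    by (rule order_trans[OF norm_triangle_ineq add_right_mono[OF norm_triangle_ineq]])
  also have "cmod (LINT k:torus|lborel. fourier gt k * (e k * E k)) \<le> 2 * gauss_const TYPE('d) K * Ng * 1 * P powr (- real CARD('d) / (2 * pg))"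
    unfolding P_def
  proof (rule torus_pairing_fourier[OF pg gts _ _ Ng _ _ _ K t(1)])
    show "(\<lambda>y. \<bar>gt y\<bar> powr pg) summable_on UNIV" "(\<Sum>\<^sub>\<infinity>y. \<bar>gt y\<bar> powr pg) \<le> Ng powr pg"
      unfolding gt_def by (fact g2)+
    show "cmod (e k * E k) \<le> 1 * exp (- (K * t) * (norm k)\<^sup>2)" if "k \<in> torus" for k
      using Eb[OF that] by (simp add: norm_mult ne)
    show "(\<lambda>k. e k * E k) \<in> borel_measurable borel" by measurable
  qed simp
  also have "cmod (LINT k:torus|lborel. fourier Qt k * h k) \<le> 2 * gauss_const TYPE('d) K * NQ * (t * M * exp (2 * M)) * P powr (- real CARD('d) / (2 * pQ))"
    unfolding P_def
  proof (rule torus_pairing_fourier[OF pQ Qts _ _ NQ hm hb _ K t(1)])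
    show "(\<lambda>y. \<bar>Qt y\<bar> powr pQ) summable_on UNIV" "(\<Sum>\<^sub>\<infinity>y. \<bar>Qt y\<bar> powr pQ) \<le> NQ powr pQ"
      unfolding Qt_def by (fact Q2)+
  qed (use t M in auto)
  also have "cmod (LINT k:torus|lborel. e k * (trig B g k * E1 k)) \<le> M * exp 1 * gauss_const TYPE('d) (K / 2) * exp (t * tilt_const M K / r\<^sup>2 - D / r) * P powr (- real CARD('d) / 2)"
    unfolding e_def E1_def B_def P_def by (rule tilted_part_bound) (use t r D in auto)
  also have "\<dots> \<le> M * exp 1 * gauss_const TYPE('d) (K / 2) * (exp (tilt_const M K) * exp (- (D / r))) * P powr (- real CARD('d) / 2)"
  proof (intro mult_right_mono mult_left_mono)
    have tc: "tilt_const M K \<ge> 0" using M K by (simp add: tilt_const_def)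
    have "t / r\<^sup>2 * tilt_const M K \<le> 1 * tilt_const M K" using t r tc by (intro mult_right_mono) auto
    then show "exp (t * tilt_const M K / r\<^sup>2 - D / r) \<le> exp (tilt_const M K) * exp (- (D / r))"
      by (simp add: exp_add[symmetric])
  qed (use M gauss_const_ge(2)[of "K / 2", where 'd='d] in auto)
  finally have *: "cmod (green_inner Q g x t) \<le> 2 * gauss_const TYPE('d) K * Ng * 1 * P powr (- real CARD('d) / (2 * pg))
    + 2 * gauss_const TYPE('d) K * NQ * (t * M * exp (2 * M)) * P powr (- real CARD('d) / (2 * pQ))
    + M * exp 1 * gauss_const TYPE('d) (K / 2) * (exp (tilt_const M K) * exp (- (D / r))) * P powr (- real CARD('d) / 2)"
    by simp
  define a where "a = 2 * gauss_const TYPE('d) K"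
  define b where "b = M * exp (2 * M)"
  define c where "c = M * exp (1 + tilt_const M K) * gauss_const TYPE('d) (K / 2)"
  have abc: "a \<ge> 0" "b \<ge> 0" "c \<ge> 0"
    using M gauss_const_ge(2)[of "K", where 'd='d] gauss_const_ge(2)[of "K / 2", where 'd='d] by (auto simp: a_def b_def c_def)
  have C: "trunc_const TYPE('d) M K = a * (1 + b) + c" by (simp add: trunc_const_def a_def b_def c_def)
  define u v w where "u = Ng * P powr (- real CARD('d) / (2 * pg))" and "v = t * NQ * P powr (- real CARD('d) / (2 * pQ))"
    and "w = exp (- (D / r)) * P powr (- real CARD('d) / 2)"
  have uvw: "u \<ge> 0" "v \<ge> 0" "w \<ge> 0" using Ng NQ t by (auto simp: u_def v_def w_def)
  have "cmod (green_inner Q g x t) \<le> a * u + a * b * v + c * w"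
    using * by (simp add: a_def b_def c_def u_def v_def w_def exp_add mult_ac)
  also have "\<dots> \<le> (a * (1 + b) + c) * u + (a * (1 + b) + c) * v + (a * (1 + b) + c) * w"
    using abc uvw by (intro add_mono mult_right_mono) (auto simp: algebra_simps)
  finally show ?thesis unfolding C by (simp add: u_def v_def w_def P_def algebra_simps)
qed

lemma trunc_const_nonneg: "trunc_const TYPE('d) M K \<ge> 0"
  using M gauss_const_ge(2)[of "K", where 'd='d] gauss_const_ge(2)[of "K / 2", where 'd='d]
  by (auto simp: trunc_const_def intro!: add_nonneg_nonneg mult_nonneg_nonneg)

text \<open>With \<open>r = D powr (1 - \<delta>)\<close> the time restriction is
  \<open>t <= r^2\<close>, and \<open>exp (- D / r)\<close> becomes a stretched exponential in
  \<open>D\<close>, below every power. The parameter \<open>a\<close> dominates the three exponents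
  of \<open>max 1 t\<close> that come from the tail of \<open>g\<close>, the tail of
  \<open>Q\<close> and the tilted part.\<close>

lemma far_bound_generic:
  fixes x :: "int ^ 'd"
  assumes \<delta>: "0 < \<delta>" "\<delta> < 1" and t: "t > 0" "t \<le> D powr (2 - 2 * \<delta>)"
    and D: "D = norm (rvec x - t *\<^sub>R \<eta>)" "D \<ge> 1" and N: "N > 0"
    and pg: "1 \<le> pg" "pg \<le> 2" and pQ: "1 \<le> pQ" "pQ \<le> 2"
    and wg: "lp_norm pg (\<lambda>y. wg y * g y) \<le> ennreal M" "\<And>y r. norm (rvec y) > r \<Longrightarrow> r \<ge> 1 \<Longrightarrow> wg y \<ge> r powr ng"
    and wQ: "lp_norm pQ (\<lambda>y. wQ y * Q y) \<le> ennreal M" "\<And>y r. norm (rvec y) > r \<Longrightarrow> r \<ge> 1 \<Longrightarrow> wQ y \<ge> r powr nQ"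
    and n: "N \<le> ng" "N \<le> nQ"
    and e: "- real CARD('d) / (2 * pg) \<le> a" "1 - real CARD('d) / (2 * pQ) \<le> a" "- real CARD('d) / 2 \<le> a"
  shows "cmod (green_inner Q g x t) \<le> far_const TYPE('d) M K N \<delta> * max 1 t powr a * D powr (- N * (1 - \<delta>))"
proof -
  define r where "r = D powr (1 - \<delta>)"
  define P where "P = max 1 t"
  have P: "P \<ge> 1" "t \<le> P" by (auto simp: P_def)
  have r: "r \<ge> 1" using D \<delta> by (simp add: r_def ge_one_powr_ge_zero)
  have r2: "r\<^sup>2 = D powr (2 - 2 * \<delta>)"
    using D by (simp add: r_def power2_eq_square powr_add[symmetric])
  have Dr: "D / r = D powr \<delta>"
  proof -
    have "D powr \<delta> * r = D" using D by (simp add: r_def powr_add[symmetric])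
    then show ?thesis using r by (simp add: field_simps)
  qed
  have rN: "D powr (- N * (1 - \<delta>)) = 1 / r powr N"
    by (simp add: r_def powr_powr powr_minus_divide[symmetric] mult.commute)
  have rn: "r powr ng > 0" "r powr nQ > 0" using r by auto
  have "cmod (green_inner Q g x t) \<le> trunc_const TYPE('d) M K *
    (M / r powr ng * P powr (- real CARD('d) / (2 * pg)) + t * (M / r powr nQ) * P powr (- real CARD('d) / (2 * pQ))
      + exp (- (D / r)) * P powr (- real CARD('d) / 2))"
    unfolding P_def
    by (rule truncation_bound[OF t(1) _ r D(1) _ pg _ tail_weight[OF wg(1) _ M rn(1) wg(2)[OF _ r]] pQ _ tail_weight[OF wQ(1) _ M rn(2) wQ(2)[OF _ r]]])
      (use t r2 D M rn pg pQ in auto)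
  also have "\<dots> \<le> trunc_const TYPE('d) M K * (M / r powr N * P powr a + M / r powr N * P powr a + (N / \<delta>) powr (N / \<delta>) * (1 / r powr N) * P powr a)"
  proof (intro mult_left_mono add_mono trunc_const_nonneg)
    show "M / r powr ng * P powr (- real CARD('d) / (2 * pg)) \<le> M / r powr N * P powr a"
      using M n r e P by (intro mult_mono divide_left_mono powr_mono) auto
    have "t * (M / r powr nQ) * P powr (- real CARD('d) / (2 * pQ)) \<le> P * (M / r powr N) * P powr (- real CARD('d) / (2 * pQ))"
      using M n r e P t by (intro mult_right_mono mult_mono divide_left_mono powr_mono) auto
    also have "\<dots> = M / r powr N * (P powr 1 * P powr (- real CARD('d) / (2 * pQ)))" using P by simp
    also have "P powr 1 * P powr (- real CARD('d) / (2 * pQ)) = P powr (1 - real CARD('d) / (2 * pQ))"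
      by (simp only: powr_add[symmetric]) simp
    also have "M / r powr N * P powr (1 - real CARD('d) / (2 * pQ)) \<le> M / r powr N * P powr a"
      using M e P r by (intro mult_left_mono powr_mono) auto
    finally show "t * (M / r powr nQ) * P powr (- real CARD('d) / (2 * pQ)) \<le> M / r powr N * P powr a" .
    have "exp (- (D / r)) \<le> (N / \<delta>) powr (N / \<delta>) * D powr (- N)"
      unfolding Dr using D \<delta> N by (intro exp_neg_powr_le) auto
    also have "D powr (- N) \<le> D powr (- N * (1 - \<delta>))"
      using D \<delta> N by (intro powr_mono) (auto simp: algebra_simps)
    finally have "exp (- (D / r)) \<le> (N / \<delta>) powr (N / \<delta>) * (1 / r powr N)"
      unfolding rN by (simp add: mult_left_mono)
    then show "exp (- (D / r)) * P powr (- real CARD('d) / 2) \<le> (N / \<delta>) powr (N / \<delta>) * (1 / r powr N) * P powr a"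
      using e P r by (intro mult_mono powr_mono) auto
  qed
  also have "\<dots> = far_const TYPE('d) M K N \<delta> * P powr a * (1 / r powr N)"
    by (simp add: far_const_def algebra_simps)
  finally show ?thesis unfolding rN P_def .
qed

text \<open>The tail of \<open>Q\<close> is taken in \<open>l^1\<close>, where its factor
  \<open>t\<close> leads to the exponent \<open>1 - d/2\<close>. The exponent \<open>p_exp\<close>
  satisfies \<open>d / (2 p) >= d/2 - 1\<close>, so the tail of \<open>g\<close> is no
  worse.\<close>

lemma far_bound:
  fixes x :: "int ^ 'd"
  assumes \<delta>: "0 < \<delta>" "\<delta> < 1" and t: "t > 0" "t \<le> D powr (2 - 2 * \<delta>)"
    and D: "D = norm (rvec x - t *\<^sub>R \<eta>)" "D \<ge> 1"
  shows "cmod (green_inner Q g x t) \<le> far_const TYPE('d) M K 2 \<delta> * max 1 t powr (1 - real CARD('d) / 2) * D powr (- 2 * (1 - \<delta>))"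
proof -
  define p where "p = p_exp CARD('d) \<zeta>"
  have d1: "CARD('d) \<ge> 1" by (simp add: Suc_leI)
  have p: "1 \<le> p \<and> real CARD('d) / 2 - 1 \<le> real CARD('d) / (2 * p)"
  proof (cases "CARD('d) = 1")
    case True then show ?thesis by (simp add: p_def p_exp_def)
  next
    case False
    define d where "d = real CARD('d)"
    have "CARD('d) \<ge> 2" using False d1 by linarith
    then have d2: "d \<ge> 2" by (simp add: d_def)
    define m where "m = min \<zeta> 2"
    have m: "0 < m" "m \<le> 2" using \<zeta> by (auto simp: m_def)
    have pe: "p = d / (d - 2 + m)" using False by (simp add: p_def p_exp_def d_def m_def)
    have pos: "d - 2 + m > 0" using d2 m by simp
    have "1 \<le> p" unfolding pe using pos m by simp
    moreover have "d / (2 * p) = (d - 2 + m) / 2" unfolding pe using pos d2 by (simp add: field_simps)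
    ultimately show ?thesis using m by (simp add: d_def)
  qed
  have pm: "real CARD('d) / (2 * p) \<le> real CARD('d) / (2 * min p 2)"
    using p by (intro divide_left_mono) auto
  show ?thesis
  proof (rule far_bound_generic[OF \<delta> t D, of 2 "min p 2" 1 "\<lambda>y. (norm (rvec y))\<^sup>2" 2 "\<lambda>y. norm (rvec y) powr (2 + \<zeta>)" "2 + \<zeta>"])
    show "lp_norm (min p 2) (\<lambda>y. (norm (rvec y))\<^sup>2 * g y) \<le> ennreal M" unfolding p_def by (rule class_QD)
    show "lp_norm 1 (\<lambda>y. norm (rvec y) powr (2 + \<zeta>) * Q y) \<le> ennreal M" by (rule class_QD)
    show "- real CARD('d) / (2 * min p 2) \<le> 1 - real CARD('d) / 2" using pm p by simp
  qed (use p \<zeta> in \<open>auto intro!: powr_mono2 power_mono\<close>)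
qed

text \<open>The weights \<open>|y|^(d-1)\<close> of condition (d) buy decay of order almost
  \<open>d - 1\<close> in \<open>D\<close>, with a time factor that decays only like
  \<open>t powr (- 1 / 2)\<close>. At early times, where \<open>D\<close> is comparable to
  \<open>|x|\<close>, this is the better bargain.\<close>

lemma far_bound_high_dim:
  fixes x :: "int ^ 'd"
  assumes \<delta>: "0 < \<delta>" "\<delta> < 1" and t: "t > 0" "t \<le> D powr (2 - 2 * \<delta>)"
    and D: "D = norm (rvec x - t *\<^sub>R \<eta>)" "D \<ge> 1" and d: "CARD('d) \<ge> 4"
  shows "cmod (green_inner Q g x t) \<le> far_const TYPE('d) M K (real CARD('d) - 1) \<delta> * max 1 t powr (- 1 / 2) * D powr (- (real CARD('d) - 1) * (1 - \<delta>))"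
proof (rule far_bound_generic[OF \<delta> t D, of _ 2 "min (real CARD('d) / 3) 2" "\<lambda>y. norm (rvec y) ^ (CARD('d) - 1)" "real CARD('d) - 1"
      "\<lambda>y. norm (rvec y) ^ (CARD('d) - 1)" "real CARD('d) - 1"])
  have d': "real CARD('d) \<ge> 4" using d by simp
  show "lp_norm 2 (\<lambda>y. norm (rvec y) ^ (CARD('d) - 1) * g y) \<le> ennreal M" by (rule class_QD(8)[OF d])
  show "lp_norm (min (real CARD('d) / 3) 2) (\<lambda>y. norm (rvec y) ^ (CARD('d) - 1) * Q y) \<le> ennreal M" by (rule class_QD(7)[OF d])
  have *: "norm (rvec y) ^ (CARD('d) - 1) \<ge> r powr (real CARD('d) - 1)" if "norm (rvec y) > r" "r \<ge> 1" for y :: "int ^ 'd" and r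
  proof -
    have "r powr (real CARD('d) - 1) = r powr real (CARD('d) - 1)" using d by (simp add: of_nat_diff)
    also have "\<dots> = r ^ (CARD('d) - 1)" using that by (intro powr_realpow) auto
    also have "\<dots> \<le> norm (rvec y) ^ (CARD('d) - 1)" using that by (intro power_mono) auto
    finally show ?thesis .
  qed
  then show "norm (rvec y) ^ (CARD('d) - 1) \<ge> r powr (real CARD('d) - 1)" if "norm (rvec y) > r" "r \<ge> 1" for y :: "int ^ 'd" and r
    using that by blast
  show "norm (rvec y) ^ (CARD('d) - 1) \<ge> r powr (real CARD('d) - 1)" if "norm (rvec y) > r" "r \<ge> 1" for y :: "int ^ 'd" and r
    using that * by blast
  define p where "p = min (real CARD('d) / 3) 2"
  have p: "p > 0" "p \<le> real CARD('d) / 3" using d' by (auto simp: p_def)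
  \<comment> \<open>\<open>d / 3\<close> is the exponent for which \<open>1 - d / (2 p)\<close>
    equals \<open>- 1 / 2\<close>; the cap at 2 can only lower this value.\<close>
  have "3 / 2 \<le> real CARD('d) / (2 * p)" using p by (simp add: field_simps)
  then show "1 - real CARD('d) / (2 * min (real CARD('d) / 3) 2) \<le> - 1 / 2" by (simp add: p_def)
qed (use d in auto)

end

section \<open>Integration in time\<close>

text \<open>Integrals as \<open>ennreal\<close> values, so that upper bounds need no integrability.\<close>

definition upint :: "(real \<Rightarrow> real) \<Rightarrow> real set \<Rightarrow> ennreal" where
  "upint \<phi> A = (\<integral>\<^sup>+ t. ennreal (\<phi> t) * indicator A t \<partial>lborel)"

lemma upint_mono:
  assumes "\<And>t. t \<in> A \<Longrightarrow> \<phi> t \<le> \<psi> t" "A \<subseteq> B"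
  shows "upint \<phi> A \<le> upint \<psi> B"
  unfolding upint_def using assms by (intro nn_integral_mono) (auto simp: indicator_def intro: ennreal_leI)

lemma upint_Un:
  assumes [measurable]: "\<phi> \<in> borel_measurable borel" "A \<in> sets borel" "B \<in> sets borel"
  shows "upint \<phi> (A \<union> B) \<le> upint \<phi> A + upint \<phi> B"
proof -
  have "upint \<phi> (A \<union> B) \<le> (\<integral>\<^sup>+ t. ennreal (\<phi> t) * indicator A t + ennreal (\<phi> t) * indicator B t \<partial>lborel)"
    unfolding upint_def by (intro nn_integral_mono) (auto simp: indicator_def)
  also have "\<dots> = upint \<phi> A + upint \<phi> B" unfolding upint_def by (rule nn_integral_add) measurable
  finally show ?thesis .
qed

lemma upint_inverse_sqrt:
  assumes "c \<ge> 0" "T \<ge> 0"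
  shows "upint (\<lambda>t. c * t powr (- 1 / 2)) {0<..T} \<le> ennreal (2 * c * sqrt T)"
proof -
  have "((\<lambda>t. c * t powr (- 1 / 2)) has_integral c * (T powr (- 1 / 2 + 1) / (- 1 / 2 + 1))) {0..T}"
    using assms by (intro has_integral_mult_right has_integral_powr_from_0) auto
  then have "upint (\<lambda>t. c * t powr (- 1 / 2)) {0..T} = ennreal (c * (T powr (- 1 / 2 + 1) / (- 1 / 2 + 1)))"
    unfolding upint_def using assms by (intro nn_integral_has_integral_lebesgue') auto
  moreover have "c * (T powr (- 1 / 2 + 1) / (- 1 / 2 + 1)) = 2 * c * sqrt T"
    using assms by (simp add: powr_half_sqrt)
  ultimately have "upint (\<lambda>t. c * t powr (- 1 / 2)) {0..T} = ennreal (2 * c * sqrt T)" by metis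
  moreover have "upint (\<lambda>t. c * t powr (- 1 / 2)) {0<..T} \<le> upint (\<lambda>t. c * t powr (- 1 / 2)) {0..T}"
    by (rule upint_mono) auto
  ultimately show ?thesis by simp
qed

lemma upint_powr_tail:
  assumes "c \<ge> 0" "T > 0" "p > 1"
  shows "upint (\<lambda>t. c * t powr (- p)) {T..} = ennreal (c * T powr (1 - p) / (p - 1))"
proof -
  have "((\<lambda>t. c * t powr (- p)) has_integral c * (- (T powr (- p + 1)) / (- p + 1))) {T..}"
    using assms by (intro has_integral_mult_right has_integral_powr_to_inf) auto
  then have "upint (\<lambda>t. c * t powr (- p)) {T..} = ennreal (c * (- (T powr (- p + 1)) / (- p + 1)))"
    unfolding upint_def using assms by (intro nn_integral_has_integral_lebesgue') auto
  also have "c * (- (T powr (- p + 1)) / (- p + 1)) = c * T powr (1 - p) / (p - 1)"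
    using assms by (simp add: field_simps)
  finally show ?thesis .
qed

lemma upint_const:
  assumes "c \<ge> 0" "a \<le> b"
  shows "upint (\<lambda>t. c) {a..b} = ennreal (c * (b - a))"
  unfolding upint_def using assms by (simp add: nn_integral_cmult ennreal_mult)

text \<open>Meant for times on both sides of the passage time \<open>a\<close>; a translation or a
  reflection carries each half line to \<open>upint_powr_tail\<close>.\<close>

lemma upint_powr_centered:
  assumes "c \<ge> 0" "L > 0" "p > 1"
  shows "upint (\<lambda>t. c * \<bar>t - a\<bar> powr (- p)) {t. \<bar>t - a\<bar> \<ge> L} \<le> ennreal (2 * (c * L powr (1 - p) / (p - 1)))"
proof -
  let ?f = "\<lambda>t. c * \<bar>t - a\<bar> powr (- p)"
  have [measurable]: "?f \<in> borel_measurable borel" by measurable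
  have 1: "upint ?f {a + L..} = ennreal (c * L powr (1 - p) / (p - 1))"
  proof -
    have "upint ?f {a + L..} = (\<integral>\<^sup>+ t. ennreal (?f (a + 1 * t)) * indicator {a + L..} (a + 1 * t) \<partial>lborel)"
      unfolding upint_def by (subst nn_integral_real_affine[of _ 1 a]) auto
    also have "\<dots> = upint (\<lambda>t. c * t powr (- p)) {L..}"
      unfolding upint_def using assms by (intro nn_integral_cong) (auto simp: indicator_def)
    finally show ?thesis using upint_powr_tail[OF assms] by simp
  qed
  have 2: "upint ?f {..a - L} = ennreal (c * L powr (1 - p) / (p - 1))"
  proof -
    have "upint ?f {..a - L} = (\<integral>\<^sup>+ t. ennreal (?f (a + (-1) * t)) * indicator {..a - L} (a + (-1) * t) \<partial>lborel)"
      unfolding upint_def by (subst nn_integral_real_affine[of _ "-1" a]) auto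
    also have "\<dots> = upint (\<lambda>t. c * t powr (- p)) {L..}"
      unfolding upint_def using assms by (intro nn_integral_cong) (auto simp: indicator_def)
    finally show ?thesis using upint_powr_tail[OF assms] by simp
  qed
  have "upint ?f {t. \<bar>t - a\<bar> \<ge> L} \<le> upint ?f ({a + L..} \<union> {..a - L})"
    by (rule upint_mono) auto
  also have "\<dots> \<le> upint ?f {a + L..} + upint ?f {..a - L}" by (rule upint_Un) measurable
  also have "\<dots> = ennreal (2 * (c * L powr (1 - p) / (p - 1)))"
    unfolding 1 2 using assms by (subst ennreal_plus[symmetric]) auto
  finally show ?thesis .
qed

lemma powr_half_minus:
  fixes y e :: real
  shows "(y / 2) powr (- e) = y powr (- e) * 2 powr e"
proof -
  have "(y / 2) powr (- e) = y powr (- e) / 2 powr (- e)" by (rule powr_divide)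
  also have "2 powr (- e) = inverse (2 powr e)" by (rule powr_minus)
  finally show ?thesis by (simp only: divide_inverse inverse_inverse_eq)
qed

lemma powr_inverse_minus: "(1 / z) powr (- e) = z powr e" for z e :: real
  by (simp add: powr_divide powr_minus_divide)

text \<open>A function \<open>\<phi>\<close> of the time \<open>t\<close> at a point at distance \<open>X\<close>, aligned with a drift of length \<open>h\<close>: \<open>F0\<close> is the
  on-diagonal bound, \<open>F1\<close> the local limit error with exponent gain \<open>e1\<close>, and \<open>F2\<close>, \<open>F3\<close> bound \<open>\<phi>\<close> away from the
  drift. The loss \<open>q\<close> must be small against \<open>e1\<close>, whence the factor \<open>100 (d + 1)^2\<close>.\<close>

locale green_majorant =
  fixes d :: nat and X h M q e1 C s0 :: real and \<phi> :: "real \<Rightarrow> real"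
  assumes d: "d \<ge> 1" and h: "0 \<le> h" "h \<le> M" and M: "M > 0" and q: "q > 0" and C: "C > 0" and s0: "s0 > 0"
    and e1: "e1 = 100 * (real d + 1)\<^sup>2 * q" "e1 \<le> 1 / 2"
    and X: "X \<ge> 2" "X \<ge> 2 * M" "X powr q \<ge> 8" "X powr q \<ge> (max 1 (2 / s0))\<^sup>2"
    and \<phi>m [measurable]: "\<phi> \<in> borel_measurable borel"
    and F0: "\<And>t. t \<ge> 1 \<Longrightarrow> \<phi> t \<le> C * t powr (- real d / 2)"
    and F1: "\<And>t. t > 0 \<Longrightarrow> \<phi> t \<le> C * t powr (- real d / 2 - e1)"
    and F2: "\<And>t. t > 0 \<Longrightarrow> \<bar>X - h * t\<bar> \<ge> 1 \<Longrightarrow> t \<le> \<bar>X - h * t\<bar> powr (2 - 2 * q) \<Longrightarrow>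
        \<phi> t \<le> C * max 1 t powr (1 - real d / 2) * \<bar>X - h * t\<bar> powr (- 2 * (1 - q))"
    and F3: "\<And>t. d \<ge> 4 \<Longrightarrow> t > 0 \<Longrightarrow> \<bar>X - h * t\<bar> \<ge> 1 \<Longrightarrow> t \<le> \<bar>X - h * t\<bar> powr (2 - 2 * q) \<Longrightarrow>
        \<phi> t \<le> C * max 1 t powr (- 1 / 2) * \<bar>X - h * t\<bar> powr (- (real d - 1) * (1 - q))"
    and low: "d \<le> 2 \<Longrightarrow> X * h \<ge> s0"
begin

definition "s = X * h"
definition "S = 1 + s"
text \<open>An upper bound for the decay exponents in use, so that losses can be counted in
  multiples of \<open>E * q\<close>.\<close>

definition "E = real d + 1"
definition "T = X powr (2 - real d) * S powr ((real d - 3) / 2)"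

lemma basic: "X > 0" "X \<ge> 1" "s \<ge> 0" "S \<ge> 1" "E \<ge> 2" "T > 0" "q < 1 / 400" "E * q \<le> 1 / 400" "real d \<ge> 1" "E\<^sup>2 * q \<le> 1 / 200"
proof -
  show "X > 0" "X \<ge> 1" using X by auto
  show s: "s \<ge> 0" using h X by (simp add: s_def)
  then show S: "S \<ge> 1" by (simp add: S_def)
  show E: "E \<ge> 2" using d by (simp add: E_def)
  show "real d \<ge> 1" using d by simp
  show "T > 0" using S X by (auto simp: T_def)
  show E2: "E\<^sup>2 * q \<le> 1 / 200" using e1 by (simp add: E_def)
  have "2 * (E * q) \<le> E * (E * q)" using E q by (intro mult_right_mono) auto
  also have "\<dots> = E\<^sup>2 * q" by (simp add: power2_eq_square)
  finally show Eq: "E * q \<le> 1 / 400" using E2 by simp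
  have "2 * q \<le> E * q" using E q by (intro mult_right_mono) auto
  with Eq show "q < 1 / 400" using q by linarith
qed

lemma X_powr_mono: "a \<le> b \<Longrightarrow> X powr a \<le> X powr b"
  using basic by (intro powr_mono) auto

lemma X_powr_ge_8: "q \<le> a \<Longrightarrow> X powr a \<ge> 8"
  using X_powr_mono[of q a] X(3) by linarith

lemma X_powr_ge_s0: "q \<le> a \<Longrightarrow> X powr a \<ge> (max 1 (2 / s0))\<^sup>2"
  using X_powr_mono[of q a] X(4) by linarith

lemma d_e1: "200 * q \<le> E\<^sup>2 * 50 * q" "e1 = 100 * E\<^sup>2 * q"
proof -
  have "4 \<le> E\<^sup>2" using power_mono[of 2 E 2] basic by simp
  then show "200 * q \<le> E\<^sup>2 * 50 * q" using q by simp
qed (use e1 in \<open>simp add: E_def\<close>)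

text \<open>For \<open>d <= 3\<close> the far bound carries
  \<open>t powr (1 - d/2) = t powr (- 1/2) * t powr m\<close>; for larger \<open>d\<close> the
  second far bound has \<open>t powr (- 1/2)\<close> and \<open>m = 0\<close>. With \<open>m\<close>
  both cases share one formula.\<close>

definition "m = max 0 ((3 - real d) / 2)"

lemma m: "0 \<le> m" "m \<le> 1" "- m \<le> (real d - 3) / 2"
  using basic by (auto simp: m_def max_def field_simps)

lemma S_powr_ge: "S powr (- m) \<le> S powr ((real d - 3) / 2)"
  using m basic by (intro powr_mono) auto

text \<open>Up to time \<open>X^2 / \<sigma>\<close> the drift has covered at most half of the
  distance, since \<open>2 * s <= \<sigma>\<close>, so \<open>D >= X / 2\<close> throughout. The
  condition \<open>4 * X powr (2 * q) <= \<sigma>\<close> makes the far bounds applicable. What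
  remains to be integrated is a multiple of \<open>t powr (- 1 / 2)\<close>, and a large
  \<open>\<sigma>\<close> is a gain.\<close>

lemma small_time:
  assumes \<sigma>: "2 * s \<le> \<sigma>" "4 * X powr (2 * q) \<le> \<sigma>" "\<sigma> \<le> X\<^sup>2"
  shows "upint \<phi> {0<..X\<^sup>2 / \<sigma>} \<le> ennreal (C * 2 ^ (d + 2) * X powr (E * q) * X powr (2 - real d) * \<sigma> powr (- 1 / 2 - m))"
proof -
  define T1 where "T1 = X\<^sup>2 / \<sigma>"
  have \<sigma>0: "\<sigma> > 0" using \<sigma>(2) X_powr_mono[of 0 "2 * q"] basic q by (smt (verit) powr_gt_zero mult_pos_pos)
  have T1: "T1 \<ge> 1" using \<sigma> \<sigma>0 by (simp add: T1_def)
  have hT: "h * T1 \<le> X / 2"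
  proof -
    have "h * T1 = X * (s / \<sigma>)" by (simp add: T1_def s_def power2_eq_square)
    also have "\<dots> \<le> X * (1 / 2)" using \<sigma> \<sigma>0 basic by (intro mult_left_mono) (auto simp: field_simps)
    finally show ?thesis by simp
  qed
  have XT: "T1 \<le> (X / 2) powr (2 - 2 * q)"
  proof -
    have "T1 \<le> X\<^sup>2 / (4 * X powr (2 * q))"
      unfolding T1_def using \<sigma> \<sigma>0 basic by (intro divide_left_mono) auto
    also have "\<dots> = (X / 2)\<^sup>2 / X powr (2 * q)" by (simp add: power_divide)
    also have "\<dots> \<le> (X / 2)\<^sup>2 / (X / 2) powr (2 * q)"
      using basic q by (intro divide_left_mono powr_mono2 mult_pos_pos) auto
    also have "\<dots> = (X / 2) powr (2 - 2 * q)" using basic by (simp add: powr_diff)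
    finally show ?thesis .
  qed
  \<comment> \<open>\<open>n\<close> is the order of decay in \<open>D\<close> of the far bound in
    use. By \<open>n = d - 1 + 2 * m\<close> the power \<open>X powr (1 + 2 * m)\<close> from the
    time integral and \<open>X powr (- n)\<close> combine to \<open>X powr (2 - d)\<close> in every
    dimension.\<close>
  define n where "n = (if d \<le> 3 then 2 else real d - 1)"
  have n: "n = real d - 1 + 2 * m" "0 \<le> n" "n \<le> E"
    using basic by (cases "d \<le> 3"; simp add: n_def m_def E_def max_def field_simps)+
  have nq: "0 \<le> n * (1 - q)" using n(2) basic(7) by (intro mult_nonneg_nonneg) auto
  have bd: "\<phi> t \<le> C * T1 powr m * (X / 2) powr (- n * (1 - q)) * t powr (- 1 / 2)" if t: "0 < t" "t \<le> T1" for t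
  proof -
    define D where "D = \<bar>X - h * t\<bar>"
    have "h * t \<le> h * T1" using t h by (intro mult_left_mono) auto
    then have D: "D \<ge> X / 2" using hT unfolding D_def by linarith
    then have D1: "D \<ge> 1" using X by simp
    have "(X / 2) powr (2 - 2 * q) \<le> D powr (2 - 2 * q)" using D basic q by (intro powr_mono2) auto
    then have tD: "t \<le> D powr (2 - 2 * q)" using t XT by simp
    have Dn: "D powr (- n * (1 - q)) \<le> (X / 2) powr (- n * (1 - q))"
      using D basic(1) nq by (intro powr_mono2') simp_all
    have mt: "max 1 t powr (- 1 / 2) \<le> t powr (- 1 / 2)" using t by (intro powr_mono2') auto
    show ?thesis
    proof (cases "d \<le> 3")
      case True
      then have md: "m = (3 - real d) / 2" "n = 2" by (auto simp: m_def n_def)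
      have "1 - real d / 2 = - 1 / 2 + m" by (simp add: md field_simps)
      then have "max 1 t powr (1 - real d / 2) = max 1 t powr (- 1 / 2) * max 1 t powr m"
        by (simp only: powr_add)
      also have "\<dots> \<le> t powr (- 1 / 2) * T1 powr m"
        using t T1 m by (intro mult_mono mt powr_mono2) auto
      finally have e: "max 1 t powr (1 - real d / 2) \<le> t powr (- 1 / 2) * T1 powr m" .
      have "\<phi> t \<le> C * max 1 t powr (1 - real d / 2) * D powr (- 2 * (1 - q))"
        using F2[OF t(1)] D1 tD by (simp add: D_def)
      also have "\<dots> \<le> C * (t powr (- 1 / 2) * T1 powr m) * (X / 2) powr (- n * (1 - q))"
        using C Dn e by (intro mult_mono mult_left_mono) (auto simp: md)
      finally show ?thesis by (simp add: mult_ac)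
    next
      case False
      then have md: "m = 0" "n = real d - 1" by (auto simp: m_def n_def)
      have "\<phi> t \<le> C * max 1 t powr (- 1 / 2) * D powr (- (real d - 1) * (1 - q))"
        using F3[OF _ t(1)] D1 tD False by (simp add: D_def)
      also have "\<dots> \<le> C * t powr (- 1 / 2) * (X / 2) powr (- n * (1 - q))"
        using C Dn mt by (intro mult_mono mult_left_mono) (auto simp: md)
      finally show ?thesis using T1 by (simp add: md mult_ac)
    qed
  qed
  have "upint \<phi> {0<..T1} \<le> upint (\<lambda>t. C * T1 powr m * (X / 2) powr (- n * (1 - q)) * t powr (- 1 / 2)) {0<..T1}"
    by (rule upint_mono[OF bd]) auto
  also have "\<dots> \<le> ennreal (2 * (C * T1 powr m * (X / 2) powr (- n * (1 - q))) * sqrt T1)"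
    using C T1 by (intro upint_inverse_sqrt) auto
  also have "\<dots> \<le> ennreal (C * 2 ^ (d + 2) * X powr (E * q) * X powr (2 - real d) * \<sigma> powr (- 1 / 2 - m))"
  proof (rule ennreal_leI)
    have "(X / 2) powr (- n * (1 - q)) = X powr (- n * (1 - q)) * 2 powr (n * (1 - q))"
      using powr_half_minus[of X "n * (1 - q)"] by simp
    also have "\<dots> \<le> X powr (- n * (1 - q)) * 2 powr E"
    proof (intro mult_left_mono powr_mono)
      have "n * (1 - q) \<le> n * 1" using n basic q by (intro mult_left_mono) auto
      then show "n * (1 - q) \<le> E" using n by simp
    qed auto
    also have "2 powr E = 2 ^ (d + 1)" by (simp add: E_def powr_add powr_realpow)
    finally have a: "(X / 2) powr (- n * (1 - q)) \<le> X powr (- n * (1 - q)) * 2 ^ (d + 1)" .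
    have b: "T1 powr m * sqrt T1 = X powr (1 + 2 * m) * \<sigma> powr (- 1 / 2 - m)"
    proof -
      have "T1 powr m * sqrt T1 = T1 powr (1 / 2 + m)"
        using T1 by (simp add: powr_half_sqrt[symmetric] powr_add[symmetric] add.commute)
      also have "\<dots> = (X powr 2) powr (1 / 2 + m) / \<sigma> powr (1 / 2 + m)"
        using basic \<sigma>0 by (simp add: T1_def powr_divide)
      also have "(X powr 2) powr (1 / 2 + m) = X powr (1 + 2 * m)" by (simp add: powr_powr algebra_simps)
      also have "X powr (1 + 2 * m) / \<sigma> powr (1 / 2 + m) = X powr (1 + 2 * m) * \<sigma> powr (- 1 / 2 - m)"
        using powr_minus_divide[of \<sigma> "1 / 2 + m"] by simp
      finally show ?thesis .
    qed
    have "2 * (C * T1 powr m * (X / 2) powr (- n * (1 - q))) * sqrt T1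
        = 2 * C * (T1 powr m * sqrt T1) * (X / 2) powr (- n * (1 - q))" by simp
    also have "\<dots> \<le> 2 * C * (X powr (1 + 2 * m) * \<sigma> powr (- 1 / 2 - m)) * (X powr (- n * (1 - q)) * 2 ^ (d + 1))"
      unfolding b using C a by (intro mult_left_mono) auto
    also have "\<dots> = C * 2 ^ (d + 2) * (X powr (1 + 2 * m) * X powr (- n * (1 - q))) * \<sigma> powr (- 1 / 2 - m)"
      by simp
    also have "X powr (1 + 2 * m) * X powr (- n * (1 - q)) = X powr (n * q + (2 - real d))"
      by (simp add: powr_add[symmetric] n algebra_simps)
    also have "\<dots> \<le> X powr (E * q + (2 - real d))"
      using n q by (intro X_powr_mono) (simp add: mult_right_mono)
    also have "X powr (E * q + (2 - real d)) = X powr (E * q) * X powr (2 - real d)" by (rule powr_add)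
    finally show "2 * (C * T1 powr m * (X / 2) powr (- n * (1 - q))) * sqrt T1 \<le>
        C * 2 ^ (d + 2) * X powr (E * q) * X powr (2 - real d) * \<sigma> powr (- 1 / 2 - m)"
      using C by (simp add: mult.assoc mult_left_mono mult_right_mono)
  qed
  finally show ?thesis by (simp add: T1_def)
qed

text \<open>Once the drift has overshot the point by a factor 2, \<open>D >= h * t / 2\<close>, and
  the far bound decays like \<open>t powr (- 1 - d/2 + 2 * q)\<close>, integrable in every
  dimension. The assumption \<open>cond\<close> is the restriction
  \<open>t <= D powr (2 - 2 * q)\<close> at \<open>t = T2\<close> with \<open>D\<close> replaced by
  \<open>h * t / 2\<close>; it persists because \<open>1 - 2 * q\<close> is positive.\<close>

lemma far_tail:
  assumes hp: "h > 0" and T2: "T2 \<ge> 1" "h * T2 \<ge> 2 * X" and cond: "T2 powr (1 - 2 * q) * (h / 2) powr (2 - 2 * q) \<ge> 1"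
  shows "upint \<phi> {T2..} \<le> ennreal (4 * C * (h / 2) powr (- (2 - 2 * q)) * T2 powr (- (real d / 2 - 2 * q)))"
proof -
  define p where "p = 1 + real d / 2 - 2 * q"
  have p: "p > 1" "p - 1 \<ge> 1 / 4" using basic by (auto simp: p_def)
  have bd: "\<phi> t \<le> C * (h / 2) powr (- (2 - 2 * q)) * t powr (- p)" if t: "t \<in> {T2..}" for t
  proof -
    define D where "D = \<bar>X - h * t\<bar>"
    have t1: "t \<ge> 1" "T2 \<le> t" using t T2 by auto
    have "h * T2 \<le> h * t" using t hp by (intro mult_left_mono) auto
    then have ht: "h * t \<ge> 2 * X" using T2 by linarith
    then have D: "D \<ge> h * t / 2" unfolding D_def by linarith
    have ht1: "h * t / 2 \<ge> 1" using ht basic by linarith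
    have "t = t * 1" by simp
    also have "\<dots> \<le> t * (t powr (1 - 2 * q) * (h / 2) powr (2 - 2 * q))"
    proof (intro mult_left_mono order_trans[OF cond] mult_right_mono powr_mono2)
    qed (use t1 T2 basic in auto)
    also have "\<dots> = t powr (1 + (1 - 2 * q)) * (h / 2) powr (2 - 2 * q)"
      unfolding powr_add using t1 by simp
    also have "\<dots> = (h * t / 2) powr (2 - 2 * q)"
      using hp t1 by (simp add: powr_mult powr_divide)
    also have "\<dots> \<le> D powr (2 - 2 * q)" using D ht1 basic by (intro powr_mono2) auto
    finally have tD: "t \<le> D powr (2 - 2 * q)" .
    have "\<phi> t \<le> C * max 1 t powr (1 - real d / 2) * D powr (- 2 * (1 - q))"
      using F2[of t] t1 D ht1 tD by (simp add: D_def)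
    also have "\<dots> \<le> C * t powr (1 - real d / 2) * (h * t / 2) powr (- (2 - 2 * q))"
    proof -
      have "max 1 t = t" using t1 by simp
      moreover have "D powr (- 2 * (1 - q)) \<le> (h * t / 2) powr (- 2 * (1 - q))"
        using D ht1 basic(7) by (intro powr_mono2') auto
      ultimately show ?thesis using C by (simp add: mult_left_mono)
    qed
    also have "(h * t / 2) powr (- (2 - 2 * q)) = (h / 2) powr (- (2 - 2 * q)) * t powr (- (2 - 2 * q))"
      using powr_mult[of "h / 2" t "- (2 - 2 * q)"] by simp
    also have "C * t powr (1 - real d / 2) * ((h / 2) powr (- (2 - 2 * q)) * t powr (- (2 - 2 * q)))
       = C * (h / 2) powr (- (2 - 2 * q)) * (t powr (1 - real d / 2) * t powr (- (2 - 2 * q)))" by simp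
    also have "t powr (1 - real d / 2) * t powr (- (2 - 2 * q)) = t powr (- p)"
      by (simp add: powr_add[symmetric] p_def algebra_simps)
    finally show ?thesis .
  qed
  have "upint \<phi> {T2..} \<le> upint (\<lambda>t. C * (h / 2) powr (- (2 - 2 * q)) * t powr (- p)) {T2..}"
    by (rule upint_mono[OF bd]) auto
  also have "\<dots> = ennreal (C * (h / 2) powr (- (2 - 2 * q)) * T2 powr (1 - p) / (p - 1))"
    using C T2 p by (intro upint_powr_tail) auto
  also have "\<dots> \<le> ennreal (C * (h / 2) powr (- (2 - 2 * q)) * T2 powr (1 - p) / (1 / 4))"
    using C p by (intro ennreal_leI divide_left_mono) auto
  also have "1 - p = - (real d / 2 - 2 * q)" by (simp add: p_def)
  finally show ?thesis by (simp add: mult_ac)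
qed

text \<open>At the passage time \<open>ts = X / h\<close> this is the height
  \<open>ts powr (- d/2)\<close> of the density times its duration
  \<open>ts * s powr (- 1/2)\<close>. For large \<open>s\<close> it is comparable to
  \<open>T\<close> but easier to handle.\<close>

definition "U = X powr (2 - real d) * s powr ((real d - 3) / 2)"

text \<open>Under a strong drift the mass passes \<open>X\<close> around the time
  \<open>ts = X / h\<close>, during a fraction \<open>s powr (- 1/2)\<close> of that time. This
  fraction is at most \<open>X powr (- 4 * E * q)\<close>, which pays for the losses at early and
  late times. Around \<open>ts\<close> itself the gain \<open>X powr (- e1)\<close> of the local
  limit error pays.\<close>

lemma drift_regime:
  assumes sB: "s \<ge> X powr (8 * E * q)"
  shows "upint \<phi> {0<..} \<le> ennreal (2 ^ (d + 6) * (1 + M) * C * T * X powr (- q))"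
proof -
  have Eq: "E * q \<ge> 2 * q" using basic q by (intro mult_right_mono) auto
  have s8: "s \<ge> 8" using X_powr_ge_8[of "8 * E * q"] Eq q sB by simp
  have "h \<noteq> 0"
  proof
    assume "h = 0"
    then have "X * h = 0" by simp
    with s8 show False unfolding s_def by linarith
  qed
  then have hp: "h > 0" using h by simp
  define ts where "ts = X / h"
  have ts: "ts > 0" "h * ts = X" using hp basic by (auto simp: ts_def)
  have ts2: "ts = X\<^sup>2 / s" using hp basic by (simp add: ts_def s_def power2_eq_square)
  have tsM: "ts \<ge> X / M" unfolding ts_def using h hp basic by (intro divide_left_mono) auto
  have "X / M \<ge> 2" using X M by (simp add: field_simps)
  then have ts_ge: "ts \<ge> 2" using tsM by linarith
  have s_half: "s powr (- 1 / 2) \<le> X powr (- 4 * E * q)"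
  proof -
    have "s powr (- 1 / 2) \<le> (X powr (8 * E * q)) powr (- 1 / 2)"
      using sB basic by (intro powr_mono2') auto
    then show ?thesis by (simp add: powr_powr mult_ac)
  qed
  have tsU: "ts powr (1 - real d / 2) * s powr (- 1 / 2) = U"
  proof -
    have "ts powr (1 - real d / 2) = (X powr 2) powr (1 - real d / 2) / s powr (1 - real d / 2)"
      unfolding ts2 using basic s8 by (simp add: powr_divide)
    also have "\<dots> = X powr (2 * (1 - real d / 2)) * s powr (- (1 - real d / 2))"
      by (simp only: powr_powr powr_minus divide_inverse)
    also have "2 * (1 - real d / 2) = 2 - real d" by simp
    finally have "ts powr (1 - real d / 2) * s powr (- 1 / 2) = X powr (2 - real d) * (s powr (- (1 - real d / 2)) * s powr (- 1 / 2))"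
      by simp
    also have "s powr (- (1 - real d / 2)) * s powr (- 1 / 2) = s powr ((real d - 3) / 2)"
      by (simp add: powr_add[symmetric] field_simps)
    finally show ?thesis by (simp add: U_def)
  qed
  have UT: "U \<le> 2 * T"
  proof -
    have "s powr ((real d - 3) / 2) \<le> 2 * S powr ((real d - 3) / 2)"
    proof (cases "d \<ge> 3")
      case True
      then have "s powr ((real d - 3) / 2) \<le> S powr ((real d - 3) / 2)"
        using basic by (intro powr_mono2) (auto simp: S_def)
      then show ?thesis using powr_ge_zero[of S "(real d - 3) / 2"] by linarith
    next
      case False
      have "s powr ((real d - 3) / 2) \<le> (S / 2) powr ((real d - 3) / 2)"
        using False basic s8 by (intro powr_mono2') (auto simp: S_def)
      also have "\<dots> = S powr ((real d - 3) / 2) * 2 powr (- ((real d - 3) / 2))"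
        using powr_half_minus[of S "- ((real d - 3) / 2)"] by simp
      also have "\<dots> \<le> S powr ((real d - 3) / 2) * 2 powr 1"
        using basic by (intro mult_left_mono powr_mono) auto
      finally show ?thesis by simp
    qed
    then have "X powr (2 - real d) * s powr ((real d - 3) / 2) \<le> X powr (2 - real d) * (2 * S powr ((real d - 3) / 2))"
      by (intro mult_left_mono) auto
    then show ?thesis by (simp add: U_def T_def)
  qed
  have U0: "U \<ge> 0" by (simp add: U_def)
  define W where "W = T * X powr (- q)"
  have W: "W \<ge> 0" using basic by (simp add: W_def)
  have UW: "U * X powr (- q) \<le> 2 * W"
    using mult_right_mono[OF UT, of "X powr (- q)"] by (simp add: W_def)
  \<comment> \<open>\<open>small_time\<close> is used with \<open>\<sigma> = 2 * s\<close>, because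
    \<open>X^2 / (2 * s)\<close> is half the passage time.\<close>
  have B1: "upint \<phi> {0<..ts / 2} \<le> ennreal (2 ^ (d + 2) * C * W)"
  proof -
    have "2 * s \<le> X\<^sup>2" using X h basic mult_left_mono[of "2 * h" X X] by (simp add: s_def power2_eq_square)
    moreover have "4 * X powr (2 * q) \<le> 2 * s"
    proof -
      have "2 * X powr (2 * q) \<le> X powr (8 * E * q - 2 * q) * X powr (2 * q)"
        using X_powr_ge_8[of "8 * E * q - 2 * q"] Eq q by (intro mult_right_mono) auto
      also have "\<dots> = X powr (8 * E * q)" by (simp add: powr_add[symmetric])
      finally show ?thesis using sB by linarith
    qed
    ultimately have "upint \<phi> {0<..X\<^sup>2 / (2 * s)} \<le> ennreal (C * 2 ^ (d + 2) * X powr (E * q) * X powr (2 - real d) * (2 * s) powr (- 1 / 2 - m))"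
      by (intro small_time) auto
    also have "\<dots> \<le> ennreal (2 ^ (d + 2) * C * W)"
    proof (rule ennreal_leI)
      have "(2 * s) powr (- 1 / 2 - m) = (2 * s) powr (- 1 / 2) * (2 * s) powr (- m)"
        by (simp only: powr_add[symmetric]) simp
      also have "\<dots> \<le> s powr (- 1 / 2) * S powr (- m)"
        using s8 m basic by (intro mult_mono powr_mono2') (auto simp: S_def)
      also have "\<dots> \<le> X powr (- 4 * E * q) * S powr ((real d - 3) / 2)"
        by (intro mult_mono s_half S_powr_ge) auto
      finally have "C * 2 ^ (d + 2) * X powr (E * q) * X powr (2 - real d) * (2 * s) powr (- 1 / 2 - m)
         \<le> C * 2 ^ (d + 2) * X powr (E * q) * X powr (2 - real d) * (X powr (- 4 * E * q) * S powr ((real d - 3) / 2))"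
        using C by (intro mult_left_mono) auto
      also have "\<dots> = 2 ^ (d + 2) * C * T * (X powr (E * q) * X powr (- 4 * E * q))"
        by (simp add: T_def)
      also have "X powr (E * q) * X powr (- 4 * E * q) = X powr (- 3 * (E * q))"
        by (simp only: powr_add[symmetric]) (simp add: algebra_simps)
      also have "2 ^ (d + 2) * C * T * X powr (- 3 * (E * q)) \<le> 2 ^ (d + 2) * C * T * X powr (- q)"
        using C basic Eq q by (intro mult_left_mono X_powr_mono) auto
      finally show "C * 2 ^ (d + 2) * X powr (E * q) * X powr (2 - real d) * (2 * s) powr (- 1 / 2 - m) \<le> 2 ^ (d + 2) * C * W"
        by (simp add: W_def mult_ac)
    qed
    finally show ?thesis by (simp add: ts2 mult.commute)
  qed
  \<comment> \<open>\<open>ts * s powr (- 1/2)\<close> is the time in which the drift covers the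
    distance \<open>sqrt ts\<close>. The margin \<open>X powr (3 * q)\<close> makes the far bound
    applicable beyond the window and is also the source of its gain there.\<close>
  define L where "L = ts * s powr (- 1 / 2) * X powr (3 * q)"
  have L0: "L > 0" using ts s8 basic by (simp add: L_def)
  have L_le: "L \<le> ts / 2"
  proof -
    have "s powr (- 1 / 2) * X powr (3 * q) \<le> X powr (- 4 * E * q) * X powr (3 * q)"
      by (intro mult_right_mono s_half) auto
    also have "\<dots> = X powr (- (4 * (E * q) - 3 * q))" by (simp add: powr_add[symmetric] algebra_simps)
    also have "\<dots> \<le> X powr (- q)" using Eq q by (intro X_powr_mono) auto
    also have "\<dots> = 1 / X powr q" by (rule powr_minus_divide)
    also have "\<dots> \<le> 1 / 8" using X by (intro divide_left_mono) auto
    finally have "ts * (s powr (- 1 / 2) * X powr (3 * q)) \<le> ts * (1 / 8)" using ts by (intro mult_left_mono) auto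
    then show ?thesis using ts by (simp add: L_def)
  qed
  have B2: "upint \<phi> {ts - L..ts + L} \<le> ennreal (2 ^ (d + 3) * (1 + M) * C * W)"
  proof -
    define c where "c = C * (ts / 2) powr (- real d / 2 - e1)"
    have e1p: "e1 > 0" using d_e1 basic q by simp
    have "upint \<phi> {ts - L..ts + L} \<le> upint (\<lambda>_. c) {ts - L..ts + L}"
    proof (rule upint_mono)
      fix t assume "t \<in> {ts - L..ts + L}"
      then have t: "t \<ge> ts / 2" using L_le by auto
      then have "\<phi> t \<le> C * t powr (- real d / 2 - e1)" using ts by (intro F1) auto
      also have "\<dots> \<le> c" unfolding c_def using C t ts e1p basic by (intro mult_left_mono powr_mono2') auto
      finally show "\<phi> t \<le> c" .
    qed auto
    also have "\<dots> = ennreal (c * ((ts + L) - (ts - L)))" using C L0 by (intro upint_const) (auto simp: c_def)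
    also have "\<dots> \<le> ennreal (2 ^ (d + 3) * (1 + M) * C * W)"
    proof (rule ennreal_leI)
      have "(ts / 2) powr (- real d / 2 - e1) = ts powr (- real d / 2 - e1) * 2 powr (real d / 2 + e1)"
        using powr_minus_divide[of 2 "real d / 2 + e1"] ts by (simp add: powr_divide)
      also have "2 powr (real d / 2 + e1) \<le> 2 powr (real (d + 1))"
        using e1 by (intro powr_mono) auto
      also have "2 powr (real (d + 1)) = 2 ^ (d + 1)" by (rule powr_realpow) simp
      also have "ts powr (- real d / 2 - e1) = ts powr (- real d / 2) * ts powr (- e1)"
        by (simp add: powr_add[symmetric])
      also have "ts powr (- e1) \<le> (1 + M) * X powr (- e1)"
      proof -
        have "ts powr (- e1) \<le> (X / M) powr (- e1)" using tsM M basic e1p by (intro powr_mono2') auto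
        also have "\<dots> = X powr (- e1) / M powr (- e1)" by (rule powr_divide)
        also have "\<dots> = X powr (- e1) * M powr e1" by (simp add: powr_minus[of M] divide_inverse)
        also have "\<dots> \<le> X powr (- e1) * (1 + M)"
        proof (rule mult_left_mono)
          have "M powr e1 \<le> (1 + M) powr e1" using M e1p by (intro powr_mono2) auto
          also have "\<dots> \<le> (1 + M) powr 1" using M e1 by (intro powr_mono) auto
          finally show "M powr e1 \<le> 1 + M" using M by simp
        qed simp
        finally show ?thesis by (simp only: mult.commute)
      qed
      finally have "(ts / 2) powr (- real d / 2 - e1) \<le> ts powr (- real d / 2) * ((1 + M) * X powr (- e1)) * 2 ^ (d + 1)"
        by (simp add: mult_left_mono mult_right_mono)
      then have "c * ((ts + L) - (ts - L)) \<le> C * (ts powr (- real d / 2) * ((1 + M) * X powr (- e1)) * 2 ^ (d + 1)) * (2 * L)"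
        unfolding c_def using C L0 M by (intro mult_mono mult_left_mono) (auto intro!: mult_nonneg_nonneg)
      also have "\<dots> = 2 ^ (d + 2) * (1 + M) * C * ((ts powr (- real d / 2) * ts) * s powr (- 1 / 2)) * (X powr (- e1) * X powr (3 * q))"
        by (simp add: L_def)
      also have "ts powr (- real d / 2) * ts = ts powr (1 - real d / 2)"
        using ts powr_add[of ts "- real d / 2" 1] by (simp add: add.commute)
      also have "ts powr (1 - real d / 2) * s powr (- 1 / 2) = U" by (rule tsU)
      also have "X powr (- e1) * X powr (3 * q) = X powr (3 * q - e1)" by (simp add: powr_add[symmetric])
      also have "2 ^ (d + 2) * (1 + M) * C * U * X powr (3 * q - e1) \<le> 2 ^ (d + 2) * (1 + M) * C * U * X powr (- q)"
        using C M U0 d_e1 q by (intro mult_left_mono X_powr_mono) auto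
      also have "\<dots> = 2 ^ (d + 2) * (1 + M) * C * (U * X powr (- q))" by simp
      also have "\<dots> \<le> 2 ^ (d + 2) * (1 + M) * C * (2 * W)" using C M by (intro mult_left_mono UW) auto
      finally show "c * ((ts + L) - (ts - L)) \<le> 2 ^ (d + 3) * (1 + M) * C * W"
        by (simp add: power_add mult_ac)
    qed
    finally show ?thesis .
  qed
  have hL: "h * L = ts powr (1 / 2) * X powr (3 * q)"
  proof -
    have "X * s powr (- 1 / 2) = ts powr (1 / 2)"
    proof -
      have "ts powr (1 / 2) = (X\<^sup>2) powr (1 / 2) / s powr (1 / 2)" unfolding ts2 by (rule powr_divide)
      also have "(X\<^sup>2) powr (1 / 2) = X" using basic by (simp add: powr_half_sqrt)
      finally show ?thesis using powr_minus_divide[of s "1 / 2"] by simp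
    qed
    then show ?thesis using ts by (simp add: L_def mult.assoc[symmetric])
  qed
  have hLX: "h * L \<le> X" using mult_left_mono[OF L_le, of h] hp ts basic by simp
  define Out where "Out = {t. ts / 2 \<le> t \<and> t \<le> 2 * ts \<and> \<bar>t - ts\<bar> \<ge> L}"
  have B3: "upint \<phi> Out \<le> ennreal (2 ^ (d + 3) * C * W)"
  proof -
    define c where "c = C * (2 ^ d * ts powr (1 - real d / 2)) * h powr (- (2 - 2 * q))"
    have c0: "c \<ge> 0" using C by (simp add: c_def)
    have bd: "\<phi> t \<le> c * \<bar>t - ts\<bar> powr (- (2 - 2 * q))" if "t \<in> Out" for t
    proof -
      from that have t: "ts / 2 \<le> t" "t \<le> 2 * ts" "\<bar>t - ts\<bar> \<ge> L" by (auto simp: Out_def)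
      have t1: "t \<ge> 1" using t ts_ge by linarith
      define D where "D = \<bar>X - h * t\<bar>"
      have D: "D = h * \<bar>t - ts\<bar>"
      proof -
        have "X - h * t = h * (ts - t)" using ts by (simp add: algebra_simps)
        then show ?thesis using hp by (simp add: D_def abs_mult abs_minus_commute)
      qed
      have DL: "D \<ge> ts powr (1 / 2) * X powr (3 * q)"
        unfolding D hL[symmetric] using t hp by (intro mult_left_mono) auto
      have "1 * 1 \<le> ts powr (1 / 2) * X powr (3 * q)"
        using ts_ge basic q by (intro mult_mono ge_one_powr_ge_zero) auto
      then have D1: "D \<ge> 1" using DL by linarith
      have DX: "D \<le> X"
      proof -
        have "\<bar>t - ts\<bar> \<le> ts" using t by (simp add: abs_le_iff)
        then have "h * \<bar>t - ts\<bar> \<le> h * ts" using hp by (intro mult_left_mono) auto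
        then show ?thesis using ts D by simp
      qed
      \<comment> \<open>From \<open>D^2 >= ts * X^(6 q)\<close> and \<open>D <= X\<close> one gets
        \<open>D^(2 - 2 q) >= ts * X^(4 q)\<close>, where \<open>X^(4 q) >= 8\<close> covers
        \<open>t <= 2 * ts\<close>.\<close>
      have "t \<le> D powr (2 - 2 * q)"
      proof -
        have "t \<le> ts * 8" using t ts by linarith
        also have "\<dots> \<le> ts * X powr (4 * q)" using X_powr_ge_8[of "4 * q"] q ts by (intro mult_left_mono) auto
        also have "\<dots> = (ts powr (1 / 2) * X powr (3 * q)) powr 2 * X powr (- 2 * q)"
        proof -
          have "(ts powr (1 / 2) * X powr (3 * q)) powr 2 = ts * X powr (6 * q)"
            using ts by (subst powr_mult) (simp add: powr_powr)
          then show ?thesis by (simp add: powr_add[symmetric])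
        qed
        also have "\<dots> \<le> D powr 2 * D powr (- 2 * q)"
          using DL D1 DX q by (intro mult_mono powr_mono2 powr_mono2') auto
        also have "\<dots> = D powr (2 - 2 * q)" by (simp add: powr_add[symmetric])
        finally show ?thesis .
      qed
      then have "\<phi> t \<le> C * max 1 t powr (1 - real d / 2) * D powr (- 2 * (1 - q))"
        using F2[of t] t1 D1 by (simp add: D_def)
      also have "\<dots> \<le> C * (2 ^ d * ts powr (1 - real d / 2)) * D powr (- 2 * (1 - q))"
      proof (intro mult_right_mono mult_left_mono)
        have mt: "max 1 t = t" using t1 by simp
        show "max 1 t powr (1 - real d / 2) \<le> 2 ^ d * ts powr (1 - real d / 2)"
        proof (cases "d \<le> 2")
          case True
          have "max 1 t powr (1 - real d / 2) \<le> (2 * ts) powr (1 - real d / 2)"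
            unfolding mt using t t1 True by (intro powr_mono2) auto
          also have "\<dots> = 2 powr (1 - real d / 2) * ts powr (1 - real d / 2)" by (rule powr_mult)
          also have "2 powr (1 - real d / 2) \<le> 2 powr (real d)" using basic by (intro powr_mono) auto
          finally show ?thesis by (simp add: powr_realpow mult_right_mono)
        next
          case False
          have "max 1 t powr (1 - real d / 2) \<le> (ts / 2) powr (1 - real d / 2)"
            unfolding mt using t t1 False ts by (intro powr_mono2') auto
          also have "\<dots> = 2 powr (- (1 - real d / 2)) * ts powr (1 - real d / 2)"
            using powr_divide[of ts 2 "1 - real d / 2"] powr_minus_divide[of 2 "1 - real d / 2"] ts by simp
          also have "2 powr (- (1 - real d / 2)) \<le> 2 powr (real d)" using basic by (intro powr_mono) auto
          finally show ?thesis by (simp add: powr_realpow mult_right_mono)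
        qed
      qed (use C in auto)
      also have "D powr (- 2 * (1 - q)) = h powr (- (2 - 2 * q)) * \<bar>t - ts\<bar> powr (- (2 - 2 * q))"
        unfolding D using powr_mult[of h "\<bar>t - ts\<bar>" "- (2 - 2 * q)"] by (simp add: algebra_simps)
      finally show ?thesis by (simp add: c_def mult.assoc)
    qed
    have "upint \<phi> Out \<le> upint (\<lambda>t. c * \<bar>t - ts\<bar> powr (- (2 - 2 * q))) {t. \<bar>t - ts\<bar> \<ge> L}"
      by (rule upint_mono[OF bd]) (auto simp: Out_def)
    also have "\<dots> \<le> ennreal (2 * (c * L powr (1 - (2 - 2 * q)) / ((2 - 2 * q) - 1)))"
      using c0 L0 basic by (intro upint_powr_centered) auto
    also have "\<dots> \<le> ennreal (2 ^ (d + 3) * C * W)"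
    proof (rule ennreal_leI)
      have "c * L powr (1 - (2 - 2 * q)) / ((2 - 2 * q) - 1) \<le> c * L powr (1 - (2 - 2 * q)) / (1 / 2)"
        using c0 basic by (intro divide_left_mono) auto
      then have 1: "2 * (c * L powr (1 - (2 - 2 * q)) / ((2 - 2 * q) - 1)) \<le> 4 * c * L powr (- 1 + 2 * q)" by simp
      have "- (2 - 2 * q) = - 1 + (- 1 + 2 * q)" by simp
      then have "h powr (- (2 - 2 * q)) = h powr (- 1) * h powr (- 1 + 2 * q)" by (simp only: powr_add)
      then have hl: "h powr (- (2 - 2 * q)) * L powr (- 1 + 2 * q) = h powr (- 1) * (h * L) powr (- 1 + 2 * q)"
        by (simp only: powr_mult mult.assoc)
      \<comment> \<open>\<open>(h * L) powr (- 1)\<close> carries \<open>X powr (- 3 * q)\<close>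
        from the width of the window, while \<open>(h * L) powr (2 * q)\<close> loses at most
        \<open>X powr (2 * q)\<close>; the difference is the gain
        \<open>X powr (- q)\<close>.\<close>
      have "(h * L) powr (- 1 + 2 * q) = (h * L) powr (- 1) * (h * L) powr (2 * q)" by (rule powr_add)
      also have "\<dots> \<le> (h * L) powr (- 1) * X powr (2 * q)"
        using hLX hp L0 q by (intro mult_left_mono powr_mono2) auto
      also have "(h * L) powr (- 1) = ts powr (- 1 / 2) * X powr (- (3 * q))"
        unfolding hL by (simp only: powr_mult powr_powr) simp
      finally have 2: "h powr (- (2 - 2 * q)) * L powr (- 1 + 2 * q) \<le> h powr (- 1) * (ts powr (- 1 / 2) * X powr (- (3 * q)) * X powr (2 * q))"
        unfolding hl by (intro mult_left_mono) auto
      have 3: "h powr (- 1) * ts powr (- 1 / 2) = s powr (- 1 / 2)"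
      proof -
        have "ts powr (- 1 / 2) = s powr (1 / 2) / X"
        proof -
          have "ts powr (1 / 2) = (X\<^sup>2) powr (1 / 2) / s powr (1 / 2)" unfolding ts2 by (rule powr_divide)
          also have "(X\<^sup>2) powr (1 / 2) = X" using basic by (simp add: powr_half_sqrt)
          finally show ?thesis using powr_minus_divide[of ts "1 / 2"] by simp
        qed
        also have "h powr (- 1) * (s powr (1 / 2) / X) = s powr (1 / 2) / s"
          using hp basic by (simp add: s_def powr_minus_divide mult.commute)
        also have "\<dots> = s powr (1 / 2 - 1)" using s8 powr_diff[of s "1 / 2" 1] by simp
        finally show ?thesis by simp
      qed
      have "4 * c * L powr (- 1 + 2 * q) = 4 * C * 2 ^ d * ts powr (1 - real d / 2) * (h powr (- (2 - 2 * q)) * L powr (- 1 + 2 * q))"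
        by (simp add: c_def)
      also have "\<dots> \<le> 4 * C * 2 ^ d * ts powr (1 - real d / 2) * (h powr (- 1) * (ts powr (- 1 / 2) * X powr (- (3 * q)) * X powr (2 * q)))"
        using C by (intro mult_left_mono 2) auto
      also have "\<dots> = 4 * C * 2 ^ d * (ts powr (1 - real d / 2) * (h powr (- 1) * ts powr (- 1 / 2))) * (X powr (- (3 * q)) * X powr (2 * q))"
        by (simp only: mult_ac)
      also have "\<dots> = 4 * C * 2 ^ d * (U * X powr (- q))"
        unfolding 3 tsU by (simp add: powr_add[symmetric])
      also have "\<dots> \<le> 4 * C * 2 ^ d * (2 * W)" using C by (intro mult_left_mono UW) auto
      finally show "2 * (c * L powr (1 - (2 - 2 * q)) / ((2 - 2 * q) - 1)) \<le> 2 ^ (d + 3) * C * W" using 1 by (simp add: power_add mult_ac)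
    qed
    finally show ?thesis .
  qed
  \<comment> \<open>Compared with \<open>U\<close> there is a spare factor
    \<open>s powr (- 1/2)\<close>, which outweighs the loss \<open>X powr (2 * q)\<close> of the far
    bound.\<close>
  have B4: "upint \<phi> {2 * ts..} \<le> ennreal (32 * C * W)"
  proof -
    have c: "(2 * ts) powr (1 - 2 * q) * (h / 2) powr (2 - 2 * q) \<ge> 1"
    proof -
      have "(h / 2) powr (2 - 2 * q) = (h / 2) powr (1 - 2 * q) * (h / 2)"
        using hp powr_add[of "h / 2" "1 - 2 * q" 1] by simp
      then have "(2 * ts) powr (1 - 2 * q) * (h / 2) powr (2 - 2 * q) = (2 * ts * (h / 2)) powr (1 - 2 * q) * (h / 2)"
        unfolding powr_mult by simp
      also have "2 * ts * (h / 2) = X" using ts by (simp add: mult.commute)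
      also have "X powr (1 - 2 * q) * (h / 2) = s / 2 * X powr (- 2 * q)"
        using basic powr_add[of X 1 "- 2 * q"] by (simp add: s_def)
      also have "\<dots> \<ge> X powr (8 * E * q) / 2 * X powr (- 2 * q)"
        using sB by (intro mult_right_mono) auto
      finally have "(2 * ts) powr (1 - 2 * q) * (h / 2) powr (2 - 2 * q) \<ge> X powr (8 * E * q - 2 * q) / 2"
        by (simp add: powr_add[symmetric])
      then show ?thesis using X_powr_ge_8[of "8 * E * q - 2 * q"] Eq q by simp
    qed
    have "upint \<phi> {2 * ts..} \<le> ennreal (4 * C * (h / 2) powr (- (2 - 2 * q)) * (2 * ts) powr (- (real d / 2 - 2 * q)))"
      by (rule far_tail[OF hp _ _ c]) (use ts ts_ge in auto)
    also have "\<dots> \<le> ennreal (32 * C * W)"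
    proof (rule ennreal_leI)
      have e1: "(h / 2) powr (- (2 - 2 * q)) = (h / 2) powr (2 * q) * (h / 2) powr (- 2)"
        by (simp add: powr_add[symmetric])
      have e2: "(2 * ts) powr (- (real d / 2 - 2 * q)) = (2 * ts) powr (2 * q) * (2 * ts) powr (- real d / 2)"
        by (simp add: powr_add[symmetric])
      have e3: "(h / 2) powr (2 * q) * (2 * ts) powr (2 * q) = X powr (2 * q)"
        using ts by (simp add: powr_mult[symmetric] mult.commute)
      have e4: "(h / 2) powr (- 2) = 4 * ts * s powr (- 1)"
        using hp basic by (simp add: powr_minus ts_def s_def power2_eq_square field_simps)
      have "(h / 2) powr (- (2 - 2 * q)) * (2 * ts) powr (- (real d / 2 - 2 * q))
          = ((h / 2) powr (2 * q) * (2 * ts) powr (2 * q)) * (h / 2) powr (- 2) * (2 * ts) powr (- real d / 2)"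
        unfolding e1 e2 by simp
      also have "\<dots> = 4 * X powr (2 * q) * (ts * (2 * ts) powr (- real d / 2)) * s powr (- 1)"
        unfolding e3 e4 by simp
      also have "\<dots> \<le> 4 * X powr (2 * q) * (ts * ts powr (- real d / 2)) * s powr (- 1)"
        using ts by (intro mult_right_mono mult_left_mono powr_mono2') auto
      also have "ts * ts powr (- real d / 2) = ts powr (1 - real d / 2)"
        using ts powr_add[of ts 1 "- real d / 2"] by simp
      also have "s powr (- 1) = s powr (- 1 / 2) * s powr (- 1 / 2)" by (simp add: powr_add[symmetric])
      also have "4 * X powr (2 * q) * ts powr (1 - real d / 2) * (s powr (- 1 / 2) * s powr (- 1 / 2)) = 4 * X powr (2 * q) * U * s powr (- 1 / 2)"
        unfolding tsU[symmetric] by simp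
      also have "\<dots> \<le> 4 * X powr (2 * q) * U * X powr (- 4 * E * q)" using U0 by (intro mult_left_mono s_half) auto
      also have "\<dots> = 4 * U * X powr (2 * q - 4 * E * q)" by (simp add: powr_add[symmetric])
      also have "\<dots> \<le> 4 * U * X powr (- q)" using U0 Eq q by (intro mult_left_mono X_powr_mono) auto
      also have "\<dots> \<le> 8 * W" using UW by (simp add: mult.commute)
      finally have "4 * C * ((h / 2) powr (- (2 - 2 * q)) * (2 * ts) powr (- (real d / 2 - 2 * q))) \<le> 4 * C * (8 * W)"
        using C by (intro mult_left_mono) auto
      then show "4 * C * (h / 2) powr (- (2 - 2 * q)) * (2 * ts) powr (- (real d / 2 - 2 * q)) \<le> 32 * C * W" by simp
    qed
    finally show ?thesis .
  qed
  have [measurable]: "Out \<in> sets borel" unfolding Out_def by measurable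
  have "upint \<phi> {0<..} \<le> upint \<phi> ({0<..ts / 2} \<union> ({ts - L..ts + L} \<union> (Out \<union> {2 * ts..})))"
    by (rule upint_mono) (auto simp: Out_def)
  also have "\<dots> \<le> upint \<phi> {0<..ts / 2} + (upint \<phi> {ts - L..ts + L} + (upint \<phi> Out + upint \<phi> {2 * ts..}))"
    by (intro order_trans[OF upint_Un] add_mono order_refl) measurable
  also have "\<dots> \<le> ennreal (2 ^ (d + 2) * C * W) + (ennreal (2 ^ (d + 3) * (1 + M) * C * W) + (ennreal (2 ^ (d + 3) * C * W) + ennreal (32 * C * W)))"
    by (intro add_mono B1 B2 B3 B4)
  also have "\<dots> = ennreal (2 ^ (d + 2) * C * W + (2 ^ (d + 3) * (1 + M) * C * W + (2 ^ (d + 3) * C * W + 32 * C * W)))"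
    using C M W by simp
  also have "\<dots> \<le> ennreal (2 ^ (d + 6) * (1 + M) * C * W)"
  proof (rule ennreal_leI)
    have d2: "(2::real) ^ d \<ge> 2" using power_increasing[OF d, of "2::real"] by simp
    have "2 ^ (d + 2) + (2 ^ (d + 3) * (1 + M) + (2 ^ (d + 3) + 32)) \<le> 2 ^ (d + 6) * (1 + M)"
    proof -
      have "M * 2 ^ d \<ge> 0" using M by simp
      then show ?thesis using d2 by (simp add: power_add algebra_simps)
    qed
    from mult_right_mono[OF this, of "C * W"]
    show "2 ^ (d + 2) * C * W + (2 ^ (d + 3) * (1 + M) * C * W + (2 ^ (d + 3) * C * W + 32 * C * W)) \<le> 2 ^ (d + 6) * (1 + M) * C * W"
      using C W by (simp add: algebra_simps)
  qed
  finally show ?thesis by (simp add: W_def mult.assoc)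
qed

text \<open>Here \<open>S\<close> is at most a small power of \<open>X\<close>, so by
  \<open>XT\<close> the target \<open>T\<close> differs from \<open>X powr (2 - d)\<close> by at
  most the factor \<open>2 * X powr (8 * r)\<close> in the harmful direction. The essential times
  are those near \<open>X^2\<close>, on the logarithmic scale. They are separated from the others by
  small powers of \<open>X\<close>, and \<open>XW\<close> collects the condition on exponents that
  each range must meet.\<close>

lemma balanced_regime:
  assumes sA: "s \<le> X powr (8 * E * q)"
  shows "upint \<phi> {0<..} \<le> ennreal ((2 ^ (d + 4) + 8 * (max 1 (2 / s0))\<^sup>2) * C * T * X powr (- q))"
proof -
  define r where "r = E * q"
  define k where "k = max 1 (2 / s0)"
  have k: "k \<ge> 1" "k \<ge> 2 / s0" "X powr q \<ge> k\<^sup>2" using X by (auto simp: k_def)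
  have r: "2 * q \<le> r" "r \<le> 1 / 400" using basic q by (auto simp: r_def intro!: mult_right_mono)
  have sA: "s \<le> X powr (8 * r)" using sA by (simp add: r_def mult.assoc)
  define W where "W = T * X powr (- q)"
  have W: "W \<ge> 0" using basic by (simp add: W_def)
  have XT: "X powr (2 - real d) \<le> 2 * X powr (8 * r) * T"
  proof -
    have X1: "1 \<le> X powr (8 * r)" using basic r q by (intro ge_one_powr_ge_zero) auto
    then have S2: "S \<le> 2 * X powr (8 * r)" using sA by (simp add: S_def)
    have "1 = S * S powr (- 1)" using basic by (simp add: powr_minus)
    also have "S powr (- 1) \<le> S powr ((real d - 3) / 2)" using basic by (intro powr_mono) auto
    finally have "1 \<le> S * S powr ((real d - 3) / 2)" using basic by (simp add: mult_left_mono)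
    also have "\<dots> \<le> 2 * X powr (8 * r) * S powr ((real d - 3) / 2)" by (intro mult_right_mono S2) auto
    finally have "X powr (2 - real d) * 1 \<le> X powr (2 - real d) * (2 * X powr (8 * r) * S powr ((real d - 3) / 2))"
      by (intro mult_left_mono) auto
    then show ?thesis by (simp add: T_def mult_ac)
  qed
  have XW: "X powr (2 - real d) * X powr a \<le> 2 * W" if "a + 8 * r \<le> - q" for a
  proof -
    have "X powr (2 - real d) * X powr a \<le> 2 * X powr (8 * r) * T * X powr a"
      by (intro mult_right_mono XT) auto
    also have "\<dots> = 2 * T * X powr (a + 8 * r)" by (simp add: powr_add)
    also have "\<dots> \<le> 2 * T * X powr (- q)" using that basic by (intro mult_left_mono X_powr_mono) auto
    finally show ?thesis by (simp add: W_def)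
  qed
  \<comment> \<open>Before \<open>T1\<close>, \<open>small_time\<close> gains
    \<open>X^(-10 r)\<close> from \<open>\<sigma> = X^(20 r)\<close> and loses \<open>X^r\<close>,
    which leaves enough for the \<open>8 r\<close> of \<open>XT\<close>. After \<open>T2\<close> the
    decay in time gains at least \<open>X^(-16 r)\<close> up to smaller terms. In between, the gain
    \<open>2 * e1 = 200 * E^2 * q\<close> must cover the \<open>32 r\<close> of \<open>T2\<close>,
    about \<open>10 r (d + 2 e1)\<close> from \<open>T1\<close>, and \<open>8 r\<close>.\<close>
  define T1 where "T1 = X powr (2 - 20 * r)"
  define T2 where "T2 = X powr (2 + 32 * r)"
  have T12: "T1 \<ge> 1" "T1 \<le> T2"
    unfolding T1_def T2_def using basic r q by (auto intro!: ge_one_powr_ge_zero X_powr_mono)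
  have A1: "upint \<phi> {0<..T1} \<le> ennreal (2 ^ (d + 3) * C * W)"
  proof -
    define \<sigma> where "\<sigma> = X powr (20 * r)"
    have c1: "2 * s \<le> \<sigma>"
    proof -
      have "2 * X powr (8 * r) \<le> X powr (12 * r) * X powr (8 * r)"
        using X_powr_ge_8[of "12 * r"] r q by (intro mult_right_mono) auto
      then show ?thesis using sA by (simp add: \<sigma>_def powr_add[symmetric])
    qed
    have c2: "4 * X powr (2 * q) \<le> \<sigma>"
    proof -
      have "4 * X powr (2 * q) \<le> X powr (20 * r - 2 * q) * X powr (2 * q)"
        using X_powr_ge_8[of "20 * r - 2 * q"] r q by (intro mult_right_mono) auto
      then show ?thesis by (simp add: \<sigma>_def powr_add[symmetric])
    qed
    have c3: "\<sigma> \<le> X\<^sup>2"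
    proof -
      have "\<sigma> \<le> X powr 2" unfolding \<sigma>_def using r by (intro X_powr_mono) auto
      then show ?thesis using basic by simp
    qed
    have "T1 = X\<^sup>2 / \<sigma>" using basic by (simp add: T1_def \<sigma>_def powr_diff)
    then have "upint \<phi> {0<..T1} \<le> ennreal (C * 2 ^ (d + 2) * X powr (E * q) * X powr (2 - real d) * \<sigma> powr (- 1 / 2 - m))"
      using small_time[OF c1 c2 c3] by simp
    also have "\<dots> \<le> ennreal (2 ^ (d + 3) * C * W)"
    proof (rule ennreal_leI)
      have "\<sigma> powr (- 1 / 2 - m) = X powr (20 * r * (- 1 / 2 - m))" by (simp add: \<sigma>_def powr_powr)
      also have "\<dots> \<le> X powr (- 10 * r)"
      proof (rule X_powr_mono)
        have "0 \<le> 20 * r * m" using r q m by (intro mult_nonneg_nonneg) auto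
        then show "20 * r * (- 1 / 2 - m) \<le> - 10 * r" by (simp add: algebra_simps)
      qed
      finally have "C * 2 ^ (d + 2) * X powr (E * q) * X powr (2 - real d) * \<sigma> powr (- 1 / 2 - m)
         \<le> C * 2 ^ (d + 2) * X powr (E * q) * X powr (2 - real d) * X powr (- 10 * r)"
        using C by (intro mult_left_mono) auto
      also have "\<dots> = C * 2 ^ (d + 2) * (X powr (2 - real d) * X powr (- 9 * r))"
        by (simp add: r_def powr_add[symmetric] algebra_simps)
      also have "\<dots> \<le> C * 2 ^ (d + 2) * (2 * W)" using C r q by (intro mult_left_mono XW) auto
      finally show "C * 2 ^ (d + 2) * X powr (E * q) * X powr (2 - real d) * \<sigma> powr (- 1 / 2 - m) \<le> 2 ^ (d + 3) * C * W"
        by (simp add: power_add mult_ac)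
    qed
    finally show ?thesis .
  qed
  have A2: "upint \<phi> {T1..T2} \<le> ennreal (2 * C * W)"
  proof -
    define c where "c = C * T1 powr (- real d / 2 - e1)"
    have e1p: "e1 > 0" using d_e1 basic q by simp
    have "upint \<phi> {T1..T2} \<le> upint (\<lambda>_. c) {T1..T2}"
    proof (rule upint_mono)
      fix t assume "t \<in> {T1..T2}"
      then have t: "t \<ge> T1" by auto
      then have "\<phi> t \<le> C * t powr (- real d / 2 - e1)" using T12 by (intro F1) auto
      also have "\<dots> \<le> c" unfolding c_def using C t T12 e1p basic by (intro mult_left_mono powr_mono2') auto
      finally show "\<phi> t \<le> c" .
    qed auto
    also have "\<dots> = ennreal (c * (T2 - T1))" using C T12 by (intro upint_const) (auto simp: c_def)
    also have "\<dots> \<le> ennreal (2 * C * W)"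
    proof (rule ennreal_leI)
      have "c * (T2 - T1) \<le> c * T2" using C T12 by (intro mult_left_mono) (auto simp: c_def)
      also have "\<dots> = C * X powr ((2 - 20 * r) * (- real d / 2 - e1) + (2 + 32 * r))"
        by (simp add: c_def T1_def T2_def powr_powr powr_add)
      also have "(2 - 20 * r) * (- real d / 2 - e1) + (2 + 32 * r) = (2 - real d) + (32 * r - 2 * e1 + 20 * r * (real d / 2 + e1))"
        by (simp add: algebra_simps)
      also have "C * X powr \<dots> = C * (X powr (2 - real d) * X powr (32 * r - 2 * e1 + 20 * r * (real d / 2 + e1)))"
        by (simp add: powr_add)
      also have "\<dots> \<le> C * (2 * W)"
      proof (intro mult_left_mono XW)
        have "20 * r * (real d / 2 + e1) \<le> 20 * r * (E / 2)"
          using e1 r q by (intro mult_left_mono) (auto simp: E_def)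
        also have "\<dots> = 10 * (E\<^sup>2 * q)" by (simp add: r_def power2_eq_square)
        finally have 1: "20 * r * (real d / 2 + e1) \<le> 10 * (E\<^sup>2 * q)" .
        have "2 * r \<le> E * r" using basic r q by (intro mult_right_mono) auto
        then have 2: "2 * r \<le> E\<^sup>2 * q" by (simp add: r_def power2_eq_square mult.assoc)
        show "32 * r - 2 * e1 + 20 * r * (real d / 2 + e1) + 8 * r \<le> - q"
          using 1 2 d_e1 r q by linarith
      qed (use C in auto)
      finally show "c * (T2 - T1) \<le> 2 * C * W" by simp
    qed
    finally show ?thesis .
  qed
  \<comment> \<open>For \<open>d >= 3\<close> the on-diagonal bound is integrable. For
    \<open>d <= 2\<close> the lower bound \<open>h >= s0 / X\<close> lets the drift overshoot the
    point before \<open>T2\<close>, so \<open>far_tail\<close> applies; this is how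
    \<open>s0\<close> enters the constant through \<open>k\<close>.\<close>
  have A3: "upint \<phi> {T2..} \<le> ennreal ((4 + 8 * k\<^sup>2) * C * W)"
  proof (cases "d \<ge> 3")
    case True
    then have d3: "real d \<ge> 3" by simp
    have "upint \<phi> {T2..} \<le> upint (\<lambda>t. C * t powr (- (real d / 2))) {T2..}"
      using T12 F0 by (intro upint_mono) auto
    also have "\<dots> = ennreal (C * T2 powr (1 - real d / 2) / (real d / 2 - 1))"
      using C T12 d3 by (intro upint_powr_tail) auto
    also have "\<dots> \<le> ennreal ((4 + 8 * k\<^sup>2) * C * W)"
    proof (rule ennreal_leI)
      have "C * T2 powr (1 - real d / 2) / (real d / 2 - 1) \<le> C * T2 powr (1 - real d / 2) / (1 / 2)"
        using C d3 by (intro divide_left_mono) auto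
      also have "\<dots> = 2 * C * X powr ((2 + 32 * r) * (1 - real d / 2))" by (simp add: T2_def powr_powr)
      also have "(2 + 32 * r) * (1 - real d / 2) = (2 - real d) + (- 16 * r * (real d - 2))" by (simp add: algebra_simps)
      also have "2 * C * X powr \<dots> = 2 * C * (X powr (2 - real d) * X powr (- 16 * r * (real d - 2)))"
        by (simp only: powr_add)
      also have "\<dots> \<le> 2 * C * (2 * W)"
      proof (intro mult_left_mono XW)
        have "16 * r * 1 \<le> 16 * r * (real d - 2)" using d3 r q by (intro mult_left_mono) auto
        then show "- 16 * r * (real d - 2) + 8 * r \<le> - q" using r q by linarith
      qed (use C in auto)
      also have "\<dots> \<le> (4 + 8 * k\<^sup>2) * C * W"
        using C W by (simp add: algebra_simps mult_nonneg_nonneg)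
      finally show "C * T2 powr (1 - real d / 2) / (real d / 2 - 1) \<le> (4 + 8 * k\<^sup>2) * C * W" .
    qed
    finally show ?thesis .
  next
    case False
    then have Xh: "X * h \<ge> s0" using low by simp
    have hp: "h > 0"
    proof (rule ccontr)
      assume "\<not> h > 0"
      then have "X * h \<le> 0" using basic by (simp add: mult_nonneg_nonpos)
      with Xh s0 show False by linarith
    qed
    have hk: "h / 2 \<ge> 1 / (k * X)"
    proof -
      have "1 \<le> k * (s0 / 2)" using k(2) s0 by (simp add: field_simps)
      also have "\<dots> \<le> k * (X * h / 2)" using Xh k by (intro mult_left_mono) auto
      finally show ?thesis using basic k by (simp add: field_simps)
    qed
    have kX: "k * X > 0" using k basic by simp
    have k2: "k powr (2 - 2 * q) \<le> k\<^sup>2"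
    proof -
      have "k powr (2 - 2 * q) \<le> k powr 2" using k q by (intro powr_mono) auto
      then show ?thesis using k by simp
    qed
    have h2: "(h / 2) powr (- (2 - 2 * q)) \<le> (k * X) powr (2 - 2 * q)"
    proof -
      have "(h / 2) powr (- (2 - 2 * q)) \<le> (1 / (k * X)) powr (- (2 - 2 * q))"
        using hk kX basic(7) by (intro powr_mono2') auto
      also have "\<dots> = (k * X) powr (2 - 2 * q)"
        by (rule powr_inverse_minus)
      finally show ?thesis .
    qed
    have e: "2 + 32 * r - 4 * q - 64 * r * q \<ge> 2 - 2 * q + q" "- 64 * r * q \<ge> - r"
    proof -
      have "64 * r * q \<le> 64 * r * (1 / 64)" using r q basic(7) by (intro mult_left_mono) auto
      then show "- 64 * r * q \<ge> - r" by simp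
      then show "2 + 32 * r - 4 * q - 64 * r * q \<ge> 2 - 2 * q + q" using r q by linarith
    qed
    have cond: "T2 powr (1 - 2 * q) * (h / 2) powr (2 - 2 * q) \<ge> 1"
    proof -
      have "1 * X powr (2 - 2 * q) \<le> (X powr q / k\<^sup>2) * X powr (2 - 2 * q)"
        using k by (intro mult_right_mono) auto
      also have "\<dots> = X powr (2 - 2 * q + q) / k\<^sup>2" unfolding powr_add by simp
      also have "\<dots> \<le> X powr (2 + 32 * r - 4 * q - 64 * r * q) / k\<^sup>2"
        using e k by (intro divide_right_mono X_powr_mono) auto
      also have "\<dots> \<le> X powr (2 + 32 * r - 4 * q - 64 * r * q) / k powr (2 - 2 * q)"
        using k2 k by (intro divide_left_mono) auto
      also have "2 + 32 * r - 4 * q - 64 * r * q = (2 + 32 * r) * (1 - 2 * q)" by (simp add: algebra_simps)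
      also have "X powr ((2 + 32 * r) * (1 - 2 * q)) = T2 powr (1 - 2 * q)" by (simp add: T2_def powr_powr)
      finally have "1 * X powr (2 - 2 * q) \<le> T2 powr (1 - 2 * q) / k powr (2 - 2 * q)" .
      moreover have "X powr (2 - 2 * q) > 0" using basic(1) by simp
      ultimately have "1 \<le> T2 powr (1 - 2 * q) / k powr (2 - 2 * q) / X powr (2 - 2 * q)"
        by (simp only: pos_le_divide_eq)
      also have "\<dots> = T2 powr (1 - 2 * q) * (1 / (k * X)) powr (2 - 2 * q)"
        using kX by (simp add: powr_divide powr_mult)
      also have "\<dots> \<le> T2 powr (1 - 2 * q) * (h / 2) powr (2 - 2 * q)"
        using hk kX basic(7) by (intro mult_left_mono powr_mono2) auto
      finally show ?thesis .
    qed
    have hT2: "h * T2 \<ge> 2 * X"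
    proof -
      have "2 * X \<le> (k * s0) * X" using k s0 basic by (intro mult_right_mono) (auto simp: field_simps)
      also have "\<dots> \<le> (X powr (32 * r) * s0) * X"
      proof (intro mult_right_mono)
        have "k * 1 \<le> k * k" using k by (intro mult_left_mono) auto
        also have "\<dots> = k\<^sup>2" by (simp add: power2_eq_square)
        also have "\<dots> \<le> X powr (32 * r)" using X_powr_ge_s0[of "32 * r"] r q by (simp add: k_def)
        finally show "k \<le> X powr (32 * r)" by simp
      qed (use s0 basic in auto)
      also have "\<dots> \<le> (X powr (32 * r) * (X * h)) * X" using Xh basic by (intro mult_right_mono mult_left_mono) auto
      also have "\<dots> = h * (X\<^sup>2 * X powr (32 * r))" by (simp add: power2_eq_square)
      also have "X\<^sup>2 * X powr (32 * r) = T2" using basic by (simp add: T2_def powr_add)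
      finally show ?thesis .
    qed
    have "upint \<phi> {T2..} \<le> ennreal (4 * C * (h / 2) powr (- (2 - 2 * q)) * T2 powr (- (real d / 2 - 2 * q)))"
      by (rule far_tail[OF hp _ hT2 cond]) (use T12 in auto)
    also have "\<dots> \<le> ennreal ((4 + 8 * k\<^sup>2) * C * W)"
    proof (rule ennreal_leI)
      have "(h / 2) powr (- (2 - 2 * q)) \<le> k powr (2 - 2 * q) * X powr (2 - 2 * q)"
        using h2 by (simp add: powr_mult)
      also have "\<dots> \<le> k\<^sup>2 * X powr 2" using k2 q by (intro mult_mono X_powr_mono) auto
      finally have "4 * C * (h / 2) powr (- (2 - 2 * q)) * T2 powr (- (real d / 2 - 2 * q))
         \<le> 4 * C * (k\<^sup>2 * X powr 2) * T2 powr (- (real d / 2 - 2 * q))"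
        using C by (intro mult_right_mono mult_left_mono) auto
      also have "\<dots> = 4 * C * k\<^sup>2 * (X powr 2 * X powr ((2 + 32 * r) * (- (real d / 2 - 2 * q))))"
        by (simp add: T2_def powr_powr)
      also have "X powr 2 * X powr ((2 + 32 * r) * (- (real d / 2 - 2 * q)))
          = X powr (2 - real d) * X powr (- 16 * r * real d + 4 * q + 64 * r * q)"
        by (simp only: powr_add[symmetric]) (simp add: algebra_simps)
      also have "4 * C * k\<^sup>2 * \<dots> \<le> 4 * C * k\<^sup>2 * (2 * W)"
      proof (intro mult_left_mono XW)
        have "16 * r * 1 \<le> 16 * r * real d" using basic(9) r q by (intro mult_left_mono) auto
        then show "- 16 * r * real d + 4 * q + 64 * r * q + 8 * r \<le> - q" using r q e by linarith
      qed (use C in auto)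
      also have "\<dots> \<le> (4 + 8 * k\<^sup>2) * C * W"
        using C W by (simp add: algebra_simps mult_nonneg_nonneg)
      finally show "4 * C * (h / 2) powr (- (2 - 2 * q)) * T2 powr (- (real d / 2 - 2 * q)) \<le> (4 + 8 * k\<^sup>2) * C * W" .
    qed
    finally show ?thesis .
  qed
  have "upint \<phi> {0<..} \<le> upint \<phi> ({0<..T1} \<union> ({T1..T2} \<union> {T2..}))"
    by (rule upint_mono) auto
  also have "\<dots> \<le> upint \<phi> {0<..T1} + (upint \<phi> {T1..T2} + upint \<phi> {T2..})"
    by (intro order_trans[OF upint_Un] add_mono order_refl) measurable
  also have "\<dots> \<le> ennreal (2 ^ (d + 3) * C * W) + (ennreal (2 * C * W) + ennreal ((4 + 8 * k\<^sup>2) * C * W))"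
    by (intro add_mono A1 A2 A3)
  also have "\<dots> = ennreal (2 ^ (d + 3) * C * W + (2 * C * W + (4 + 8 * k\<^sup>2) * C * W))"
    using C W by simp
  also have "\<dots> \<le> ennreal ((2 ^ (d + 4) + 8 * k\<^sup>2) * C * W)"
  proof (rule ennreal_leI)
    have d2: "(2::real) ^ d \<ge> 2" using power_increasing[OF d, of "2::real"] by simp
    have "2 ^ (d + 3) + (2 + (4 + 8 * k\<^sup>2)) \<le> 2 ^ (d + 4) + 8 * k\<^sup>2"
      using d2 by (simp add: power_add)
    from mult_right_mono[OF this, of "C * W"]
    show "2 ^ (d + 3) * C * W + (2 * C * W + (4 + 8 * k\<^sup>2) * C * W) \<le> (2 ^ (d + 4) + 8 * k\<^sup>2) * C * W"
      using C W by (simp add: algebra_simps)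
  qed
  finally show ?thesis by (simp add: W_def k_def mult.assoc)
qed

lemma total_bound:
  "upint \<phi> {0<..} \<le> ennreal ((2 ^ (d + 6) * (1 + M) + 8 * (max 1 (2 / s0))\<^sup>2) * C * T * X powr (- q))"
proof -
  define W where "W = C * T * X powr (- q)"
  have W: "W \<ge> 0" using basic C by (simp add: W_def)
  show ?thesis
  proof (cases "s \<ge> X powr (8 * E * q)")
    case True
    from drift_regime[OF this] have "upint \<phi> {0<..} \<le> ennreal (2 ^ (d + 6) * (1 + M) * W)"
      by (simp add: W_def mult.assoc)
    also have "\<dots> \<le> ennreal ((2 ^ (d + 6) * (1 + M) + 8 * (max 1 (2 / s0))\<^sup>2) * W)"
      using W by (intro ennreal_leI mult_right_mono) auto
    finally show ?thesis by (simp add: W_def mult.assoc)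
  next
    case False
    then have "s \<le> X powr (8 * E * q)" by simp
    from balanced_regime[OF this] have "upint \<phi> {0<..} \<le> ennreal ((2 ^ (d + 4) + 8 * (max 1 (2 / s0))\<^sup>2) * W)"
      by (simp add: W_def mult.assoc)
    also have "\<dots> \<le> ennreal ((2 ^ (d + 6) * (1 + M) + 8 * (max 1 (2 / s0))\<^sup>2) * W)"
    proof (intro ennreal_leI mult_right_mono add_right_mono W)
      have "(2::real) ^ (d + 4) * 1 \<le> 2 ^ (d + 6) * (1 + M)"
        using M by (intro mult_mono power_increasing) auto
      then show "(2::real) ^ (d + 4) \<le> 2 ^ (d + 6) * (1 + M)" by simp
    qed
    finally show ?thesis by (simp add: W_def mult.assoc)
  qed
qed

end

section \<open>The Green function asymptotics\<close>

text \<open>Converts an \<open>ennreal\<close> bound into Bochner integrability. It matters because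
  the integral of a nonintegrable function is 0 by convention, so an identity for
  \<open>green\<close> says something only together with integrability.\<close>

lemma set_integrable_upint:
  fixes f :: "real \<Rightarrow> 'b::{banach, second_countable_topology}"
  assumes m: "(\<lambda>t. indicator A t *\<^sub>R f t) \<in> borel_measurable borel" and B: "upint (\<lambda>t. norm (f t)) A \<le> ennreal B" "B \<ge> 0"
  shows "set_integrable lborel A f" "norm (LINT t:A|lborel. f t) \<le> B"
proof -
  have e: "(\<integral>\<^sup>+ t. ennreal (norm (indicat_real A t *\<^sub>R f t)) \<partial>lborel) = upint (\<lambda>t. norm (f t)) A"
    unfolding upint_def by (intro nn_integral_cong) (auto simp: indicator_def)
  show i: "set_integrable lborel A f"
    unfolding set_integrable_def
  proof (rule integrableI_bounded)
    show "(\<integral>\<^sup>+ t. ennreal (norm (indicat_real A t *\<^sub>R f t)) \<partial>lborel) < \<infinity>"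
      unfolding e using B(1) by (rule le_less_trans) simp
  qed (use m in simp)
  have "ennreal (norm (LINT t:A|lborel. f t)) \<le> ennreal B"
    unfolding set_lebesgue_integral_def
    by (rule order_trans[OF integral_norm_bound_ennreal[OF i[unfolded set_integrable_def], unfolded e] B(1)])
  then show "norm (LINT t:A|lborel. f t) \<le> B" using B by simp
qed

text \<open>The two summands are the constants of \<open>exp_neg_le_powr\<close> for the powers
  \<open>N / 2\<close>, used for \<open>t >= 1\<close>, and \<open>(d + N) / 2\<close>, used for
  \<open>t < 1\<close>.\<close>

definition rho_far_const :: "real \<Rightarrow> real \<Rightarrow> real \<Rightarrow> real \<Rightarrow> real" where
  "rho_far_const d M K N = (1 / (4 * pi * K)) powr (d / 2) *
     ((N / 2) powr (N / 2) * (K / M\<^sup>2) powr (- (N / 2)) + ((d + N) / 2) powr ((d + N) / 2) * (K / M\<^sup>2) powr (- ((d + N) / 2)))"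

text \<open>The first factor is that of \<open>rho_lower\<close>; the other two account for times up
  to \<open>2 * t0\<close> and for a squared distance of at most \<open>4 * t\<close>.\<close>

definition green_lower_const :: "real \<Rightarrow> real \<Rightarrow> real \<Rightarrow> real" where
  "green_lower_const d M K = (1 / (2 * pi * M)) powr (d / 2) * 2 powr (- d / 2) * exp (- 1 / K)"

lemma exp_neg_le_powr:
  fixes c u b :: real
  assumes "c > 0" "u > 0" "b > 0"
  shows "exp (- (c * u)) \<le> b powr b * c powr (- b) * u powr (- b)"
  using exp_neg_powr_le[of "c * u" 1 b] assms by (simp add: powr_mult mult.assoc)

text \<open>A sum of the constants for the four bounds demanded by \<open>green_majorant\<close>, so
  that it dominates each; the summand 1 makes it positive.\<close>

definition majorant_const :: "'d::finite itself \<Rightarrow> real \<Rightarrow> real \<Rightarrow> real \<Rightarrow> real \<Rightarrow> real" where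
  "majorant_const _ M K z q = 1 + (M * gauss_const TYPE('d) K + M * (1 / (4 * pi * K)) powr (real CARD('d) / 2))
     + lclt_const TYPE('d) M K z
     + (far_const TYPE('d) M K 2 q + M * rho_far_const CARD('d) M K 2)
     + (far_const TYPE('d) M K (real CARD('d) - 1) q + M * rho_far_const CARD('d) M K (real CARD('d) - 1))"

context class_pair
begin

text \<open>The Gaussian factor is bounded by \<open>(D^2 / t) powr (- b)\<close>. For
  \<open>t >= 1\<close> one takes \<open>2 * b = N\<close>; for \<open>t < 1\<close> the choice
  \<open>2 * b = d + N\<close> cancels the singularity \<open>t powr (- d/2)\<close>, and the
  surplus decay in \<open>D >= 1\<close> is discarded.\<close>

lemma rho_far:
  assumes t: "t > 0" and D: "D = norm (z - t *\<^sub>R \<eta>)" "D \<ge> 1" and N: "N > 0"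
  shows "rho t z \<eta> \<Lambda> \<le> rho_far_const CARD('d) M K N * max 1 t powr ((N - real CARD('d)) / 2) * D powr (- N)"
proof -
  define d where "d = real CARD('d)"
  have d: "d \<ge> 1" by (simp add: d_def Suc_leI)
  define c where "c = K / M\<^sup>2"
  have c: "c > 0" using K M by (simp add: c_def)
  define Cr where "Cr = (1 / (4 * pi * K)) powr (d / 2)"
  have Cr: "Cr \<ge> 0" by (simp add: Cr_def)
  define u where "u = D\<^sup>2 / t"
  have u: "u > 0" unfolding u_def using t D(2) by (intro divide_pos_pos) auto
  have D2: "D\<^sup>2 = D powr 2" using D by simp
  have up: "u powr (- b) = D powr (- (2 * b)) * t powr b" for b
    by (simp only: u_def D2 powr_divide powr_powr) (simp add: powr_minus divide_inverse)
  have rb: "rho t z \<eta> \<Lambda> \<le> Cr * t powr (- d / 2) * (b powr b * c powr (- b) * (D powr (- (2 * b)) * t powr b))" if "b > 0" for b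
  proof -
    have "rho t z \<eta> \<Lambda> \<le> Cr * t powr (- d / 2) * exp (- (c * u))"
      using rho_upper[OF t, of z] by (simp add: Cr_def d_def c_def u_def D(1))
    also have "\<dots> \<le> Cr * t powr (- d / 2) * (b powr b * c powr (- b) * u powr (- b))"
      using Cr by (intro mult_left_mono exp_neg_le_powr c u that) auto
    finally show ?thesis unfolding up .
  qed
  define b1 b2 where "b1 = N / 2" and "b2 = (d + N) / 2"
  have b: "b1 > 0" "b2 > 0" using N d by (auto simp: b1_def b2_def)
  define k1 k2 where "k1 = b1 powr b1 * c powr (- b1)" and "k2 = b2 powr b2 * c powr (- b2)"
  have k: "k1 \<ge> 0" "k2 \<ge> 0" by (auto simp: k1_def k2_def)
  have "rho t z \<eta> \<Lambda> \<le> Cr * (k1 + k2) * (max 1 t powr ((N - d) / 2) * D powr (- N))"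
  proof (cases "t \<ge> 1")
    case True
    have "rho t z \<eta> \<Lambda> \<le> Cr * k1 * ((t powr (- d / 2) * t powr b1) * D powr (- N))"
      using rb[OF b(1)] by (simp add: k1_def b1_def mult_ac)
    also have "t powr (- d / 2) * t powr b1 = t powr ((N - d) / 2)"
      by (simp add: powr_add[symmetric] b1_def diff_divide_distrib)
    also have "Cr * k1 * (t powr ((N - d) / 2) * D powr (- N)) \<le> Cr * (k1 + k2) * (t powr ((N - d) / 2) * D powr (- N))"
      using Cr k by (intro mult_right_mono mult_left_mono) auto
    finally show ?thesis using True by (simp add: max_def)
  next
    case False
    have "rho t z \<eta> \<Lambda> \<le> Cr * k2 * ((t powr (- d / 2) * t powr b2) * D powr (- (d + N)))"
    proof -
      have "2 * b2 = d + N" by (simp add: b2_def)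
      from rb[OF b(2), unfolded this] show ?thesis by (simp only: k2_def mult_ac)
    qed
    also have "t powr (- d / 2) * t powr b2 = t powr (N / 2)"
      by (simp add: powr_add[symmetric] b2_def add_divide_distrib)
    also have "Cr * k2 * (t powr (N / 2) * D powr (- (d + N))) \<le> Cr * k2 * (1 * D powr (- N))"
    proof (intro mult_left_mono mult_mono powr_mono)
      show "t powr (N / 2) \<le> 1" using t False N by (intro powr_le1) auto
    qed (use Cr k D d in auto)
    also have "\<dots> \<le> Cr * (k1 + k2) * (1 * D powr (- N))"
      using Cr k by (intro mult_right_mono mult_left_mono) auto
    finally show ?thesis using False by (simp add: max_def)
  qed
  then show ?thesis by (simp add: rho_far_const_def d_def Cr_def k1_def k2_def b1_def b2_def c_def mult_ac)
qed

lemma rho_sup: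
  assumes "t > 0"
  shows "rho t z \<eta> \<Lambda> \<le> (1 / (4 * pi * K)) powr (real CARD('d) / 2) * t powr (- real CARD('d) / 2)"
proof -
  have "rho t z \<eta> \<Lambda> \<le> (1 / (4 * pi * K)) powr (real CARD('d) / 2) * t powr (- real CARD('d) / 2) * exp (- (K / M\<^sup>2) * (norm (z - t *\<^sub>R \<eta>))\<^sup>2 / t)"
    by (rule rho_upper[OF assms])
  also have "\<dots> \<le> (1 / (4 * pi * K)) powr (real CARD('d) / 2) * t powr (- real CARD('d) / 2) * 1"
    using K M assms by (intro mult_left_mono) (auto simp: divide_nonpos_pos)
  finally show ?thesis by simp
qed

lemma rho_measurable [measurable]: "(\<lambda>t. rho t z \<eta> \<Lambda>) \<in> borel_measurable borel"
proof -
  have [measurable]: "(\<lambda>t. (z - t *\<^sub>R \<eta>) \<bullet> (matrix_inv \<Lambda> *v (z - t *\<^sub>R \<eta>))) \<in> borel_measurable borel"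
    by (intro borel_measurable_continuous_onI continuous_on_inner
        bounded_linear.continuous_on[OF matrix_vector_mul_bounded_linear] continuous_intros)
  show ?thesis unfolding rho_def by measurable
qed

lemma green_inner_measurable [measurable]: "(\<lambda>t. green_inner Q g x t) \<in> borel_measurable borel"
proof -
  have "(\<lambda>t. LINT k|lborel. indicator torus k *\<^sub>R (exp (\<i> * complex_of_real (k \<bullet> rvec x)) * (fourier g k * exp (- (complex_of_real t * F k))))) \<in> borel_measurable borel"
    by (rule sigma_finite_measure.borel_measurable_lebesgue_integral[OF sigma_finite_lborel]) measurable
  then show ?thesis unfolding green_inner_eq set_lebesgue_integral_def by measurable
qed

end

section \<open>Points aligned with the drift\<close>

locale aligned_point = class_pair Q g M K \<zeta>
  for Q g :: "int ^ 'd::finite \<Rightarrow> real" and M K \<zeta> +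
  fixes x :: "int ^ 'd" and X h s0 :: real
  assumes X: "X = norm (rvec x)" "X \<ge> 2" and h: "h = norm \<eta>" and aligned: "\<eta> = h *\<^sub>R (rvec x /\<^sub>R X)"
    and s0: "s0 > 0" "CARD('d) \<le> 2 \<Longrightarrow> X * h \<ge> s0"
begin

lemma h_bounds: "0 \<le> h" "h \<le> M"
  using drift_bound by (auto simp: h)

text \<open>Alignment makes the displacement from the drifting centre one-dimensional, so that the
  abstract estimates can work with the scalars \<open>X\<close> and \<open>h\<close>.\<close>

lemma dist_drift: "norm (rvec x - t *\<^sub>R \<eta>) = \<bar>X - h * t\<bar>"
proof -
  have "rvec x = X *\<^sub>R (rvec x /\<^sub>R X)" using X(2) by simp
  moreover have "t *\<^sub>R \<eta> = (h * t) *\<^sub>R (rvec x /\<^sub>R X)"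
    using aligned by (metis scaleR_scaleR mult.commute)
  ultimately have "rvec x - t *\<^sub>R \<eta> = (X - h * t) *\<^sub>R (rvec x /\<^sub>R X)"
    by (metis scaleR_left_diff_distrib)
  moreover have "norm (rvec x /\<^sub>R X) = 1" using X(1)[symmetric] X(2) by simp
  ultimately show ?thesis by (simp only: norm_scaleR mult_1_right)
qed

text \<open>Only finiteness is at stake, so the cut points and bounds may depend on \<open>x\<close>
  and \<open>\<eta>\<close> in an uncontrolled way.\<close>

lemma rho_integrable: "set_integrable lborel {0<..} (\<lambda>t. rho t (rvec x) \<eta> \<Lambda>)"
proof -
  let ?r = "\<lambda>t. rho t (rvec x) \<eta> \<Lambda>"
  define d where "d = real CARD('d)"
  have d: "d \<ge> 1" by (simp add: d_def Suc_leI)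
  define Cr where "Cr = (1 / (4 * pi * K)) powr (d / 2)"
  have Cr: "Cr \<ge> 0" by (simp add: Cr_def)
  define Cf where "Cf = (\<lambda>N. rho_far_const d M K N)"
  have Cf: "Cf N \<ge> 0" for N by (auto simp: Cf_def rho_far_const_def)
  have pos: "0 \<le> ?r t" if "t > 0" for t using rho_pos[OF that, of "rvec x"] by simp
  have far: "?r t \<le> Cf N * max 1 t powr ((N - d) / 2) * \<bar>X - h * t\<bar> powr (- N)" if "t > 0" "\<bar>X - h * t\<bar> \<ge> 1" "N > 0" for t N
    using rho_far[OF that(1) dist_drift[symmetric] that(2,3)] by (simp add: Cf_def d_def)
  have sup: "?r t \<le> Cr * t powr (- d / 2)" if "t > 0" for t
    using rho_sup[OF that, of "rvec x"] by (simp add: Cr_def d_def)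
  \<comment> \<open>Ensures \<open>h * t <= X / 2\<close>, hence distance at least 1, for
    \<open>t <= T1\<close>; the summand 1 avoids a division by zero when there is no drift.\<close>
  define T1 where "T1 = X / 2 / (h + 1)"
  have T1: "T1 > 0" unfolding T1_def using X(2) h_bounds by (intro divide_pos_pos) auto
  have 1: "upint ?r {0<..T1} \<le> ennreal (Cf d * (T1 - 0))"
  proof -
    have "upint ?r {0<..T1} \<le> upint (\<lambda>_. Cf d) {0..T1}"
    proof (rule upint_mono)
      fix t assume t: "t \<in> {0<..T1}"
      have "h * t \<le> h * T1" using t h_bounds by (intro mult_left_mono) auto
      also have "h * T1 \<le> (h + 1) * T1" using T1 by (intro mult_right_mono) auto
      also have "(h + 1) * T1 = X / 2"
      proof -
        have "h + 1 \<noteq> 0" using h_bounds by linarith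
        then show ?thesis using T1_def by (metis mult.commute nonzero_eq_divide_eq)
      qed
      finally have D: "\<bar>X - h * t\<bar> \<ge> 1" using X by linarith
      \<comment> \<open>Taking \<open>N = d\<close> makes the power of \<open>max 1 t\<close>
        trivial, so the density is bounded down to time 0.\<close>
      have "?r t \<le> Cf d * max 1 t powr ((d - d) / 2) * \<bar>X - h * t\<bar> powr (- d)"
        using t D d by (intro far) auto
      also have "\<dots> = Cf d * \<bar>X - h * t\<bar> powr (- d)" by (simp add: max_def)
      also have "\<dots> \<le> Cf d * \<bar>X - h * t\<bar> powr 0"
        using D d by (intro mult_left_mono powr_mono Cf) auto
      finally show "?r t \<le> Cf d" using D by (auto split: if_splits)
    qed auto
    also have "\<dots> = ennreal (Cf d * (T1 - 0))" using Cf T1 by (intro upint_const) auto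
    finally show ?thesis .
  qed
  define T2 where "T2 = max (max 1 T1) (2 * X / (if h = 0 then 1 else h))"
  have T2: "T2 \<ge> 1" "T2 \<ge> T1" by (auto simp: T2_def)
  have 2: "upint ?r {T1..T2} \<le> ennreal (Cr * T1 powr (- d / 2) * (T2 - T1))"
  proof -
    have "upint ?r {T1..T2} \<le> upint (\<lambda>_. Cr * T1 powr (- d / 2)) {T1..T2}"
    proof (rule upint_mono)
      fix t assume t: "t \<in> {T1..T2}"
      then have "?r t \<le> Cr * t powr (- d / 2)" using T1 by (intro sup) auto
      also have "\<dots> \<le> Cr * T1 powr (- d / 2)" using t T1 Cr d by (intro mult_left_mono powr_mono2') auto
      finally show "?r t \<le> Cr * T1 powr (- d / 2)" .
    qed auto
    also have "\<dots> = ennreal (Cr * T1 powr (- d / 2) * (T2 - T1))" using Cr T2 by (intro upint_const) auto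
    finally show ?thesis .
  qed
  have 3: "\<exists>B. upint ?r {T2..} \<le> ennreal B \<and> B \<ge> 0"
  proof (cases "h = 0")
    case True
    have d3: "d \<ge> 3"
    proof (rule ccontr)
      assume "\<not> d \<ge> 3"
      then have "CARD('d) \<le> 2" by (simp add: d_def)
      with s0 True show False by auto
    qed
    have "upint ?r {T2..} \<le> upint (\<lambda>t. Cr * t powr (- (d / 2))) {T2..}"
      using T2 sup by (intro upint_mono) auto
    also have "\<dots> = ennreal (Cr * T2 powr (1 - d / 2) / (d / 2 - 1))"
      using Cr T2 d3 by (intro upint_powr_tail) auto
    finally have "upint ?r {T2..} \<le> ennreal (Cr * T2 powr (1 - d / 2) / (d / 2 - 1))" .
    moreover have "Cr * T2 powr (1 - d / 2) / (d / 2 - 1) \<ge> 0" using Cr d3 by simp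
    ultimately show ?thesis by blast
  next
    case False
    then have hp: "h > 0" using h_bounds by simp
    have "upint ?r {T2..} \<le> upint (\<lambda>t. Cf 2 * (h / 2) powr (- 2) * t powr (- (1 + d / 2))) {T2..}"
    proof (rule upint_mono)
      fix t assume t: "t \<in> {T2..}"
      then have t1: "t \<ge> 1" using T2 by auto
      have "2 * X / h \<le> t" using t False by (simp add: T2_def)
      then have ht: "2 * X \<le> h * t" using hp by (simp add: field_simps)
      then have D: "\<bar>X - h * t\<bar> \<ge> h * t / 2" "h * t / 2 \<ge> 1" using X by linarith+
      have "?r t \<le> Cf 2 * max 1 t powr ((2 - d) / 2) * \<bar>X - h * t\<bar> powr (- 2)"
        using t1 D by (intro far) auto
      also have "\<dots> \<le> Cf 2 * t powr ((2 - d) / 2) * (h * t / 2) powr (- 2)"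
      proof -
        have "max 1 t = t" using t1 by simp
        moreover have "\<bar>X - h * t\<bar> powr (- 2) \<le> (h * t / 2) powr (- 2)" using D by (intro powr_mono2') auto
        ultimately show ?thesis using Cf[of 2] by (simp add: mult_left_mono)
      qed
      also have "(h * t / 2) powr (- 2) = (h / 2) powr (- 2) * t powr (- 2)"
        using powr_mult[of "h / 2" t "- 2"] by simp
      also have "Cf 2 * t powr ((2 - d) / 2) * ((h / 2) powr (- 2) * t powr (- 2)) = Cf 2 * (h / 2) powr (- 2) * (t powr ((2 - d) / 2) * t powr (- 2))"
        by simp
      also have "t powr ((2 - d) / 2) * t powr (- 2) = t powr (- (1 + d / 2))"
      proof -
        have "- (1 + d / 2) = (2 - d) / 2 + - 2" by (simp add: field_simps)
        then show ?thesis by (simp only: powr_add)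
      qed
      finally show "?r t \<le> Cf 2 * (h / 2) powr (- 2) * t powr (- (1 + d / 2))" .
    qed auto
    also have "\<dots> = ennreal (Cf 2 * (h / 2) powr (- 2) * T2 powr (1 - (1 + d / 2)) / ((1 + d / 2) - 1))"
      using Cf T2 d by (intro upint_powr_tail) auto
    finally have "upint ?r {T2..} \<le> ennreal (Cf 2 * (h / 2) powr (- 2) * T2 powr (1 - (1 + d / 2)) / ((1 + d / 2) - 1))" .
    moreover have "Cf 2 * (h / 2) powr (- 2) * T2 powr (1 - (1 + d / 2)) / ((1 + d / 2) - 1) \<ge> 0" using Cf d by simp
    ultimately show ?thesis by blast
  qed
  then obtain B where B: "upint ?r {T2..} \<le> ennreal B" "B \<ge> 0" by blast
  have "upint (\<lambda>t. norm (?r t)) {0<..} \<le> upint ?r ({0<..T1} \<union> ({T1..T2} \<union> {T2..}))"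
    using pos by (intro upint_mono) (auto simp: abs_of_nonneg)
  also have "\<dots> \<le> upint ?r {0<..T1} + (upint ?r {T1..T2} + upint ?r {T2..})"
    by (intro order_trans[OF upint_Un] add_mono order_refl) measurable
  also have "\<dots> \<le> ennreal (Cf d * (T1 - 0)) + (ennreal (Cr * T1 powr (- d / 2) * (T2 - T1)) + ennreal B)"
    by (intro add_mono 1 2 B)
  also have "\<dots> = ennreal (Cf d * (T1 - 0) + (Cr * T1 powr (- d / 2) * (T2 - T1) + B))"
    using Cf Cr T1 T2 B by simp
  finally show ?thesis
    by (rule set_integrable_upint(1)[rotated]) (use Cf Cr T1 T2 B in auto)
qed

text \<open>The density is positive, so one time window gives a lower bound. Its start
  \<open>X^2 / S\<close> interpolates between the diffusive time \<open>X^2\<close> without drift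
  and the passage time \<open>X / h\<close> under a strong drift.\<close>

lemma brownian_green_ge:
  "brownian_green (rvec x) \<eta> \<Lambda> \<ge> green_lower_const CARD('d) M K * (X powr (2 - real CARD('d)) * (1 + X * h) powr ((real CARD('d) - 3) / 2))"
proof -
  let ?r = "\<lambda>t. rho t (rvec x) \<eta> \<Lambda>"
  define d where "d = real CARD('d)"
  have d: "d \<ge> 1" by (simp add: d_def Suc_leI)
  define S where "S = 1 + X * h"
  have S: "S \<ge> 1" using X h_bounds by (simp add: S_def)
  \<comment> \<open>The density is of order \<open>t0 powr (- d / 2)\<close> for times in \<open>[t0, t0 + t0 * w]\<close>, as \<open>|X - h t| \<le> 2 X w\<close> is then
    comparable to \<open>sqrt t0\<close>.\<close>
  define t0 where "t0 = X\<^sup>2 / S"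
  define w where "w = S powr (- 1 / 2)"
  have t0: "t0 > 0" unfolding t0_def using X(2) S by (intro divide_pos_pos) auto
  have w: "0 < w" "w \<le> 1" "w\<^sup>2 = 1 / S" "1 / S \<le> w"
  proof -
    show "0 < w" using S by (simp add: w_def)
    show "w \<le> 1" using powr_mono[of "- 1 / 2" 0 S] S by (simp add: w_def)
    have "w\<^sup>2 = S powr (- 1 / 2 + - 1 / 2)" by (simp only: power2_eq_square w_def powr_add)
    then show "w\<^sup>2 = 1 / S" using S by (simp add: powr_minus_divide)
    have "S powr (- 1) \<le> w" unfolding w_def using S by (intro powr_mono) auto
    then show "1 / S \<le> w" using S by (simp add: powr_minus_divide)
  qed
  define cr where "cr = (1 / (2 * pi * M)) powr (d / 2)"
  define c where "c = cr * ((2 * t0) powr (- d / 2) * exp (- 1 / K))"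
  have low: "c \<le> ?r t" if t: "t \<in> {t0..t0 + t0 * w}" for t
  proof -
    have tw: "t0 * w \<le> t0 * 1" using t0 w by (intro mult_left_mono) auto
    from t have "t0 \<le> t" "t \<le> t0 + t0 * w" by auto
    with tw t0 have t2: "t0 \<le> t" "t \<le> 2 * t0" "t > 0" by linarith+
    have "\<bar>X - h * t\<bar> \<le> \<bar>X - h * t0\<bar> + h * (t0 * w)"
    proof -
      have "h * t0 \<le> h * t" "h * t \<le> h * (t0 + t0 * w)" using t h_bounds by (auto intro: mult_left_mono)
      then show ?thesis by (simp add: algebra_simps abs_le_iff) linarith
    qed
    also have "h * t0 = X * ((S - 1) / S)" using X by (simp add: t0_def S_def power2_eq_square)
    also have "X - X * ((S - 1) / S) = X * (1 / S)" using S by (simp add: field_simps)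
    also have "\<bar>X * (1 / S)\<bar> = X * (1 / S)" using X S by simp
    also have "X * (1 / S) \<le> X * w" using w X by (intro mult_left_mono) auto
    also have "h * (t0 * w) \<le> X * w"
    proof -
      have "h * t0 \<le> X" using X S by (simp add: t0_def S_def power2_eq_square field_simps)
      then have "h * t0 * w \<le> X * w" using w by (intro mult_right_mono) auto
      then show ?thesis by (simp add: mult.assoc)
    qed
    finally have "\<bar>X - h * t\<bar> \<le> 2 * X * w" by simp
    then have "\<bar>X - h * t\<bar>\<^sup>2 \<le> (2 * X * w)\<^sup>2" by (intro power_mono) auto
    also have "\<dots> = 4 * X\<^sup>2 * w\<^sup>2" by (simp add: power_mult_distrib)
    also have "\<dots> = 4 * t0" by (simp add: w t0_def)
    finally have D: "\<bar>X - h * t\<bar>\<^sup>2 \<le> 4 * t" using t2 by simp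
    have "\<bar>X - h * t\<bar>\<^sup>2 / (4 * K * t) \<le> (4 * t) / (4 * K * t)" using K t2 by (intro divide_right_mono D) auto
    also have "\<dots> = 1 / K" using t2 by simp
    finally have e: "exp (- 1 / K) \<le> exp (- \<bar>X - h * t\<bar>\<^sup>2 / (4 * K * t))" by simp
    have "c \<le> cr * (t powr (- d / 2) * exp (- \<bar>X - h * t\<bar>\<^sup>2 / (4 * K * t)))"
      unfolding c_def using t2 d e by (intro mult_left_mono mult_mono powr_mono2') (auto simp: cr_def)
    also have "\<dots> \<le> ?r t"
      using rho_lower[OF t2(3), of "rvec x"] by (simp only: dist_drift cr_def d_def mult.assoc)
    finally show ?thesis .
  qed
  have sub: "{t0..t0 + t0 * w} \<subseteq> {0<..}" using t0 by auto
  have "c * (t0 * w) = (LINT t:{t0..t0 + t0 * w}|lborel. c)"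
    using t0 w by (simp add: set_lebesgue_integral_def)
  also have "\<dots> \<le> (LINT t:{t0..t0 + t0 * w}|lborel. ?r t)"
  proof (rule set_integral_mono)
    show "set_integrable lborel {t0..t0 + t0 * w} (\<lambda>_. c)" by (intro borel_integrable_atLeastAtMost' continuous_intros)
    show "set_integrable lborel {t0..t0 + t0 * w} ?r" by (rule set_integrable_subset[OF rho_integrable]) (use t0 in auto)
  qed (rule low)
  also have "\<dots> \<le> brownian_green (rvec x) \<eta> \<Lambda>"
    unfolding brownian_green_def set_lebesgue_integral_def
  proof (rule integral_mono)
    show "integrable lborel (\<lambda>t. indicat_real {t0..t0 + t0 * w} t *\<^sub>R ?r t)"
      using set_integrable_subset[OF rho_integrable _ sub] by (simp add: set_integrable_def)
    show "integrable lborel (\<lambda>t. indicat_real {0<..} t *\<^sub>R ?r t)" using rho_integrable by (simp add: set_integrable_def)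
    show "indicat_real {t0..t0 + t0 * w} t *\<^sub>R ?r t \<le> indicat_real {0<..} t *\<^sub>R ?r t" for t
      using t0 less_imp_le[OF rho_pos[of t "rvec x"]] by (auto simp: indicator_def)
  qed
  also have "c * (t0 * w) = green_lower_const CARD('d) M K * ((t0 powr (- d / 2) * t0) * w)"
    by (simp add: c_def green_lower_const_def cr_def d_def powr_mult)
  also have "t0 powr (- d / 2) * t0 = t0 powr (1 - d / 2)"
    using t0 powr_add[of t0 "- d / 2" 1] by (simp add: add.commute)
  also have "t0 powr (1 - d / 2) * w = X powr (2 - d) * S powr ((d - 3) / 2)"
  proof -
    have "X\<^sup>2 = X powr 2" using X by simp
    then have "t0 powr (1 - d / 2) = X powr (2 * (1 - d / 2)) / S powr (1 - d / 2)"
      by (simp only: t0_def powr_divide powr_powr)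
    also have "\<dots> = X powr (2 - d) * S powr (- (1 - d / 2))"
      by (simp only: powr_minus divide_inverse) (simp add: algebra_simps)
    finally have "t0 powr (1 - d / 2) * w = X powr (2 - d) * (S powr (- (1 - d / 2)) * S powr (- 1 / 2))"
      by (simp add: w_def)
    also have "S powr (- (1 - d / 2)) * S powr (- 1 / 2) = S powr ((d - 3) / 2)"
      by (simp only: powr_add[symmetric]) (simp add: field_simps)
    finally show ?thesis .
  qed
  finally show ?thesis by (simp add: d_def S_def)
qed

definition err :: "real \<Rightarrow> complex" where
  "err t = green_inner Q g x t - fourier g 0 * complex_of_real (rho t (rvec x) \<eta> \<Lambda>)"

lemma norm_err_le:
  assumes "t > 0" "cmod (green_inner Q g x t) \<le> a * w" "rho t (rvec x) \<eta> \<Lambda> \<le> b * w"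
  shows "cmod (err t) \<le> (a + M * b) * w"
proof -
  have "cmod (err t) \<le> cmod (green_inner Q g x t) + cmod (fourier g 0) * rho t (rvec x) \<eta> \<Lambda>"
    using rho_pos[OF assms(1), of "rvec x"] norm_triangle_ineq4[of "green_inner Q g x t" "fourier g 0 * complex_of_real (rho t (rvec x) \<eta> \<Lambda>)"]
    by (simp add: err_def norm_mult)
  also have "\<dots> \<le> a * w + M * (b * w)"
    using assms M rho_pos[OF assms(1), of "rvec x"] by (intro add_mono mult_mono fourier_g_bound) auto
  finally show ?thesis by (simp add: algebra_simps)
qed

lemma majorant_const_ge:
  assumes "q > 0"
  shows "majorant_const TYPE('d) M K z1 q \<ge> M * gauss_const TYPE('d) K + M * (1 / (4 * pi * K)) powr (real CARD('d) / 2)"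
    "majorant_const TYPE('d) M K z1 q \<ge> lclt_const TYPE('d) M K z1"
    "majorant_const TYPE('d) M K z1 q \<ge> far_const TYPE('d) M K 2 q + M * rho_far_const CARD('d) M K 2"
    "majorant_const TYPE('d) M K z1 q \<ge> far_const TYPE('d) M K (real CARD('d) - 1) q + M * rho_far_const CARD('d) M K (real CARD('d) - 1)"
    "majorant_const TYPE('d) M K z1 q > 0"
proof -
  have f: "far_const TYPE('d) M K N q \<ge> 0" for N
    unfolding far_const_def using trunc_const_nonneg M by (intro mult_nonneg_nonneg add_nonneg_nonneg) auto
  have rf: "M * rho_far_const CARD('d) M K N \<ge> 0" for N
    unfolding rho_far_const_def using M by (intro mult_nonneg_nonneg add_nonneg_nonneg) auto
  have l: "lclt_const TYPE('d) M K z1 \<ge> 0"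
    unfolding lclt_const_def using M by (intro mult_nonneg_nonneg add_nonneg_nonneg) auto
  have g0: "M * gauss_const TYPE('d) K + M * (1 / (4 * pi * K)) powr (real CARD('d) / 2) \<ge> 0"
    using M gauss_const_ge(2)[of K, where 'd='d] by (intro add_nonneg_nonneg mult_nonneg_nonneg) auto
  note n = f[of 2] rf[of 2] f[of "real CARD('d) - 1"] rf[of "real CARD('d) - 1"] l g0
  show "majorant_const TYPE('d) M K z1 q \<ge> M * gauss_const TYPE('d) K + M * (1 / (4 * pi * K)) powr (real CARD('d) / 2)"
    "majorant_const TYPE('d) M K z1 q \<ge> lclt_const TYPE('d) M K z1"
    "majorant_const TYPE('d) M K z1 q \<ge> far_const TYPE('d) M K 2 q + M * rho_far_const CARD('d) M K 2"
    "majorant_const TYPE('d) M K z1 q \<ge> far_const TYPE('d) M K (real CARD('d) - 1) q + M * rho_far_const CARD('d) M K (real CARD('d) - 1)"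
    "majorant_const TYPE('d) M K z1 q > 0"
    unfolding majorant_const_def using n by linarith+
qed

text \<open>The factor in \<open>q\<close> is that of \<open>green_majorant\<close>, read backwards
  from the local limit rate \<open>e1 = z1 / 2\<close>. Away from the drift both parts of
  \<open>err\<close> are estimated separately; the Gaussian part decays with the full power of
  \<open>D\<close>, which is weakened to the exponent of the lattice part.\<close>

lemma err_majorant:
  assumes q: "q = z1 / 2 / (100 * (real CARD('d) + 1)\<^sup>2)"
    and Xq: "X \<ge> 2 * M" "X powr q \<ge> 8" "X powr q \<ge> (max 1 (2 / s0))\<^sup>2"
  shows "green_majorant CARD('d) X h M q (z1 / 2) (majorant_const TYPE('d) M K z1 q) s0 (\<lambda>t. cmod (err t))"
proof
  define Cm where "Cm = majorant_const TYPE('d) M K z1 q"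
  have E: "100 * (real CARD('d) + 1)\<^sup>2 \<ge> 100"
    using one_le_power[of "real CARD('d) + 1" 2] by simp
  show q0: "0 < q" unfolding q using z1 E by (intro divide_pos_pos) auto
  note Cge = majorant_const_ge[OF q0]
  have q1: "q < 1"
  proof -
    have "q \<le> z1 / 2 / 100" unfolding q using z1 E by (intro divide_left_mono) auto
    then show ?thesis using z1 by linarith
  qed
  show "1 \<le> CARD('d)" by (simp add: Suc_leI)
  show "0 \<le> h" "h \<le> M" by (fact h_bounds)+
  show "0 < M" "0 < s0" by (fact M s0)+
  show "0 < majorant_const TYPE('d) M K z1 q" by (rule Cge)
  show "z1 / 2 = 100 * (real CARD('d) + 1)\<^sup>2 * q" unfolding q using E by simp
  show "z1 / 2 \<le> 1 / 2" using z1 by simp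
  show "2 \<le> X" by (fact X)
  show "2 * M \<le> X" "8 \<le> X powr q" "(max 1 (2 / s0))\<^sup>2 \<le> X powr q" by (fact Xq)+
  show "(\<lambda>t. cmod (err t)) \<in> borel_measurable borel" unfolding err_def by measurable
  show "CARD('d) \<le> 2 \<Longrightarrow> s0 \<le> X * h" by (rule s0)
  show "cmod (err t) \<le> majorant_const TYPE('d) M K z1 q * t powr (- real CARD('d) / 2)" if "1 \<le> t" for t
  proof -
    have "cmod (err t) \<le> (M * gauss_const TYPE('d) K + M * (1 / (4 * pi * K)) powr (real CARD('d) / 2)) * t powr (- real CARD('d) / 2)"
      using green_inner_sup[of t x] rho_sup[of t "rvec x"] that by (intro norm_err_le) (auto simp: max_def)
    also have "\<dots> \<le> majorant_const TYPE('d) M K z1 q * t powr (- real CARD('d) / 2)"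
      by (intro mult_right_mono Cge) auto
    finally show ?thesis .
  qed
  show "cmod (err t) \<le> majorant_const TYPE('d) M K z1 q * t powr (- real CARD('d) / 2 - z1 / 2)" if "0 < t" for t
  proof -
    have "cmod (err t) \<le> lclt_const TYPE('d) M K z1 * t powr (- real CARD('d) / 2 - z1 / 2)"
      unfolding err_def by (rule local_clt[OF that])
    also have "\<dots> \<le> majorant_const TYPE('d) M K z1 q * t powr (- real CARD('d) / 2 - z1 / 2)"
      by (intro mult_right_mono Cge) auto
    finally show ?thesis .
  qed
  show "cmod (err t) \<le> majorant_const TYPE('d) M K z1 q * max 1 t powr (1 - real CARD('d) / 2) * \<bar>X - h * t\<bar> powr (- 2 * (1 - q))"
    if t: "0 < t" "1 \<le> \<bar>X - h * t\<bar>" "t \<le> \<bar>X - h * t\<bar> powr (2 - 2 * q)" for t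
  proof -
    define D where "D = \<bar>X - h * t\<bar>"
    define w where "w = max 1 t powr (1 - real CARD('d) / 2) * D powr (- 2 * (1 - q))"
    have "cmod (err t) \<le> (far_const TYPE('d) M K 2 q + M * rho_far_const CARD('d) M K 2) * w"
    proof (rule norm_err_le[OF t(1)])
      show "cmod (green_inner Q g x t) \<le> far_const TYPE('d) M K 2 q * w"
        using far_bound[OF q0 q1 t(1,3) dist_drift[symmetric] t(2)] by (simp add: w_def D_def mult.assoc)
      have "rho t (rvec x) \<eta> \<Lambda> \<le> rho_far_const CARD('d) M K 2 * max 1 t powr ((2 - real CARD('d)) / 2) * D powr (- 2)"
        using rho_far[OF t(1) dist_drift[symmetric] t(2), of 2] by (simp add: D_def)
      also have "\<dots> \<le> rho_far_const CARD('d) M K 2 * max 1 t powr ((2 - real CARD('d)) / 2) * D powr (- 2 * (1 - q))"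
        using t q0 by (intro mult_left_mono powr_mono mult_nonneg_nonneg) (auto simp: D_def rho_far_const_def)
      also have "(2 - real CARD('d)) / 2 = 1 - real CARD('d) / 2" by (simp add: diff_divide_distrib)
      finally show "rho t (rvec x) \<eta> \<Lambda> \<le> rho_far_const CARD('d) M K 2 * w" by (simp add: w_def mult.assoc)
    qed
    also have "\<dots> \<le> majorant_const TYPE('d) M K z1 q * w" by (intro mult_right_mono Cge) (auto simp: w_def)
    finally show ?thesis by (simp add: w_def D_def mult.assoc)
  qed
  show "cmod (err t) \<le> majorant_const TYPE('d) M K z1 q * max 1 t powr (- 1 / 2) * \<bar>X - h * t\<bar> powr (- (real CARD('d) - 1) * (1 - q))"
    if d4: "4 \<le> CARD('d)" and t: "0 < t" "1 \<le> \<bar>X - h * t\<bar>" "t \<le> \<bar>X - h * t\<bar> powr (2 - 2 * q)" for t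
  proof -
    define D where "D = \<bar>X - h * t\<bar>"
    define N where "N = real CARD('d) - 1"
    have N: "N > 0" using d4 by (simp add: N_def)
    define w where "w = max 1 t powr (- 1 / 2) * D powr (- N * (1 - q))"
    have "cmod (err t) \<le> (far_const TYPE('d) M K N q + M * rho_far_const CARD('d) M K N) * w"
    proof (rule norm_err_le[OF t(1)])
      show "cmod (green_inner Q g x t) \<le> far_const TYPE('d) M K N q * w"
        using far_bound_high_dim[OF q0 q1 t(1,3) dist_drift[symmetric] t(2) d4] by (simp add: w_def D_def N_def mult.assoc)
      have "rho t (rvec x) \<eta> \<Lambda> \<le> rho_far_const CARD('d) M K N * max 1 t powr ((N - real CARD('d)) / 2) * D powr (- N)"
        using rho_far[OF t(1) dist_drift[symmetric] t(2) N] by (simp add: D_def)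
      also have "\<dots> \<le> rho_far_const CARD('d) M K N * max 1 t powr ((N - real CARD('d)) / 2) * D powr (- N * (1 - q))"
      proof (intro mult_left_mono powr_mono mult_nonneg_nonneg)
        have "0 \<le> N * q" using N q0 by simp
        then show "- N \<le> - N * (1 - q)" by (simp add: algebra_simps)
      qed (use t in \<open>auto simp: D_def rho_far_const_def\<close>)
      also have "(N - real CARD('d)) / 2 = - 1 / 2" by (simp add: N_def)
      finally show "rho t (rvec x) \<eta> \<Lambda> \<le> rho_far_const CARD('d) M K N * w" by (simp add: w_def mult.assoc)
    qed
    also have "\<dots> \<le> majorant_const TYPE('d) M K z1 q * w"
      unfolding N_def by (intro mult_right_mono Cge) (auto simp: w_def)
    finally show ?thesis by (simp add: w_def D_def N_def mult.assoc)
  qed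
qed

text \<open>The bound on the integral of \<open>err\<close> and the lower bound for the Brownian
  Green function share the factor \<open>T\<close>, which cancels in the quotient and leaves
  \<open>X powr (- q)\<close>. The additive form of \<open>e\<close> inside the bracket makes the
  argument independent of the size of ghat(0).\<close>

lemma green_asymptotics:
  assumes q: "q = z1 / 2 / (100 * (real CARD('d) + 1)\<^sup>2)"
    and Xq: "X \<ge> 2 * M" "X powr q \<ge> 8" "X powr q \<ge> (max 1 (2 / s0))\<^sup>2"
    and Kt: "Kt = (2 ^ (CARD('d) + 6) * (1 + M) + 8 * (max 1 (2 / s0))\<^sup>2) * majorant_const TYPE('d) M K z1 q"
  shows "set_integrable lborel {0<..} (\<lambda>t. green_inner Q g x t)"
    and "\<exists>e. green Q g x = complex_of_real (brownian_green (rvec x) \<eta> \<Lambda>) * (fourier g 0 + e) \<and>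
          cmod e \<le> Kt / green_lower_const CARD('d) M K * X powr (- q)"
proof -
  interpret G: green_majorant "CARD('d)" X h M q "z1 / 2" "majorant_const TYPE('d) M K z1 q" s0 "\<lambda>t. cmod (err t)"
    by (rule err_majorant[OF q Xq])
  let ?r = "\<lambda>t. rho t (rvec x) \<eta> \<Lambda>"
  define b where "b = brownian_green (rvec x) \<eta> \<Lambda>"
  define c where "c = green_lower_const CARD('d) M K"
  have c: "c > 0" using M by (simp add: c_def green_lower_const_def)
  have bT: "c * G.T \<le> b"
    using brownian_green_ge unfolding c_def b_def G.T_def G.S_def G.s_def .
  have b: "b > 0" using mult_pos_pos[OF c G.basic(6)] bT by linarith
  have Kt0: "Kt \<ge> 0" unfolding Kt using M G.C by (intro mult_nonneg_nonneg add_nonneg_nonneg) auto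
  have u: "upint (\<lambda>t. cmod (err t)) {0<..} \<le> ennreal (Kt * G.T * X powr (- q))"
    using G.total_bound by (simp add: Kt)
  have B: "Kt * G.T * X powr (- q) \<ge> 0" using Kt0 G.basic(6) by (intro mult_nonneg_nonneg) auto
  have m: "(\<lambda>t. indicator {0<..} t *\<^sub>R err t) \<in> borel_measurable borel" unfolding err_def by measurable
  note e = set_integrable_upint[OF m u B]
  have ri: "set_integrable lborel {0<..} (\<lambda>t. fourier g 0 * complex_of_real (?r t))"
    using integrable_of_real[OF rho_integrable[unfolded set_integrable_def], where 'a=complex]
    unfolding set_integrable_def by (simp add: scaleR_conv_of_real mult_ac integrable_mult_left)
  have gi: "green_inner Q g x t = fourier g 0 * complex_of_real (?r t) + err t" for t
    by (simp add: err_def)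
  show "set_integrable lborel {0<..} (\<lambda>t. green_inner Q g x t)"
    unfolding gi by (rule set_integral_add(1)[OF ri e(1)])
  have "(LINT t:{0<..}|lborel. fourier g 0 * complex_of_real (?r t)) = fourier g 0 * complex_of_real b"
    unfolding b_def brownian_green_def set_lebesgue_integral_def
    by (subst integral_complex_of_real[symmetric], subst integral_mult_right_zero[symmetric])
      (intro Bochner_Integration.integral_cong refl, simp add: scaleR_conv_of_real)
  then have eq: "green Q g x = complex_of_real b * fourier g 0 + (LINT t:{0<..}|lborel. err t)"
    unfolding green_def gi set_integral_add(2)[OF ri e(1)] by (simp add: mult.commute)
  show "\<exists>e. green Q g x = complex_of_real (brownian_green (rvec x) \<eta> \<Lambda>) * (fourier g 0 + e) \<and>
          cmod e \<le> Kt / green_lower_const CARD('d) M K * X powr (- q)"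
  proof (intro exI conjI)
    show "green Q g x = complex_of_real (brownian_green (rvec x) \<eta> \<Lambda>) * (fourier g 0 + (LINT t:{0<..}|lborel. err t) / complex_of_real b)"
      unfolding eq using b by (simp add: b_def[symmetric] distrib_left)
    have "cmod ((LINT t:{0<..}|lborel. err t) / complex_of_real b) = cmod (LINT t:{0<..}|lborel. err t) / b"
      using b by (simp add: norm_divide)
    also have "\<dots> \<le> (Kt * G.T * X powr (- q)) / (c * G.T)"
      using e(2) B b bT c G.basic(6) by (intro frac_le) auto
    also have "\<dots> = Kt / c * X powr (- q)" using G.basic(6) by simp
    finally show "cmod ((LINT t:{0<..}|lborel. err t) / complex_of_real b) \<le> Kt / green_lower_const CARD('d) M K * X powr (- q)"
      by (simp add: c_def)
  qed
qed

end

theorem theorem1p10: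
  fixes M K_IR \<zeta> s0 :: real
  assumes "M > 0" and "K_IR > 0" and "\<zeta> > 0" and "s0 > 0"
  shows "\<exists>\<epsilon> > 0. \<exists>C R. \<forall>Q g. (Q, g) \<in> class_Q M K_IR \<zeta> \<longrightarrow>
    (\<forall>x :: int ^ 'd::finite.
       x \<noteq> 0 \<longrightarrow>
       norm (rvec x) \<ge> R \<longrightarrow>
       drift Q = norm (drift Q) *\<^sub>R (rvec x /\<^sub>R norm (rvec x)) \<longrightarrow>
       (CARD('d) \<le> 2 \<longrightarrow> norm (rvec x) * norm (drift Q) \<ge> s0) \<longrightarrow>
       set_integrable lborel {0<..} (\<lambda>t. green_inner Q g x t) \<and>
       set_integrable lborel {0<..} (\<lambda>t. rho t (rvec x) (drift Q) (second_moment Q)) \<and>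
       (\<exists>e :: complex.
          green Q g x
            = complex_of_real (brownian_green (rvec x) (drift Q) (second_moment Q))
              * (fourier g 0 + e) \<and>
          cmod e \<le> C * norm (rvec x) powr (- \<epsilon>)))"
proof -
  define z where "z = min \<zeta> 1"
  \<comment> \<open>This exponent, like \<open>C\<close> and \<open>R\<close> below, is fixed before
    \<open>Q\<close>, \<open>g\<close> and \<open>x\<close> are introduced, which is the uniformity
    claimed. It agrees with the \<open>q\<close> of the locales because \<open>z\<close> is their
    \<open>z1\<close>.\<close>
  define q where "q = z / 2 / (100 * (real CARD('d) + 1)\<^sup>2)"
  define k where "k = max 8 ((max 1 (2 / s0))\<^sup>2)"
  define Kt where "Kt = (2 ^ (CARD('d) + 6) * (1 + M) + 8 * (max 1 (2 / s0))\<^sup>2) * majorant_const TYPE('d) M K_IR z q"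
  define C where "C = Kt / green_lower_const CARD('d) M K_IR"
  \<comment> \<open>Beyond \<open>R\<close> all largeness conditions of
    \<open>green_majorant\<close> hold: \<open>X >= 2\<close>, \<open>X >= 2 * M\<close>, and
    \<open>X powr q\<close> is at least 8 and at least the square of
    \<open>max 1 (2 / s0)\<close>.\<close>
  define R where "R = max (max 2 (2 * M)) (k powr (1 / q))"
  have q: "q > 0" unfolding q_def z_def using assms by (intro divide_pos_pos) auto
  have k: "k \<ge> 8" by (simp add: k_def)
  show ?thesis
  proof (rule exI[of _ q], intro conjI q, rule exI[of _ C], rule exI[of _ R], intro allI impI)
    fix Q g :: "int ^ 'd \<Rightarrow> real" and x :: "int ^ 'd"
    assume cl: "(Q, g) \<in> class_Q M K_IR \<zeta>" and R: "norm (rvec x) \<ge> R"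
      and al: "drift Q = norm (drift Q) *\<^sub>R (rvec x /\<^sub>R norm (rvec x))"
      and low: "CARD('d) \<le> 2 \<longrightarrow> norm (rvec x) * norm (drift Q) \<ge> s0"
    have R': "norm (rvec x) \<ge> 2" "norm (rvec x) \<ge> 2 * M" "norm (rvec x) \<ge> k powr (1 / q)"
      using R by (auto simp: R_def)
    have "k = (k powr (1 / q)) powr q" using q k by (simp add: powr_powr)
    also have "\<dots> \<le> norm (rvec x) powr q" using R' q by (intro powr_mono2) auto
    finally have Xk: "norm (rvec x) powr q \<ge> 8" "norm (rvec x) powr q \<ge> (max 1 (2 / s0))\<^sup>2"
      by (auto simp: k_def)
    interpret class_pair Q g M K_IR \<zeta> by standard (use cl assms in auto)
    interpret aligned_point Q g M K_IR \<zeta> x "norm (rvec x)" "norm (drift Q)" s0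
      by standard (use R' al low assms in auto)
    have z1: "z1 = z" by (simp add: z1_def z_def)
    have q': "q = z1 / 2 / (100 * (real CARD('d) + 1)\<^sup>2)" by (simp add: q_def z1)
    have Kt': "Kt = (2 ^ (CARD('d) + 6) * (1 + M) + 8 * (max 1 (2 / s0))\<^sup>2) * majorant_const TYPE('d) M K_IR z1 q"
      by (simp add: Kt_def z1)
    show "set_integrable lborel {0<..} (\<lambda>t. green_inner Q g x t) \<and>
       set_integrable lborel {0<..} (\<lambda>t. rho t (rvec x) (drift Q) (second_moment Q)) \<and>
       (\<exists>e :: complex.
          green Q g x
            = complex_of_real (brownian_green (rvec x) (drift Q) (second_moment Q))
              * (fourier g 0 + e) \<and>
          cmod e \<le> C * norm (rvec x) powr (- q))"
      using green_asymptotics[OF q' R'(2) Xk Kt'] rho_integrable unfolding C_def by blast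
  qed
qed

end
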